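(* Consider a standard gambling game $(X,Y,\Gamma,\Lambda,u)$, with $\lambda$-discounted values $v_\lambda$, $\lambda\in(0,1]$. 1. If at least one of the two gambling houses $\Gamma$, $\Lambda$ is strongly acyclic, then $(v_\lambda)$ converges uniformly on $X\times Y$ as $\lambda\to 0$ to a function $v$, which is the unique function in $\mathcal C(X\times Y)$ satisfying all of the following: (a) $v$ is excessive: for all $(x,y)\in X\times Y$, $v(x,y)=\max_{p\in\Gamma(x)}\tilde v(p,y)$; (b) $v$ is depressive: for all $(x,y)\in X\times Y$, $v(x,y)=\min_{q\in\Lambda(y)}\tilde v(x,q)$; (c) (P1) for all $(x,y)\in X\times Y$ there exists $p\in\Gamma^\infty(x)$ such that $v(x,y)=\tilde v(p,y)\le \tilde u(p,y)$; (d) (P2) for all $(x,y)\in X\times Y$ there exists $q\in\Lambda^\infty(y)$ such that $v(x,y)=\tilde v(x,q)\ge \tilde u(x,q)$. Moreover, $v$ is the largest function in $\mathcal C(X\times Y)$ that is excessive, depressive and satisfies (P1), and $v$ is the smallest function in $\mathcal C(X\times Y)$ that is excessive, depressive and satisfies (P2). 2. If both gambling houses are only assumed to be weakly acyclic, convergence may fail: there exists a standard gambling game in which both gambling houses are weakly acyclic and such that $(v_\lambda)$ does not converge as $\lambda\to0$.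
   Context: For a compact metric space $S$: $\Delta(S)$ is the set of Borel probabilities on $S$ (weak-* topology, metrized by the Kantorovich–Rubinstein distance $d_{KR}(p,p')=\sup\{|\int f\,dp-\int f\,dp'| : f \text{ 1-Lipschitz on } S\}$), $\mathcal B(S)$ the bounded measurable real functions, $\mathcal C(S)$ the continuous real functions, $\delta_s$ the Dirac mass at $s$ (identified with $s$). For $\varphi\in\mathcal B(S)$, $\tilde\varphi(p)=\int\varphi\,dp$. For $v\in\mathcal B(X\times Y)$, $\tilde v(p,q)=\int\int v(x,y)\,dp(x)\,dq(y)$, $\tilde v(p,y)=\tilde v(p,\delta_y)$, $\tilde v(x,q)=\tilde v(\delta_x,q)$; likewise for $\tilde u$. A standard gambling game consists of nonempty compact metric spaces $X,Y$, a continuous payoff $u:X\times Y\to\mathbb R$, and multifunctions (gambling houses) $\Gamma:X\rightrightarrows\Delta(X)$, $\Lambda:Y\rightrightarrows\Delta(Y)$ with nonempty convex compact values which are leavable ($\delta_x\in\Gamma(x)$, $\delta_y\in\Lambda(y)$ for all $x,y$) and non expansive (for all $x,x'\in X$ and $p\in\Gamma(x)$ there is $p'\in\Gamma(x')$ with $d_{KR}(p,p')\le d(x,x')$; similarly for $\Lambda$). For $\lambda\in(0,1]$, $v_\lambda$ is the unique element of $\mathcal C(X\times Y)$ such that for all $(x,y)$: $v_\lambda(x,y)=\max_{p\in\Gamma(x)}\min_{q\in\Lambda(y)}(\lambda u(x,y)+(1-\lambda)\tilde v_\lambda(p,q))=\min_{q\in\Lambda(y)}\max_{p\in\Gamma(x)}(\lambda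 u(x,y)+(1-\lambda)\tilde v_\lambda(p,q))$. $\tilde\Gamma:\Delta(X)\rightrightarrows\Delta(X)$ is the multifunction whose graph is the closed convex hull of $\{(\delta_x,p):x\in X,\,p\in\Gamma(x)\}$ in $\Delta(X)\times\Delta(X)$; $\tilde\Gamma^0(p)=\{p\}$, $\tilde\Gamma^{n+1}=\tilde\Gamma^n\circ\tilde\Gamma$ (composition of multifunctions). $\Gamma^\infty(x)$ is the closure of $\bigcup_{n\ge0}\tilde\Gamma^n(\delta_x)$ in $\Delta(X)$. $\tilde\Lambda$, $\tilde\Lambda^n$ and $\Lambda^\infty(y)$ are defined similarly. $\Gamma$ is weakly acyclic if there is a lower semicontinuous $\varphi\in\mathcal B(X)$ with $\operatorname{Argmax}_{p\in\Gamma(x)}\tilde\varphi(p)=\{\delta_x\}$ for all $x\in X$; it is strongly acyclic if there is a lower semicontinuous $\varphi\in\mathcal B(X)$ with $\operatorname{Argmax}_{p\in\Gamma^\infty(x)}\tilde\varphi(p)=\{\delta_x\}$ for all $x\in X$. $\Lambda$ is weakly (resp. strongly) acyclic if there is an upper semicontinuous $\psi\in\mathcal B(Y)$ with $\operatorname{Argmin}_{q\in\Lambda(y)}\tilde\psi(q)=\{\delta_y\}$ (resp. $\operatorname{Argmin}_{q\in\Lambda^\infty(y)}\tilde\psi(q)=\{\delta_y\}$) for all $y\in Y$. *)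

theory Defs
  imports "HOL-Probability.Probability"
begin

section \<open>Borel probabilities on a compact metric space\<close>

text \<open>A compact metric space is a compact subset \<open>S\<close> of a metric-space type; functions on \<open>S\<close> are
  functions on the whole type of which only the values on \<open>S\<close> matter.\<close>

abbreviation borel_on :: "'a::metric_space set \<Rightarrow> 'a measure" where
  "borel_on S \<equiv> restrict_space borel S"

definition Delta :: "'a::metric_space set \<Rightarrow> 'a measure set" where
  "Delta S = {p. prob_space p \<and> sets p = sets (borel_on S)}"

definition dirac :: "'a::metric_space set \<Rightarrow> 'a \<Rightarrow> 'a measure" where
  "dirac S s = return (borel_on S) s"

text \<open>The weak-* topology: the coarsest one making \<open>p \<mapsto> \<integral>f dp\<close> continuous for all continuous \<open>f\<close>.\<close>

definition weak_star :: "'a::metric_space set \<Rightarrow> 'a measure topology" where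
  "weak_star S = topology_generated_by
     {{p \<in> Delta S. (LINT s|p. f s) \<in> U} | (f :: 'a \<Rightarrow> real) U. continuous_on S f \<and> open U}"

definition dKR :: "'a::metric_space set \<Rightarrow> 'a measure \<Rightarrow> 'a measure \<Rightarrow> real" where
  "dKR S p p' = (SUP f \<in> {f :: 'a \<Rightarrow> real. 1-lipschitz_on S f}. \<bar>(LINT s|p. f s) - (LINT s|p'. f s)\<bar>)"

definition bdd_measurable :: "'a::metric_space set \<Rightarrow> ('a \<Rightarrow> real) \<Rightarrow> bool" where
  "bdd_measurable S \<phi> \<longleftrightarrow> \<phi> \<in> borel_measurable (borel_on S) \<and> bounded (\<phi> ` S)"

text \<open>The convex combination \<open>(1 - t) p + t q\<close> of two measures.\<close>

definition mix :: "real \<Rightarrow> 'a measure \<Rightarrow> 'a measure \<Rightarrow> 'a measure" where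
  "mix t p q = measure_of (space p) (sets p)
     (\<lambda>A. ennreal (1 - t) * emeasure p A + ennreal t * emeasure q A)"

lemma emeasure_mix:
  assumes "sets q = sets p" "A \<in> sets p"
  shows "emeasure (mix t p q) A = ennreal (1 - t) * emeasure p A + ennreal t * emeasure q A"
proof (rule emeasure_measure_of[OF mix_def])
  show "countably_additive (sets (mix t p q))
      (\<lambda>A. ennreal (1 - t) * emeasure p A + ennreal t * emeasure q A)"
    unfolding countably_additive_def
  proof (intro allI impI)
    fix B :: "nat \<Rightarrow> 'a set"
    assume B: "range B \<subseteq> sets (mix t p q)" "disjoint_family B"
    have "sets (mix t p q) = sets p"
      by (simp add: mix_def)
    with B(1) have "range B \<subseteq> sets p" "range B \<subseteq> sets q"
      using assms(1) by auto
    then show "(\<Sum>i. ennreal (1 - t) * emeasure p (B i) + ennreal t * emeasure q (B i)) =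
        ennreal (1 - t) * emeasure p (\<Union>i. B i) + ennreal t * emeasure q (\<Union>i. B i)"
      using B(2) by (simp add: suminf_add[symmetric] ennreal_suminf_cmult suminf_emeasure)
  qed
qed (use assms sets.space_closed in \<open>auto simp: positive_def mix_def\<close>)

lemma topspace_weak_star: "topspace (weak_star S) = Delta S"
proof
  have "Delta S = {p \<in> Delta S. (LINT s|p. (0::real)) \<in> UNIV} \<and> continuous_on S (\<lambda>_. 0::real)"
    by simp
  then show "Delta S \<subseteq> topspace (weak_star S)"
    unfolding weak_star_def topology_generated_by_topspace
    by (intro Union_upper CollectI exI[of _ "\<lambda>_. 0"] exI[of _ UNIV]) auto
qed (auto simp: weak_star_def)

definition convex_measures :: "'a measure set \<Rightarrow> bool" where
  "convex_measures C \<longleftrightarrow> (\<forall>p\<in>C. \<forall>q\<in>C. \<forall>t\<in>{0..1}. mix t p q \<in> C)"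

definition convex_measure_pairs :: "('a measure \<times> 'a measure) set \<Rightarrow> bool" where
  "convex_measure_pairs C \<longleftrightarrow>
     (\<forall>(p, p')\<in>C. \<forall>(q, q')\<in>C. \<forall>t\<in>{0..1}. (mix t p q, mix t p' q') \<in> C)"

definition is_max :: "real set \<Rightarrow> real \<Rightarrow> bool" where
  "is_max A m \<longleftrightarrow> m \<in> A \<and> (\<forall>a\<in>A. a \<le> m)"

definition is_min :: "real set \<Rightarrow> real \<Rightarrow> bool" where
  "is_min A m \<longleftrightarrow> m \<in> A \<and> (\<forall>a\<in>A. m \<le> a)"

definition lsc_on :: "'a::metric_space set \<Rightarrow> ('a \<Rightarrow> real) \<Rightarrow> bool" where
  "lsc_on S \<phi> \<longleftrightarrow> (\<forall>s\<in>S. \<forall>c<\<phi> s. \<forall>\<^sub>F s' in at s within S. c < \<phi> s')"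

definition usc_on :: "'a::metric_space set \<Rightarrow> ('a \<Rightarrow> real) \<Rightarrow> bool" where
  "usc_on S \<psi> \<longleftrightarrow> (\<forall>s\<in>S. \<forall>c>\<psi> s. \<forall>\<^sub>F s' in at s within S. \<psi> s' < c)"


section \<open>Gambling houses\<close>

definition gambling_house :: "'a::metric_space set \<Rightarrow> ('a \<Rightarrow> 'a measure set) \<Rightarrow> bool" where
  "gambling_house S \<Gamma> \<longleftrightarrow>
     (\<forall>x\<in>S. \<Gamma> x \<subseteq> Delta S \<and> \<Gamma> x \<noteq> {} \<and> convex_measures (\<Gamma> x) \<and> compactin (weak_star S) (\<Gamma> x)) \<and>
     (\<forall>x\<in>S. dirac S x \<in> \<Gamma> x) \<and>
     (\<forall>x\<in>S. \<forall>x'\<in>S. \<forall>p\<in>\<Gamma> x. \<exists>p'\<in>\<Gamma> x'. dKR S p p' \<le> dist x x')"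

text \<open>The multifunction \<open>\<Gamma>\<close> extended to \<open>\<Delta>(S)\<close>, as its graph.\<close>

definition house_ext ::
  "'a::metric_space set \<Rightarrow> ('a \<Rightarrow> 'a measure set) \<Rightarrow> ('a measure \<times> 'a measure) set" where
  "house_ext S \<Gamma> =
     (\<lambda>C. C \<subseteq> Delta S \<times> Delta S \<and> convex_measure_pairs C \<and>
          closedin (prod_topology (weak_star S) (weak_star S)) C)
     hull {(dirac S x, p) | x p. x \<in> S \<and> p \<in> \<Gamma> x}"

definition house_inf ::
  "'a::metric_space set \<Rightarrow> ('a \<Rightarrow> 'a measure set) \<Rightarrow> 'a \<Rightarrow> 'a measure set" where
  "house_inf S \<Gamma> x = weak_star S closure_of (\<Union>n. (house_ext S \<Gamma> ^^ n) `` {dirac S x})"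

definition acyclic_max :: "'a::metric_space set \<Rightarrow> ('a \<Rightarrow> 'a measure set) \<Rightarrow> bool" where
  "acyclic_max S G \<longleftrightarrow> (\<exists>\<phi>. bdd_measurable S \<phi> \<and> lsc_on S \<phi> \<and>
     (\<forall>x\<in>S. {p. is_arg_max (\<lambda>p. LINT s|p. \<phi> s) (\<lambda>p. p \<in> G x) p} = {dirac S x}))"

definition acyclic_min :: "'a::metric_space set \<Rightarrow> ('a \<Rightarrow> 'a measure set) \<Rightarrow> bool" where
  "acyclic_min S G \<longleftrightarrow> (\<exists>\<psi>. bdd_measurable S \<psi> \<and> usc_on S \<psi> \<and>
     (\<forall>x\<in>S. {p. is_arg_min (\<lambda>p. LINT s|p. \<psi> s) (\<lambda>p. p \<in> G x) p} = {dirac S x}))"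

text \<open>Suffix 1 is for \<open>\<Gamma>\<close> (the maximizing player), suffix 2 for \<open>\<Lambda>\<close> (the minimizing player).\<close>

abbreviation "weakly_acyclic1 X \<Gamma> \<equiv> acyclic_max X \<Gamma>"
abbreviation "strongly_acyclic1 X \<Gamma> \<equiv> acyclic_max X (house_inf X \<Gamma>)"
abbreviation "weakly_acyclic2 Y \<Lambda> \<equiv> acyclic_min Y \<Lambda>"
abbreviation "strongly_acyclic2 Y \<Lambda> \<equiv> acyclic_min Y (house_inf Y \<Lambda>)"


section \<open>Standard gambling games\<close>

definition standard_gambling_game ::
  "'a::metric_space set \<Rightarrow> 'b::metric_space set \<Rightarrow> ('a \<Rightarrow> 'a measure set) \<Rightarrow>
   ('b \<Rightarrow> 'b measure set) \<Rightarrow> ('a \<times> 'b \<Rightarrow> real) \<Rightarrow> bool" where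
  "standard_gambling_game X Y \<Gamma> \<Lambda> u \<longleftrightarrow>
     compact X \<and> X \<noteq> {} \<and> compact Y \<and> Y \<noteq> {} \<and> continuous_on (X \<times> Y) u \<and>
     gambling_house X \<Gamma> \<and> gambling_house Y \<Lambda>"

definition bilin :: "('a \<times> 'b \<Rightarrow> real) \<Rightarrow> 'a measure \<Rightarrow> 'b measure \<Rightarrow> real" where
  "bilin v p q = (LINT y|q. LINT x|p. v (x, y))"

definition is_max_min :: "'p set \<Rightarrow> 'q set \<Rightarrow> ('p \<Rightarrow> 'q \<Rightarrow> real) \<Rightarrow> real \<Rightarrow> bool" where
  "is_max_min A B F w \<longleftrightarrow> (\<exists>m. (\<forall>p\<in>A. is_min (F p ` B) (m p)) \<and> is_max (m ` A) w)"

definition is_min_max :: "'p set \<Rightarrow> 'q set \<Rightarrow> ('p \<Rightarrow> 'q \<Rightarrow> real) \<Rightarrow> real \<Rightarrow> bool" where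
  "is_min_max A B F w \<longleftrightarrow> (\<exists>m. (\<forall>q\<in>B. is_max ((\<lambda>p. F p q) ` A) (m q)) \<and> is_min (m ` B) w)"

text \<open>\<open>w\<close> is the \<open>l\<close>-discounted value; on \<open>X \<times> Y\<close> it is unique, as the fixed point of a
  contraction when \<open>0 < l \<le> 1\<close>.\<close>

definition discounted_value ::
  "'a::metric_space set \<Rightarrow> 'b::metric_space set \<Rightarrow> ('a \<Rightarrow> 'a measure set) \<Rightarrow>
   ('b \<Rightarrow> 'b measure set) \<Rightarrow> ('a \<times> 'b \<Rightarrow> real) \<Rightarrow> real \<Rightarrow> ('a \<times> 'b \<Rightarrow> real) \<Rightarrow> bool" where
  "discounted_value X Y \<Gamma> \<Lambda> u l w \<longleftrightarrow> continuous_on (X \<times> Y) w \<and>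
     (\<forall>x\<in>X. \<forall>y\<in>Y.
        is_max_min (\<Gamma> x) (\<Lambda> y) (\<lambda>p q. l * u (x, y) + (1 - l) * bilin w p q) (w (x, y)) \<and>
        is_min_max (\<Gamma> x) (\<Lambda> y) (\<lambda>p q. l * u (x, y) + (1 - l) * bilin w p q) (w (x, y)))"

definition excessive ::
  "'a::metric_space set \<Rightarrow> 'b::metric_space set \<Rightarrow> ('a \<Rightarrow> 'a measure set) \<Rightarrow> ('a \<times> 'b \<Rightarrow> real) \<Rightarrow> bool" where
  "excessive X Y \<Gamma> v \<longleftrightarrow>
     (\<forall>x\<in>X. \<forall>y\<in>Y. is_max ((\<lambda>p. bilin v p (dirac Y y)) ` \<Gamma> x) (v (x, y)))"

definition depressive ::
  "'a::metric_space set \<Rightarrow> 'b::metric_space set \<Rightarrow> ('b \<Rightarrow> 'b measure set) \<Rightarrow> ('a \<times> 'b \<Rightarrow> real) \<Rightarrow> bool" where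
  "depressive X Y \<Lambda> v \<longleftrightarrow>
     (\<forall>x\<in>X. \<forall>y\<in>Y. is_min ((\<lambda>q. bilin v (dirac X x) q) ` \<Lambda> y) (v (x, y)))"

definition P1 ::
  "'a::metric_space set \<Rightarrow> 'b::metric_space set \<Rightarrow> ('a \<Rightarrow> 'a measure set) \<Rightarrow>
   ('a \<times> 'b \<Rightarrow> real) \<Rightarrow> ('a \<times> 'b \<Rightarrow> real) \<Rightarrow> bool" where
  "P1 X Y \<Gamma> u v \<longleftrightarrow> (\<forall>x\<in>X. \<forall>y\<in>Y. \<exists>p\<in>house_inf X \<Gamma> x.
     v (x, y) = bilin v p (dirac Y y) \<and> bilin v p (dirac Y y) \<le> bilin u p (dirac Y y))"

definition P2 ::
  "'a::metric_space set \<Rightarrow> 'b::metric_space set \<Rightarrow> ('b \<Rightarrow> 'b measure set) \<Rightarrow>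
   ('a \<times> 'b \<Rightarrow> real) \<Rightarrow> ('a \<times> 'b \<Rightarrow> real) \<Rightarrow> bool" where
  "P2 X Y \<Lambda> u v \<longleftrightarrow> (\<forall>x\<in>X. \<forall>y\<in>Y. \<exists>q\<in>house_inf Y \<Lambda> y.
     v (x, y) = bilin v (dirac X x) q \<and> bilin v (dirac X x) q \<ge> bilin u (dirac X x) q)"

text \<open>The space of bounded real sequences with the sup metric.  Every compact metric space embeds
  isometrically into it (Frechet), so that "there is a compact metric space" is the same as
  "there is a compact subset of this type".\<close>

type_synonym linf = "(nat, real) bcontfun"

end

theory Submission
  imports Defs "HOL-Complex_Analysis.Great_Picard"
begin

text \<open>
  Every discounted value has the same approximate Lipschitz constants as the payoff, so the family is
  relatively compact; it remains to see that there is only one limit point as \<open>\<lambda> \<rightarrow> 0\<close>.  A limit point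
  \<open>v\<close> satisfies the equation with \<open>\<lambda> = 0\<close>, which under acyclicity of one house forces it to be excessive and
  depressive.  For (P1), let player 1 play optimally in the \<open>\<lambda>\<close>-game against an immobile opponent: as long
  as the mean payoff is below the mean of \<open>v\<^sub>\<lambda>\<close> by \<open>\<epsilon>\<close>, each stage raises the latter by at least
  \<open>\<lambda> \<epsilon>\<close>, so that after finitely many stages the payoff is good enough.  Uniqueness
  is a maximum principle: on the set where \<open>v - w\<close> is maximal take a point at which the potential of the
  strongly acyclic house is minimal; there (P1) can only be satisfied by staying, and (P2) for \<open>w\<close> leads to
  a contradiction.

  For the counterexample both players move between two states \<open>a\<close>, \<open>b\<close>, moving with probability \<open>\<alpha>\<close> at
  the price of being absorbed in a losing state \<open>c\<close> with probability about \<open>\<alpha>\<^sup>2\<close>; player 1 wants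
  the states to agree, player 2 wants them to differ.  The value depends on the best ratio
  \<open>\<alpha> / (\<lambda>/(1-\<lambda>) + \<gamma>)\<close> over the available pairs \<open>(\<alpha>, \<gamma>)\<close>, and it oscillates if one of the
  players can use the optimal \<open>\<alpha> \<approx> sqrt \<lambda>\<close> only when it is close to a power of \<open>1/4\<close>.
\<close>

section \<open>Integration over Borel probabilities\<close>

text \<open>Sequential compactness of \<open>Delta S\<close> is brought over from the line by a
  ternary code of membership in countably many balls; its inverse is uniformly continuous even
  though the code need not be continuous. The same compactness replaces measurable selections: moves
  are chosen at finitely many points only, and the graph of the extended house is convex and closed.
  Regularity is measured by a pair (\<open>e\<close>, \<open>L\<close>) rather than a modulus of
  continuity, because nonexpansive houses transport Lipschitz bounds through the
  Kantorovich-Rubinstein distance.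

  Strong acyclicity enters through the comparison: the measures in (P1) and (P2) come from
  \<open>house_inf\<close>, so the potential has to drop along these, not only along single moves.

  In the counterexample a transfer from \<open>a\<close> to \<open>b\<close> that is split into many
  small steps has vanishing total risk, so weak acyclicity does not become strong. If
  \<open>d\<close> and \<open>1 - e\<close> are the values at unequal and equal states and
  \<open>\<Delta> = 1 - e - d\<close>, the discounted equations decouple into
  \<open>d = k1 * \<Delta>\<close> and \<open>e = k2 * \<Delta>\<close> with \<open>k1\<close>,
  \<open>k2\<close> the best ratios of the players; this gives
  \<open>d = k1 / (1 + k1 + k2)\<close>.\<close>

abbreviation E :: "'a measure \<Rightarrow> ('a \<Rightarrow> real) \<Rightarrow> real" where
  "E p f \<equiv> integral\<^sup>L p f"

lemma Delta_space: "p \<in> Delta S \<Longrightarrow> space p = S"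
  by (auto simp: Delta_def space_restrict_space dest: sets_eq_imp_space_eq)

lemma Delta_sets: "p \<in> Delta S \<Longrightarrow> sets p = sets (borel_on S)"
  by (auto simp: Delta_def)

lemma Delta_prob: "p \<in> Delta S \<Longrightarrow> prob_space p"
  by (auto simp: Delta_def)

lemma Delta_measurable: "p \<in> Delta S \<Longrightarrow> f \<in> borel_measurable (borel_on S) \<Longrightarrow> f \<in> borel_measurable p"
  by (simp add: measurable_cong_sets[OF Delta_sets refl])

lemma bdd_measurable_integrable:
  assumes "bdd_measurable S f" "p \<in> Delta S" shows "integrable p f"
proof -
  interpret prob_space p by (rule Delta_prob[OF assms(2)])
  obtain B where "\<forall>y\<in>f ` S. norm y \<le> B"
    using assms(1) unfolding bdd_measurable_def bounded_iff by blast
  then show ?thesis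
    using assms Delta_measurable[OF assms(2)] Delta_space[OF assms(2)]
    by (intro integrable_const_bound[where B = B]) (auto simp: bdd_measurable_def)
qed

lemma continuous_bdd_measurable:
  "compact S \<Longrightarrow> continuous_on S f \<Longrightarrow> bdd_measurable S f"
  by (simp add: bdd_measurable_def borel_measurable_continuous_on_restrict compact_continuous_image
      compact_imp_bounded)

lemma continuous_integrable:
  "compact S \<Longrightarrow> continuous_on S f \<Longrightarrow> p \<in> Delta S \<Longrightarrow> integrable p (f :: _ \<Rightarrow> real)"
  by (rule bdd_measurable_integrable[OF continuous_bdd_measurable])

lemma integral_le:
  assumes "p \<in> Delta S" "integrable p f" "integrable p g" "\<And>s. s \<in> S \<Longrightarrow> f s \<le> g s"
  shows "E p f \<le> E p g"
  using assms by (intro integral_mono) (auto simp: Delta_space)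

lemma integral_const_Delta: "p \<in> Delta S \<Longrightarrow> (LINT s|p. c) = (c::real)"
  using Delta_prob prob_space.prob_space by fastforce

lemma integral_cong_Delta:
  "p \<in> Delta S \<Longrightarrow> (\<And>s. s \<in> S \<Longrightarrow> f s = g s) \<Longrightarrow> E p f = E p g"
  by (intro Bochner_Integration.integral_cong) (auto simp: Delta_space)

lemma dirac_in_Delta: "s \<in> S \<Longrightarrow> dirac S s \<in> Delta S"
  by (auto simp: Delta_def dirac_def space_restrict_space intro: prob_space_return)

lemma integral_dirac:
  "s \<in> S \<Longrightarrow> f \<in> borel_measurable (borel_on S) \<Longrightarrow> E (dirac S s) f = (f s :: real)"
  unfolding dirac_def by (intro integral_return) (auto simp: space_restrict_space)

lemma integral_dirac_cont:
  "s \<in> S \<Longrightarrow> continuous_on S f \<Longrightarrow> E (dirac S s) f = (f s :: real)"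
  by (intro integral_dirac borel_measurable_continuous_on_restrict)

section \<open>Integrals against convex combinations of measures\<close>

lemma sets_mix [simp]: "sets (mix t p q) = sets p" and space_mix [simp]: "space (mix t p q) = space p"
  by (simp_all add: mix_def)

text \<open>\<open>mix\<close> prescribes measures of sets, that is, integrals of indicators;
  monotone class induction extends the formula to nonnegative functions.\<close>

lemma nn_integral_mix:
  assumes "sets q = sets p" "f \<in> borel_measurable p"
  shows "(\<integral>\<^sup>+x. f x \<partial>mix t p q) = ennreal (1-t) * (\<integral>\<^sup>+x. f x \<partial>p) + ennreal t * (\<integral>\<^sup>+x. f x \<partial>q)"
  using assms(2)
proof (induction rule: borel_measurable_induct)
  case (cong f g)
  have "space q = space p" using assms(1) by (rule sets_eq_imp_space_eq)
  then have "(\<integral>\<^sup>+x. f x \<partial>M) = (\<integral>\<^sup>+x. g x \<partial>M)" if "M \<in> {p, q, mix t p q}" for M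
    using cong(3) that by (intro nn_integral_cong) auto
  then show ?case using cong by simp
next
  case (set A)
  then show ?case using assms(1) by (simp add: emeasure_mix)
next
  case (mult u c)
  note [measurable] = \<open>u \<in> borel_measurable p\<close> and [measurable_cong] = assms(1) sets_mix
  show ?case by (simp add: nn_integral_cmult mult algebra_simps)
next
  case (add u v)
  note [measurable] = \<open>u \<in> borel_measurable p\<close> \<open>v \<in> borel_measurable p\<close> and [measurable_cong] = assms(1) sets_mix
  show ?case by (simp add: nn_integral_add add algebra_simps)
next
  case (seq U)
  note [measurable] = seq(1) and [measurable_cong] = assms(1) sets_mix
  have *: "(\<integral>\<^sup>+x. (SUP u\<in>range U. u x) \<partial>M) = (SUP i. \<integral>\<^sup>+x. U i x \<partial>M)" if "M \<in> {p, q, mix t p q}" for M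
    using that \<open>incseq U\<close> by (auto simp: image_comp intro!: nn_integral_monotone_convergence_SUP)
  have inc: "incseq (\<lambda>i. \<integral>\<^sup>+x. U i x \<partial>M)" for M
    using \<open>incseq U\<close> by (auto simp: incseq_def le_fun_def intro!: nn_integral_mono)
  have inc': "incseq (\<lambda>i. c * \<integral>\<^sup>+x. U i x \<partial>M)" for M and c :: ennreal
    using inc by (auto simp: incseq_def intro: mult_left_mono)
  show ?case
    by (simp add: * seq ennreal_SUP_add[OF inc' inc'] SUP_mult_left_ennreal)
qed

lemma integral_mix:
  fixes f :: "'a \<Rightarrow> real"
  assumes "sets q = sets p" "integrable p f" "integrable q f" and t: "t \<in> {0..1}"
  shows "E (mix t p q) f = (1-t) * E p f + t * E q f"
proof -
  have f: "f \<in> borel_measurable p" using assms by auto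
  have e: "enn2real (ennreal (1-t) * a + ennreal t * b) = (1-t) * enn2real a + t * enn2real b"
    if "a < \<infinity>" "b < \<infinity>" for a b :: ennreal
    using t that by (cases a; cases b) (auto simp: ennreal_mult[symmetric] ennreal_plus[symmetric] simp del: ennreal_plus)
  have n: "(\<integral>\<^sup>+x. ennreal (f x) \<partial>M) < \<infinity>" "(\<integral>\<^sup>+x. ennreal (- f x) \<partial>M) < \<infinity>" if "M \<in> {p, q}" for M
    using that assms(2,3) by (auto simp: real_integrable_def less_top[symmetric])
  have "integrable (mix t p q) f"
    unfolding real_integrable_def
    using f n[of p] n[of q] by (auto simp: nn_integral_mix assms(1) measurable_cong_sets[OF sets_mix] ennreal_mult_eq_top_iff)
  then show ?thesis
    using assms(2,3) n[of p] n[of q] f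
    by (simp add: real_lebesgue_integral_def nn_integral_mix assms(1) e) (simp add: algebra_simps)
qed

lemma mix_in_Delta:
  assumes "p \<in> Delta S" "q \<in> Delta S" "t \<in> {0..1}"
  shows "mix t p q \<in> Delta S"
proof -
  have s: "sets q = sets p" and sp: "space p = S" "space q = S" using assms by (auto simp: Delta_sets Delta_space)
  have "emeasure p (space p) = 1" "emeasure q (space q) = 1"
    using assms Delta_prob prob_space.emeasure_space_1 by blast+
  then have "emeasure (mix t p q) (space (mix t p q)) = 1"
    using assms(3) sp emeasure_mix[OF s, of "space p" t] sets.top[of p]
    by (simp add: ennreal_plus[symmetric] del: ennreal_plus sets.top)
  then show ?thesis using assms s by (auto simp: Delta_def intro: prob_spaceI)
qed

lemma integral_mix_Delta:
  assumes "compact S" "continuous_on S f" "p \<in> Delta S" "q \<in> Delta S" "t \<in> {0..1}"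
  shows "E (mix t p q) f = (1-t) * E p f + t * E q f"
  using assms by (intro integral_mix continuous_integrable) (auto simp: Delta_sets)

section \<open>The weak-* topology\<close>

lemma continuous_map_integral:
  assumes "continuous_on S f"
  shows "continuous_map (weak_star S) euclideanreal (\<lambda>p. E p f)"
proof -
  have "openin (weak_star S) {p \<in> Delta S. E p f \<in> U}" if "open U" for U
    unfolding weak_star_def using assms that by (intro topology_generated_by_Basis) blast
  then show ?thesis by (auto simp: continuous_map_def topspace_weak_star)
qed

text \<open>The sets that contain \<open>P n\<close> eventually as soon as they contain
  \<open>p\<close> include the generators of the topology and are stable under finite intersections
  and unions. Hence testing against continuous functions is enough.\<close>

lemma limitin_weak_star:
  assumes p: "p \<in> Delta S" and P: "\<And>n. P n \<in> Delta S"
    and lim: "\<And>f. continuous_on S f \<Longrightarrow> (\<lambda>n. E (P n) f) \<longlonglongrightarrow> E p f"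
  shows "limitin (weak_star S) P p sequentially"
proof -
  have "p \<in> U \<longrightarrow> (\<forall>\<^sub>F n in sequentially. P n \<in> U)" if "openin (weak_star S) U" for U
    using that unfolding weak_star_def openin_topology_generated_by_iff
  proof (induction rule: generate_topology_on.induct)
    case (Basis s)
    then obtain f V where s: "s = {p \<in> Delta S. E p f \<in> V}" "continuous_on S f" "open V"
      unfolding mem_Collect_eq by (elim exE conjE) (rule that)
    show ?case
    proof
      assume "p \<in> s"
      then have "\<forall>\<^sub>F n in sequentially. E (P n) f \<in> V"
        using s(1) topological_tendstoD[OF lim[OF s(2)] s(3)] by simp
      then show "\<forall>\<^sub>F n in sequentially. P n \<in> s" using P s by simp
    qed
  next
    case (Int a b)
    then show ?case by (simp add: eventually_conj_iff)
  next
    case (UN K)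
    show ?case
    proof
      assume "p \<in> \<Union>K"
      then obtain k where k: "k \<in> K" "p \<in> k" by blast
      then have "\<forall>\<^sub>F n in sequentially. P n \<in> k" using UN by simp
      then show "\<forall>\<^sub>F n in sequentially. P n \<in> \<Union>K"
        using k(1) by (auto elim!: eventually_mono)
    qed
  qed simp
  then show ?thesis using p by (auto simp: limitin_def topspace_weak_star)
qed

lemma compactin_attains_max:
  assumes "compactin (weak_star S) C" "C \<noteq> {}" "continuous_on S f"
  shows "\<exists>p\<in>C. \<forall>q\<in>C. E q f \<le> E p f"
proof -
  have "compact ((\<lambda>p. E p f) ` C)"
    using image_compactin[OF assms(1) continuous_map_integral[OF assms(3)]] by simp
  then show ?thesis using compact_attains_sup[of "(\<lambda>p. E p f) ` C"] assms(2) by simp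
qed

text \<open>A hull has the property it is taken for only if that property survives intersections.
  \<open>Delta S \<times> Delta S\<close> is a member of the intersected family, which is therefore
  nonempty, as closedness of the intersection requires.\<close>

lemma house_ext_props:
  "house_ext S \<Gamma> \<subseteq> Delta S \<times> Delta S \<and> convex_measure_pairs (house_ext S \<Gamma>) \<and>
   closedin (prod_topology (weak_star S) (weak_star S)) (house_ext S \<Gamma>)"
  if "\<And>x. x \<in> S \<Longrightarrow> \<Gamma> x \<subseteq> Delta S"
proof -
  let ?Q = "\<lambda>C. C \<subseteq> Delta S \<times> Delta S \<and> convex_measure_pairs C \<and>
          closedin (prod_topology (weak_star S) (weak_star S)) C"
  let ?G = "{(dirac S x, p) | x p. x \<in> S \<and> p \<in> \<Gamma> x}"
  have top: "?Q (Delta S \<times> Delta S)"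
    using closedin_topspace[of "prod_topology (weak_star S) (weak_star S)"]
    by (auto simp: convex_measure_pairs_def topspace_weak_star mix_in_Delta)
  have G: "?G \<subseteq> Delta S \<times> Delta S" using that dirac_in_Delta by blast
  define K where "K = {C. ?Q C \<and> ?G \<subseteq> C}"
  have KQ: "C \<subseteq> Delta S \<times> Delta S" "convex_measure_pairs C"
    "closedin (prod_topology (weak_star S) (weak_star S)) C" if "C \<in> K" for C
    using that unfolding K_def by blast+
  have topK: "Delta S \<times> Delta S \<in> K" using top G unfolding K_def by blast
  have "convex_measure_pairs (\<Inter>K)"
    unfolding convex_measure_pairs_def
  proof (clarify)
    fix p p' q q' t C
    assume *: "(p, p') \<in> \<Inter>K" "(q, q') \<in> \<Inter>K" "t \<in> {0..1::real}" "C \<in> K"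
    then have "(p, p') \<in> C" "(q, q') \<in> C" by blast+
    then show "(mix t p q, mix t p' q') \<in> C"
      using KQ(2)[OF *(4)] *(3) unfolding convex_measure_pairs_def by fast
  qed
  moreover have "closedin (prod_topology (weak_star S) (weak_star S)) (\<Inter>K)"
    using topK KQ(3) by (intro closedin_Inter) auto
  moreover have "\<Inter>K \<subseteq> Delta S \<times> Delta S" using topK by blast
  moreover have "house_ext S \<Gamma> = \<Inter>K"
    unfolding house_ext_def hull_def K_def by (rule arg_cong[where f = Inter]) blast
  ultimately show ?thesis by simp
qed

lemma house_ext_gen: "x \<in> S \<Longrightarrow> p \<in> \<Gamma> x \<Longrightarrow> (dirac S x, p) \<in> house_ext S \<Gamma>"
  unfolding house_ext_def by (rule subsetD[OF hull_subset]) blast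

section \<open>Approximation by finitely supported measures\<close>

lemma compact_finite_net:
  assumes "compact S" "d > 0"
  obtains F where "finite F" "F \<subseteq> S" "S \<subseteq> (\<Union>x\<in>F. ball x d)"
proof -
  have "\<exists>k. finite k \<and> k \<subseteq> S \<and> S \<subseteq> (\<Union>x\<in>k. ball x d)"
    using seq_compact_imp_totally_bounded compact_imp_seq_compact assms by metis
  then show ?thesis using that by auto
qed

text \<open>The mass of \<open>p\<close> is moved to the points of a finite net, each point
  receiving what lies in its own piece of diameter of order \<open>d\<close>. The weights depend
  only on \<open>p\<close> and \<open>d\<close>, so that one discretization serves all continuous
  functions at once, each with its own oscillation \<open>e\<close>.\<close>

lemma finite_approx:
  assumes S: "compact S" and p: "p \<in> Delta S" and d: "d > 0"
  obtains n :: nat and x w where "\<And>i. i < n \<Longrightarrow> x i \<in> S" "\<And>i. i < n \<Longrightarrow> 0 \<le> w i" "(\<Sum>i<n. w i) = 1"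
    "\<And>f e. continuous_on S f \<Longrightarrow> (\<forall>s\<in>S. \<forall>t\<in>S. dist s t < d \<longrightarrow> \<bar>f s - f t\<bar> \<le> e) \<Longrightarrow>
        \<bar>E p f - (\<Sum>i<n. w i * f (x i))\<bar> \<le> (e::real)"
proof -
  interpret prob_space p by (rule Delta_prob[OF p])
  obtain F where F: "finite F" "F \<subseteq> S" "S \<subseteq> (\<Union>x\<in>F. ball x d)"
    by (rule compact_finite_net[OF S d])
  obtain x n where xn: "F = x ` {i::nat. i < n}"
    using finite_imp_nat_seg_image_inj_on[OF F(1)] by blast
  \<comment> \<open>The balls of the net, made disjoint so that their measures are weights of total
    mass 1.\<close>
  define A where "A = disjointed (\<lambda>i. ball (x i) d \<inter> S)"
  have cov: "(\<Union>i\<in>{0..<n}. A i) = S"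
    unfolding A_def finite_UN_disjointed_eq using F(3) by (force simp: xn)
  have sp: "space p = S" by (rule Delta_space[OF p])
  have "range (\<lambda>i. ball (x i) d \<inter> S) \<subseteq> sets p"
    by (auto simp: Delta_sets[OF p] sets_restrict_space)
  then have A[measurable]: "A i \<in> sets p" for i
    using sets.range_disjointed_sets unfolding A_def by blast
  have AS: "A i \<subseteq> ball (x i) d \<inter> S" for i unfolding A_def by (rule disjointed_subset)
  have dis: "disjoint_family_on A {0..<n}"
    unfolding A_def by (rule disjoint_family_on_mono[OF _ disjoint_family_disjointed]) simp
  have one: "(\<Sum>i\<in>{0..<n}. indicator (A i) s) = (1::real)" if "s \<in> S" for s
  proof -
    have "(\<Sum>i\<in>{0..<n}. indicator (A i) s) = (indicator S s :: real)"
      unfolding cov[symmetric] by (rule indicator_UN_disjoint[OF _ dis, symmetric]) simp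
    then show ?thesis using that by simp
  qed
  have integ: "integrable p (\<lambda>s. indicator (A i) s * (c::real))" for i c
    by (rule integrable_const_bound[where B = "\<bar>c\<bar>"]) (auto simp: indicator_def)
  have intg: "(LINT s|p. (\<Sum>i\<in>{0..<n}. indicator (A i) s * c i)) = (\<Sum>i\<in>{0..<n}. prob (A i) * c i)" for c :: "nat \<Rightarrow> real"
    using integ by (subst Bochner_Integration.integral_sum) (auto simp: sp Int_absorb2[OF order.trans[OF AS Int_lower2]])
  have "(\<Sum>i\<in>{0..<n}. prob (A i)) = (LINT s|p. (\<Sum>i\<in>{0..<n}. indicator (A i) s * 1))"
    unfolding intg by simp
  also have "\<dots> = (LINT s|p. 1)"
    using one by (intro integral_cong_Delta[OF p]) (simp only: mult_1_right)
  finally have sum1: "(\<Sum>i<n. prob (A i)) = 1" by (simp add: prob_space lessThan_atLeast0)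
  show thesis
  proof
    show "(\<Sum>i<n. prob (A i)) = 1" by (rule sum1)
    fix f e assume f: "continuous_on S f" and e: "\<forall>s\<in>S. \<forall>t\<in>S. dist s t < d \<longrightarrow> \<bar>f s - f t\<bar> \<le> (e::real)"
    let ?g = "\<lambda>s. \<Sum>i\<in>{0..<n}. indicator (A i) s * f (x i)"
    have ig: "integrable p ?g" by (rule Bochner_Integration.integrable_sum) (rule integ)
    have if': "integrable p f" by (rule continuous_integrable[OF S f p])
    have le: "\<bar>f s - ?g s\<bar> \<le> e" if s: "s \<in> S" for s
    proof -
      have "f s - ?g s = (\<Sum>i\<in>{0..<n}. indicator (A i) s * (f s - f (x i)))"
        using one[OF s] by (simp add: right_diff_distrib sum_subtractf sum_distrib_right[symmetric])
      also have "\<bar>\<dots>\<bar> \<le> (\<Sum>i\<in>{0..<n}. indicator (A i) s * e)"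
      proof (rule order.trans[OF sum_abs], rule sum_mono)
        fix i assume "i \<in> {0..<n}"
        then have "x i \<in> S" using F xn by auto
        then show "\<bar>indicator (A i) s * (f s - f (x i))\<bar> \<le> indicator (A i) s * e"
          using e AS[of i] s by (auto simp: indicator_def dist_commute abs_mult)
      qed
      also have "\<dots> = e" using one[OF s] by (simp add: sum_distrib_right[symmetric])
      finally show ?thesis .
    qed
    have "\<bar>E p f - E p ?g\<bar> = \<bar>LINT s|p. f s - ?g s\<bar>" using if' ig by simp
    also have "\<dots> \<le> (LINT s|p. \<bar>f s - ?g s\<bar>)" using integral_norm_bound[of p "\<lambda>s. f s - ?g s"] by simp
    also have "\<dots> \<le> (LINT s|p. e)" using if' ig le by (intro integral_le[OF p]) auto
    also have "\<dots> = e" by (rule integral_const_Delta[OF p])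
    finally show "\<bar>E p f - (\<Sum>i<n. prob (A i) * f (x i))\<bar> \<le> e"
      unfolding intg by (simp add: lessThan_atLeast0)
  qed (use F xn in auto)
qed

section \<open>Sequential compactness of the space of probabilities\<close>

text \<open>With digits 0 and 1 in base 3, all digits after position \<open>K\<close> contribute at
  most half of \<open>(1/3)^K\<close>, so a first difference at \<open>K\<close> cannot be
  compensated by the tail.\<close>

lemma ternary_separation:
  fixes a b :: "nat \<Rightarrow> real"
  assumes a: "\<And>k. a k \<in> {0, 1}" and b: "\<And>k. b k \<in> {0, 1}"
    and close: "\<bar>(\<Sum>k. (1/3)^k * a k) - (\<Sum>k. (1/3)^k * b k)\<bar> < (1/3)^N / 2"
    and k: "k \<le> N"
  shows "a k = b k"
proof (rule ccontr)
  assume ne: "a k \<noteq> b k"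
  define K where "K = (LEAST k. a k \<noteq> b k)"
  have "K \<le> k" unfolding K_def using ne by (rule Least_le)
  moreover have "a K \<noteq> b K" unfolding K_def using ne by (rule LeastI)
  moreover have "a j = b j" if "j < K" for j using not_less_Least[OF that[unfolded K_def]] by simp
  ultimately have K: "a K \<noteq> b K" "K \<le> N" "\<And>j. j < K \<Longrightarrow> a j = b j" using k by auto
  define c where "c j = (1/3)^j * (a j - b j)" for j
  have ab: "\<bar>a j\<bar> \<le> 1" "\<bar>b j\<bar> \<le> 1" "\<bar>a j - b j\<bar> \<le> 1" for j using a[of j] b[of j] by auto
  have geo: "summable (\<lambda>k. (1/3::real)^k)" by (simp add: summable_geometric)
  have sa: "summable (\<lambda>k. (1/3)^k * a k)" "summable (\<lambda>k. (1/3)^k * b k)"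
    using ab by (auto intro!: summable_comparison_test'[OF geo] simp: abs_mult)
  have bound: "\<bar>c j\<bar> \<le> (1/3)^j" for j using ab(3)[of j] by (simp add: c_def abs_mult)
  have sc: "summable c" using bound by (auto intro!: summable_comparison_test'[OF geo])
  have eq: "(\<Sum>k. (1/3)^k * a k) - (\<Sum>k. (1/3)^k * b k) = suminf c"
    unfolding c_def using suminf_diff[OF sa] by (simp add: right_diff_distrib)
  have split: "suminf c = (\<Sum>j. c (j + Suc K)) + (\<Sum>j<Suc K. c j)"
    by (rule suminf_split_initial_segment[OF sc])
  have "(\<Sum>j<Suc K. c j) = c K" using K(3) by (simp add: c_def)
  moreover have "\<bar>c K\<bar> = (1/3)^K"
    using K(1) a[of K] b[of K] by (auto simp: c_def)
  moreover have "\<bar>\<Sum>j. c (j + Suc K)\<bar> \<le> (1/3)^K / 2"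
  proof -
    have g: "(\<lambda>j. (1/3::real)^(j + Suc K)) sums ((1/3)^K / 2)"
      using sums_mult[OF geometric_sums[of "1/3::real"], of "(1/3)^(Suc K)"]
      by (simp add: power_add mult_ac)
    have s: "summable (\<lambda>j. \<bar>c (j + Suc K)\<bar>)"
      by (rule summable_comparison_test'[OF sums_summable[OF g]]) (simp only: real_norm_def abs_abs bound)
    have "\<bar>\<Sum>j. c (j + Suc K)\<bar> \<le> (\<Sum>j. \<bar>c (j + Suc K)\<bar>)" by (rule summable_rabs[OF s])
    also have "\<dots> \<le> (\<Sum>j. (1/3::real)^(j + Suc K))"
      using s sums_summable[OF g] by (rule suminf_le[rotated]) (rule bound)
    finally show ?thesis using sums_unique[OF g] by simp
  qed
  moreover have "(1/3::real)^N \<le> (1/3)^K" using K(2) by (intro power_decreasing) auto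
  ultimately show False using close eq split by linarith
qed

text \<open>The \<open>k\<close>-th digit of the code records membership in the \<open>k\<close>-th
  ball of a countable family made of finite nets of every radius \<open>1 / real (Suc n)\<close>.
  The code is only measurable, but nearby codes share their leading digits and so lie in the same
  small balls.\<close>

lemma compact_ternary_code:
  fixes S :: "'a::metric_space set"
  assumes S: "compact S" "S \<noteq> {}"
  obtains s :: "'a \<Rightarrow> real" where "s \<in> borel_measurable borel" "\<And>x. s x \<in> {0..2}"
    "\<And>e. e > 0 \<Longrightarrow> \<exists>d>0. \<forall>x\<in>S. \<forall>y\<in>S. \<bar>s x - s y\<bar> < d \<longrightarrow> dist x y < e"
proof -
  have "\<exists>F. finite F \<and> F \<subseteq> S \<and> S \<subseteq> (\<Union>x\<in>F. ball x (1 / real (Suc n)))" for n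
    by (rule compact_finite_net[OF S(1), of "1 / real (Suc n)"]) auto
  then obtain F where F: "\<And>n. finite (F n)" "\<And>n. F n \<subseteq> S"
      "\<And>n. S \<subseteq> (\<Union>x\<in>F n. ball x (1 / real (Suc n)))"
    by metis
  define C where "C = (\<Union>n. (\<lambda>x. ball x (1 / real (Suc n))) ` F n)"
  have "countable C"
    unfolding C_def using F(1) by (auto intro: countable_finite)
  moreover have "C \<noteq> {}" using S(2) F(3)[of 0] unfolding C_def by fastforce
  ultimately have C: "countable C" "C \<noteq> {}" by auto
  define B where "B = from_nat_into C"
  have BC: "range B = C" unfolding B_def by (rule range_from_nat_into[OF C(2,1)])
  have Bopen: "open (B k)" for k
    using BC unfolding C_def by (metis (no_types, lifting) UN_E imageE open_ball rangeI)
  define s where "s x = (\<Sum>k. (1/3)^k * indicator (B k) x :: real)" for x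
  have ind: "indicator (B k) x \<in> {0, 1::real}" for k x by (simp add: indicator_def)
  have geo: "(\<lambda>k. (1/3::real)^k) sums (3/2)" using geometric_sums[of "1/3::real"] by simp
  have sum1: "summable (\<lambda>k. (1/3)^k * indicator (B k) x :: real)" for x
    by (rule summable_comparison_test'[OF sums_summable[OF geo]]) (auto simp: indicator_def)
  show thesis
  proof
    show "s \<in> borel_measurable borel"
    proof -
      have [measurable]: "B k \<in> sets borel" for k using Bopen by simp
      show ?thesis unfolding s_def by measurable
    qed
    show "s x \<in> {0..2}" for x
    proof -
      have "s x \<le> (\<Sum>k. (1/3::real)^k)"
        unfolding s_def using sum1 sums_summable[OF geo] by (intro suminf_le) (auto simp: indicator_def)
      moreover have "0 \<le> s x" unfolding s_def using sum1 by (intro suminf_nonneg) auto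
      ultimately show ?thesis using sums_unique[OF geo] by auto
    qed
    fix e :: real assume "e > 0"
    then obtain n where n: "2 / real (Suc n) < e"
      using reals_Archimedean[of "e/2"] by (auto simp: field_simps)
    have "(\<lambda>x. ball x (1 / real (Suc n))) ` F n \<subseteq> range B" unfolding BC C_def by blast
    then obtain J where J: "finite J" "(\<lambda>x. ball x (1 / real (Suc n))) ` F n = B ` J"
      using finite_subset_image[of "(\<lambda>x. ball x (1 / real (Suc n))) ` F n" B UNIV] F(1) by auto
    \<comment> \<open>The first \<open>N + 1\<close> digits decide membership in every ball of the
      \<open>n\<close>-th net; codes closer than \<open>(1/3)^N/2\<close> agree in these
      digits.\<close>
    define N where "N = Max (insert 0 J)"
    show "\<exists>d>0. \<forall>x\<in>S. \<forall>y\<in>S. \<bar>s x - s y\<bar> < d \<longrightarrow> dist x y < e"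
    proof (intro exI[of _ "(1/3)^N/2"] conjI ballI impI)
      fix x y assume xy: "x \<in> S" "y \<in> S" "\<bar>s x - s y\<bar> < (1/3)^N / 2"
      obtain z where z: "z \<in> F n" "x \<in> ball z (1 / real (Suc n))" using F(3) xy(1) by blast
      then obtain k where k: "k \<in> J" "ball z (1 / real (Suc n)) = B k" using J(2) by blast
      have "k \<le> N" using J(1) k(1) by (simp add: N_def)
      from ternary_separation[OF ind ind xy(3)[unfolded s_def] this]
      have "x \<in> B k \<longleftrightarrow> y \<in> B k" by (cases "x \<in> B k"; cases "y \<in> B k") auto
      then have "y \<in> ball z (1 / real (Suc n))" using z(2) k(2) by blast
      then have "dist z x < 1 / real (Suc n)" "dist z y < 1 / real (Suc n)" using z(2) by auto
      then have "dist x y < 1 / real (Suc n) + 1 / real (Suc n)"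
        using dist_triangle2[of x y z] by (simp add: dist_commute)
      then show "dist x y < e" using n by simp
    qed simp
  qed
qed

text \<open>The set of codes need not be closed. As the inverse is uniformly continuous on it, it
  extends to the closure, and compactness keeps the extended values in \<open>S\<close>.\<close>

lemma code_inverse:
  fixes S :: "'a::metric_space set" and s :: "'a \<Rightarrow> real"
  assumes S: "compact S"
    and unif: "\<And>e. e > 0 \<Longrightarrow> \<exists>d>0. \<forall>x\<in>S. \<forall>y\<in>S. \<bar>s x - s y\<bar> < d \<longrightarrow> dist x y < e"
  obtains h where "continuous_on (closure (s ` S)) h" "\<And>t. t \<in> closure (s ` S) \<Longrightarrow> h t \<in> S"
    "\<And>x. x \<in> S \<Longrightarrow> h (s x) = x"
proof -
  have "\<exists>x\<in>S. \<forall>e>0. \<exists>d>0. \<forall>x'\<in>S. \<bar>s x' - t\<bar> < d \<longrightarrow> dist x' x < e" if "t \<in> closure (s ` S)" for t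
  proof -
    obtain u where u: "\<And>n. u n \<in> s ` S" "u \<longlonglongrightarrow> t" using \<open>t \<in> closure (s ` S)\<close> unfolding closure_sequential by auto
    have "\<forall>n. \<exists>x\<in>S. u n = s x" using u(1) by blast
    then obtain X where X: "\<And>n. X n \<in> S" "\<And>n. u n = s (X n)" by metis
    obtain x r where x: "x \<in> S" "strict_mono r" "(X \<circ> r) \<longlonglongrightarrow> x"
      using S X(1) unfolding compact_eq_seq_compact_metric seq_compact_def by blast
    have ur: "(\<lambda>n. u (r n)) \<longlonglongrightarrow> t" using LIMSEQ_subseq_LIMSEQ[OF u(2) x(2)] by (simp add: o_def)
    show ?thesis
    proof (intro bexI[OF _ x(1)] allI impI)
      fix e :: real assume "e > 0"
      then obtain d where d: "d > 0" "\<And>x y. x \<in> S \<Longrightarrow> y \<in> S \<Longrightarrow> \<bar>s x - s y\<bar> < d \<Longrightarrow> dist x y < e/2"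
        using unif[of "e/2"] by auto
      have "\<forall>\<^sub>F n in sequentially. dist (X (r n)) x < e/2 \<and> dist (u (r n)) t < d/2"
        using tendstoD[OF x(3), of "e/2"] tendstoD[OF ur, of "d/2"] \<open>e > 0\<close> d(1)
        by (simp add: eventually_conj_iff o_def)
      then obtain n where n: "dist (X (r n)) x < e/2" "dist (u (r n)) t < d/2"
        using eventually_happens'[OF sequentially_bot] by blast
      show "\<exists>d>0. \<forall>x'\<in>S. \<bar>s x' - t\<bar> < d \<longrightarrow> dist x' x < e"
      proof (intro exI[of _ "d/2"] conjI ballI impI)
        fix x' assume x': "x' \<in> S" "\<bar>s x' - t\<bar> < d/2"
        then have "\<bar>s x' - s (X (r n))\<bar> < d"
          using n(2) X(2)[of "r n"] abs_triangle_ineq4[of "s x' - t" "s (X (r n)) - t"]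
          by (simp add: dist_real_def)
        then have "dist x' (X (r n)) < e/2" using d(2) x'(1) X(1) by blast
        then show "dist x' x < e" using n(1) dist_triangle[of x' x "X (r n)"] by linarith
      qed (use d in simp)
    qed
  qed
  then obtain h where h: "\<And>t. t \<in> closure (s ` S) \<Longrightarrow> h t \<in> S"
    "\<And>t e. t \<in> closure (s ` S) \<Longrightarrow> e > 0 \<Longrightarrow> \<exists>d>0. \<forall>x'\<in>S. \<bar>s x' - t\<bar> < d \<longrightarrow> dist x' (h t) < e"
    by metis
  show thesis
  proof
    show "continuous_on (closure (s ` S)) h"
      unfolding continuous_on_iff
    proof (intro ballI allI impI)
      fix t0 and e :: real assume t0: "t0 \<in> closure (s ` S)" and e: "e > 0"
      obtain d where d: "d > 0" "\<And>x'. x' \<in> S \<Longrightarrow> \<bar>s x' - t0\<bar> < d \<Longrightarrow> dist x' (h t0) < e/2"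
        using h(2)[OF t0, of "e/2"] e by auto
      show "\<exists>d>0. \<forall>t\<in>closure (s ` S). dist t t0 < d \<longrightarrow> dist (h t) (h t0) < e"
      proof (intro exI[of _ "d/2"] conjI ballI impI)
        fix t assume t: "t \<in> closure (s ` S)" "dist t t0 < d/2"
        obtain d' where d': "d' > 0" "\<And>x'. x' \<in> S \<Longrightarrow> \<bar>s x' - t\<bar> < d' \<Longrightarrow> dist x' (h t) < e/2"
          using h(2)[OF t(1), of "e/2"] e by auto
        obtain x' where x': "x' \<in> S" "dist (s x') t < min d' (d/2)"
          using t(1) d(1) d'(1) unfolding closure_approachable
          by (metis (no_types, lifting) half_gt_zero imageE min_less_iff_conj)
        have "dist x' (h t) < e/2" using d'(2) x' by (simp add: dist_real_def)
        moreover have "dist x' (h t0) < e/2"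
        proof (rule d(2)[OF x'(1)])
          show "\<bar>s x' - t0\<bar> < d"
            using x'(2) t(2) abs_triangle_ineq[of "s x' - t" "t - t0"] by (simp add: dist_real_def)
        qed
        ultimately show "dist (h t) (h t0) < e"
          using dist_triangle3[of "h t" "h t0" x'] by linarith
      qed (use d in simp)
    qed
    show "h (s x) = x" if "x \<in> S" for x
    proof -
      have sx: "s x \<in> closure (s ` S)" using that by (intro subsetD[OF closure_subset] imageI)
      have "dist x (h (s x)) < e" if e: "e > 0" for e
      proof -
        obtain d where "d > 0" "\<forall>x'\<in>S. \<bar>s x' - s x\<bar> < d \<longrightarrow> dist x' (h (s x)) < e"
          using h(2)[OF sx e] by auto
        then show ?thesis using \<open>x \<in> S\<close> by simp
      qed
      from this[of "dist x (h (s x))"] show ?thesis by (cases "h (s x) = x") auto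
    qed
  qed (use h in auto)
qed

text \<open>The image measures under the ternary code live in a bounded interval, hence are tight,
  and a subsequence converges weakly on the line. The limit is carried by the closure
  \<open>K\<close> of the codes and is transported back by the continuous inverse
  \<open>h\<close>.\<close>

lemma Delta_seq_compact:
  fixes S :: "'a::metric_space set"
  assumes S: "compact S" and P: "\<And>n::nat. P n \<in> Delta S"
  obtains r p where "strict_mono r" "p \<in> Delta S"
    "\<And>f. continuous_on S f \<Longrightarrow> (\<lambda>n. E (P (r n)) f) \<longlonglongrightarrow> E p f"
proof -
  have ne: "S \<noteq> {}"
    using prob_space.not_empty[OF Delta_prob[OF P[of 0]]] Delta_space[OF P[of 0]] by simp
  then obtain x0 where x0: "x0 \<in> S" by blast
  obtain s :: "'a \<Rightarrow> real" where s: "s \<in> borel_measurable borel" "\<And>x. s x \<in> {0..2}"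
    "\<And>e. e > 0 \<Longrightarrow> \<exists>d>0. \<forall>x\<in>S. \<forall>y\<in>S. \<bar>s x - s y\<bar> < d \<longrightarrow> dist x y < e"
    using compact_ternary_code[OF S ne] by blast
  define K where "K = closure (s ` S)"
  obtain h where h: "continuous_on K h" "\<And>t. t \<in> K \<Longrightarrow> h t \<in> S" "\<And>x. x \<in> S \<Longrightarrow> h (s x) = x"
    using code_inverse[OF S s(3), folded K_def] by blast
  have sK: "s x \<in> K" if "x \<in> S" for x
    unfolding K_def using that by (intro subsetD[OF closure_subset] imageI)
  have K: "closed K" "K \<noteq> {}" using ne by (auto simp: K_def)
  have sm: "s \<in> borel_measurable (P n)" for n
    using Delta_measurable[OF P] measurable_restrict_space1[OF s(1)] by blast
  define \<mu> where "\<mu> n = distr (P n) borel s" for n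
  have rd: "real_distribution (\<mu> n)" for n
    unfolding \<mu>_def by (rule prob_space.real_distribution_distr[OF Delta_prob[OF P] sm])
  have "tight \<mu>"
    unfolding tight_def
  proof (intro conjI allI impI rd)
    fix e :: real assume "e > 0"
    have "measure (\<mu> n) {-1<..3} = 1" for n
    proof -
      have "measure (\<mu> n) {-1<..3} = measure (P n) (s -` {-1<..3} \<inter> space (P n))"
        unfolding \<mu>_def by (rule measure_distr[OF sm]) simp
      also have "s -` {-1<..3} \<inter> space (P n) = space (P n)"
      proof -
        have "s x \<in> {-1<..3}" for x using s(2)[of x] by auto
        then show ?thesis by blast
      qed
      finally show ?thesis using prob_space.prob_space[OF Delta_prob[OF P]] by simp
    qed
    then show "\<exists>a b. a < b \<and> (\<forall>n. 1 - e < measure (\<mu> n) {a<..b})"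
      using \<open>e > 0\<close> by (intro exI[of _ "-1"] exI[of _ 3]) auto
  qed
  from tight_imp_convergent_subsubsequence[OF this strict_mono_id]
  obtain r M where r: "strict_mono r" "real_distribution M" "weak_conv_m (\<lambda>n. \<mu> (r n)) M"
    by (auto simp: o_def)
  interpret M: real_distribution M by (rule r(2))
  have conv: "(\<lambda>n. integral\<^sup>L (\<mu> (r n)) g) \<longlonglongrightarrow> integral\<^sup>L M g"
    if "\<And>x. isCont g x" "\<And>x. norm (g x) \<le> B" for g :: "real \<Rightarrow> real" and B
    by (rule weak_conv_imp_integral_bdd_continuous_conv[OF rd r(2,3) that])
  have int\<mu>: "integral\<^sup>L (\<mu> n) g = E (P n) (\<lambda>x. g (s x))" if "g \<in> borel_measurable borel" for g :: "real \<Rightarrow> real" and n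
    unfolding \<mu>_def by (rule integral_distr[OF sm that])
  \<comment> \<open>The distance to \<open>K\<close>, cut off at 1, is a bounded continuous test
    function that vanishes at every code, so its integral against the limit is 0.\<close>
  have AEK: "AE t in M. t \<in> K"
  proof -
    let ?g = "\<lambda>t. min 1 (infdist t K)"
    have g0: "E (P n) (\<lambda>x. ?g (s x)) = 0" for n
    proof -
      have "E (P n) (\<lambda>x. ?g (s x)) = (LINT x|P n. 0)"
        using sK by (intro integral_cong_Delta[OF P]) simp
      then show ?thesis by simp
    qed
    have gb: "norm (?g t) \<le> 1" for t by (simp add: infdist_nonneg)
    have gm: "?g \<in> borel_measurable borel"
      by (intro borel_measurable_continuous_onI continuous_intros)
    have "(\<lambda>n. integral\<^sup>L (\<mu> (r n)) ?g) \<longlonglongrightarrow> integral\<^sup>L M ?g"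
      by (rule conv[OF _ gb]) (intro continuous_intros)
    then have "integral\<^sup>L M ?g = 0" using g0 int\<mu>[OF gm] LIMSEQ_unique[OF _ tendsto_const] by simp
    moreover have "integrable M ?g"
      using gb gm by (intro M.integrable_const_bound[where B = 1]) auto
    ultimately have "AE t in M. ?g t = 0"
      using integral_nonneg_eq_0_iff_AE[of M ?g] infdist_nonneg by auto
    then show ?thesis
      by eventually_elim (use K in_closed_iff_infdist_zero in \<open>auto simp: min_def split: if_splits\<close>)
  qed
  \<comment> \<open>The value \<open>x0\<close> is taken on a null set only; it makes
    \<open>h'\<close> map into \<open>S\<close> everywhere.\<close>
  define h' where "h' t = (if t \<in> K then h t else x0)" for t
  have "h' \<in> measurable borel borel"
    unfolding h'_def using K(1) h(1)
    by (subst measurable_If_restrict_space_iff) (auto intro: borel_measurable_continuous_on_restrict)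
  then have h'm: "h' \<in> measurable M (borel_on S)"
    using h(2) x0 by (intro measurable_restrict_space2) (auto simp: h'_def)
  define p where "p = distr M (borel_on S) h'"
  have p: "p \<in> Delta S" by (simp add: Delta_def p_def M.prob_space_distr[OF h'm])
  show thesis
  proof (rule that[OF r(1) p])
    fix f :: "'a \<Rightarrow> real" assume f: "continuous_on S f"
    obtain b where b: "\<And>x. x \<in> S \<Longrightarrow> norm (f x) \<le> b"
      using compact_imp_bounded[OF compact_continuous_image[OF f S]] unfolding bounded_iff by auto
    have b0: "0 \<le> b" using b[OF x0] norm_ge_zero order.trans by blast
    have "continuous_on K (\<lambda>t. f (h t))"
      using h(1,2) by (intro continuous_on_compose2[OF f]) auto
    \<comment> \<open>Weak convergence needs a test function on the whole line, whereas
      \<open>f\<close> composed with \<open>h\<close> lives on \<open>K\<close>. A Tietze extension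
      does not affect the integrals, since all the measures involved are carried by
      \<open>K\<close>.\<close>
    then obtain g where g: "continuous_on UNIV g" "\<And>t. t \<in> K \<Longrightarrow> g t = f (h t)" "\<And>t. norm (g t) \<le> b"
      using Tietze[of K "\<lambda>t. f (h t)" UNIV b] K(1) b0 b h(2) by auto
    have gm: "g \<in> borel_measurable borel" by (rule borel_measurable_continuous_onI[OF g(1)])
    have fm: "f \<in> borel_measurable (borel_on S)" by (rule borel_measurable_continuous_on_restrict[OF f])
    have "E p f = integral\<^sup>L M (\<lambda>t. f (h' t))"
      unfolding p_def by (rule integral_distr[OF h'm fm])
    also have "\<dots> = integral\<^sup>L M g"
    proof (rule integral_cong_AE)
      show "AE t in M. f (h' t) = g t"
        using AEK by eventually_elim (simp add: h'_def g)
      show "(\<lambda>t. f (h' t)) \<in> borel_measurable M" by (rule measurable_compose[OF h'm fm])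
    qed (use gm in simp)
    finally have "E p f = integral\<^sup>L M g" .
    moreover have "integral\<^sup>L (\<mu> n) g = E (P n) f" for n
      unfolding int\<mu>[OF gm] using sK h(3) g(2) by (intro integral_cong_Delta[OF P]) simp
    moreover have "(\<lambda>n. integral\<^sup>L (\<mu> (r n)) g) \<longlonglongrightarrow> integral\<^sup>L M g"
      using g(1,3) by (intro conv) (auto simp: continuous_on_eq_continuous_at)
    ultimately show "(\<lambda>n. E (P (r n)) f) \<longlonglongrightarrow> E p f" by simp
  qed
qed

section \<open>Mixed extensions and the Kantorovich--Rubinstein distance\<close>

lemma E_diff_le:
  assumes "p \<in> Delta S" "integrable p f" "integrable p g" "\<And>s. s \<in> S \<Longrightarrow> f s - g s \<le> e"
  shows "E p f - E p g \<le> e"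
proof -
  have "E p (\<lambda>s. f s - g s) \<le> (LINT s|p. e)"
    using assms Delta_prob[OF assms(1)]
    by (intro integral_le[OF assms(1)]) (auto simp: prob_space.finite_measure finite_measure.integrable_const)
  then show ?thesis using assms prob_space.prob_space[OF Delta_prob[OF assms(1)]] by simp
qed

lemma E_abs_diff_le:
  assumes "p \<in> Delta S" "integrable p f" "integrable p g" "\<And>s. s \<in> S \<Longrightarrow> \<bar>f s - g s\<bar> \<le> e"
  shows "\<bar>E p f - E p g\<bar> \<le> e"
proof -
  have "E p f - E p g \<le> e" "E p g - E p f \<le> e"
    using assms(4) by (intro E_diff_le[OF assms(1)] assms(2,3); force simp: abs_le_iff)+
  then show ?thesis by linarith
qed

lemma section_continuous:
  fixes v :: "'a::metric_space \<times> 'b::metric_space \<Rightarrow> real"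
  assumes "continuous_on (X \<times> Y) v"
  shows "y \<in> Y \<Longrightarrow> continuous_on X (\<lambda>x. v (x, y))" "x \<in> X \<Longrightarrow> continuous_on Y (\<lambda>y. v (x, y))"
  by (rule continuous_on_compose2[OF assms], auto intro!: continuous_intros)+

lemma product_uniformly_continuous:
  fixes v :: "'a::metric_space \<times> 'b::metric_space \<Rightarrow> real"
  assumes "compact X" "compact Y" "continuous_on (X \<times> Y) v" "e > 0"
  obtains d where "d > 0" "\<And>x x' y y'. x \<in> X \<Longrightarrow> x' \<in> X \<Longrightarrow> y \<in> Y \<Longrightarrow> y' \<in> Y \<Longrightarrow>
    dist x x' + dist y y' < d \<Longrightarrow> \<bar>v (x, y) - v (x', y')\<bar> < e"
proof -
  obtain d where d: "d > 0" "\<And>z z'. z \<in> X \<times> Y \<Longrightarrow> z' \<in> X \<times> Y \<Longrightarrow> dist z' z < d \<Longrightarrow> dist (v z') (v z) < e"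
    using compact_uniformly_continuous[OF assms(3) compact_Times[OF assms(1,2)]] assms(4)
    unfolding uniformly_continuous_on_def by meson
  show thesis
  proof (rule that[OF d(1)])
    fix x x' y y' assume *: "x \<in> X" "x' \<in> X" "y \<in> Y" "y' \<in> Y" "dist x x' + dist y y' < d"
    have "dist (x, y) (x', y') \<le> dist x x' + dist y y'"
      unfolding dist_Pair_Pair by (rule sqrt_sum_squares_le_sum) auto
    then show "\<bar>v (x, y) - v (x', y')\<bar> < e"
      using d(2)[of "(x', y')" "(x, y)"] * by (simp add: dist_real_def)
  qed
qed

lemma integral_section_continuous_snd:
  fixes v :: "'a::metric_space \<times> 'b::metric_space \<Rightarrow> real"
  assumes X: "compact X" and Y: "compact Y" and v: "continuous_on (X \<times> Y) v" and p: "p \<in> Delta X"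
  shows "continuous_on Y (\<lambda>y. E p (\<lambda>x. v (x, y)))"
  unfolding continuous_on_iff
proof (intro ballI allI impI)
  fix y and e :: real assume y: "y \<in> Y" and e: "e > 0"
  have ivx: "integrable p (\<lambda>x. v (x, y))" if "y \<in> Y" for y
    using X v p that by (blast intro: continuous_integrable section_continuous)
  obtain d where d: "d > 0" "\<And>x x' y y'. x \<in> X \<Longrightarrow> x' \<in> X \<Longrightarrow> y \<in> Y \<Longrightarrow> y' \<in> Y \<Longrightarrow>
      dist x x' + dist y y' < d \<Longrightarrow> \<bar>v (x, y) - v (x', y')\<bar> < e/2"
    by (rule product_uniformly_continuous[OF X Y v, of "e/2"]) (use e in auto)
  have "dist (E p (\<lambda>x. v (x, y'))) (E p (\<lambda>x. v (x, y))) < e" if y': "y' \<in> Y" "dist y' y < d" for y'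
  proof -
    have "\<bar>v (x, y') - v (x, y)\<bar> < e/2" if "x \<in> X" for x using d(2)[of x x y' y] y y' that by simp
    then have "\<bar>E p (\<lambda>x. v (x, y')) - E p (\<lambda>x. v (x, y))\<bar> \<le> e/2"
      using y y'(1) by (intro E_abs_diff_le[OF p] ivx less_imp_le)
    then show ?thesis using e by (simp add: dist_real_def)
  qed
  then show "\<exists>d>0. \<forall>y'\<in>Y. dist y' y < d \<longrightarrow> dist (E p (\<lambda>x. v (x, y'))) (E p (\<lambda>x. v (x, y))) < e"
    using d(1) by blast
qed

lemma integral_section_continuous:
  fixes v :: "'a::metric_space \<times> 'b::metric_space \<Rightarrow> real"
  assumes X: "compact X" and Y: "compact Y" and v: "continuous_on (X \<times> Y) v"
  shows "p \<in> Delta X \<Longrightarrow> continuous_on Y (\<lambda>y. E p (\<lambda>x. v (x, y)))"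
    and "q \<in> Delta Y \<Longrightarrow> continuous_on X (\<lambda>x. E q (\<lambda>y. v (x, y)))"
proof -
  have "continuous_on (Y \<times> X) (\<lambda>z. v (snd z, fst z))"
    by (rule continuous_on_compose2[OF v]) (auto intro!: continuous_intros)
  from integral_section_continuous_snd[OF Y X this]
  show "q \<in> Delta Y \<Longrightarrow> continuous_on X (\<lambda>x. E q (\<lambda>y. v (x, y)))" by simp
qed (rule integral_section_continuous_snd[OF assms])

text \<open>For finitely supported \<open>p\<close> the two orders agree by linearity. Discretizing
  \<open>p\<close> at a scale where \<open>v\<close> oscillates by less than \<open>e/2\<close>
  leaves both iterated integrals within \<open>e/2\<close> of the same finite sum, without any
  measurability on the product.\<close>

lemma integral_swap_Delta:
  fixes v :: "'a::metric_space \<times> 'b::metric_space \<Rightarrow> real"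
  assumes X: "compact X" and Y: "compact Y" and v: "continuous_on (X \<times> Y) v"
    and p: "p \<in> Delta X" and q: "q \<in> Delta Y"
  shows "E p (\<lambda>x. E q (\<lambda>y. v (x, y))) = E q (\<lambda>y. E p (\<lambda>x. v (x, y)))"
proof -
  have ivx: "integrable p (\<lambda>x. v (x, y))" if "y \<in> Y" for y
    using X v that p by (blast intro: continuous_integrable section_continuous)
  have ivy: "integrable q (\<lambda>y. v (x, y))" if "x \<in> X" for x
    using Y v that q by (blast intro: continuous_integrable section_continuous)
  have le: "\<bar>E p (\<lambda>x. E q (\<lambda>y. v (x, y))) - E q (\<lambda>y. E p (\<lambda>x. v (x, y)))\<bar> \<le> e" if "e > 0" for e
  proof -
    obtain d where d: "d > 0" "\<And>x x' y y'. x \<in> X \<Longrightarrow> x' \<in> X \<Longrightarrow> y \<in> Y \<Longrightarrow> y' \<in> Y \<Longrightarrow>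
        dist x x' + dist y y' < d \<Longrightarrow> \<bar>v (x, y) - v (x', y')\<bar> < e/2"
      by (rule product_uniformly_continuous[OF X Y v, of "e/2"]) (use \<open>e > 0\<close> in auto)
    obtain n :: nat and x w where "\<And>i. i < n \<Longrightarrow> x i \<in> X" "\<And>i. i < n \<Longrightarrow> 0 \<le> w i" "(\<Sum>i<n. w i) = 1"
      "\<And>f c. continuous_on X f \<Longrightarrow>
        (\<forall>s\<in>X. \<forall>t\<in>X. dist s t < d \<longrightarrow> \<bar>f s - f t\<bar> \<le> c) \<Longrightarrow> \<bar>E p f - (\<Sum>i<n. w i * f (x i))\<bar> \<le> c"
      by (fact finite_approx[OF X p d(1)])
    note n = this(1,4)
    let ?m = "\<Sum>i<n. w i * E q (\<lambda>y. v (x i, y))"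
    let ?g = "\<lambda>y. \<Sum>i<n. w i * v (x i, y)"
    have ig: "integrable q ?g" using ivy n(1) by auto
    have iE: "integrable q (\<lambda>y. E p (\<lambda>x. v (x, y)))"
      by (rule continuous_integrable[OF Y integral_section_continuous(1)[OF X Y v p] q])
    have Eg: "E q ?g = ?m" using ivy n(1) by (subst Bochner_Integration.integral_sum) auto
    have *: "\<bar>E p (\<lambda>x. v (x, y)) - ?g y\<bar> \<le> e/2" if "y \<in> Y" for y
      using that d(2) by (intro n(2)) (auto intro!: section_continuous[OF v] less_imp_le)
    have "\<bar>E q (\<lambda>y. E p (\<lambda>x. v (x, y))) - E q ?g\<bar> \<le> e/2"
      using * by (rule E_abs_diff_le[OF q iE ig])
    moreover have "\<bar>E p (\<lambda>x. E q (\<lambda>y. v (x, y))) - ?m\<bar> \<le> e/2"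
    proof (rule n(2)[OF integral_section_continuous(2)[OF X Y v q]], intro ballI impI)
      fix s t assume st: "s \<in> X" "t \<in> X" "dist s t < d"
      have "\<bar>v (s, y) - v (t, y)\<bar> < e/2" if "y \<in> Y" for y using d(2)[of s t y y] st that by simp
      then show "\<bar>E q (\<lambda>y. v (s, y)) - E q (\<lambda>y. v (t, y))\<bar> \<le> e/2"
        using st by (intro E_abs_diff_le[OF q] ivy less_imp_le)
    qed
    ultimately show ?thesis unfolding Eg by linarith
  qed
  have "\<bar>E p (\<lambda>x. E q (\<lambda>y. v (x, y))) - E q (\<lambda>y. E p (\<lambda>x. v (x, y)))\<bar> \<le> 0"
    by (rule field_le_epsilon) (simp add: le)
  then show ?thesis by simp
qed

lemma bilin_dirac_right:
  fixes v :: "'a::metric_space \<times> 'b::metric_space \<Rightarrow> real"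
  assumes "compact X" "compact Y" "continuous_on (X \<times> Y) v" "p \<in> Delta X" "y \<in> Y"
  shows "bilin v p (dirac Y y) = E p (\<lambda>x. v (x, y))"
  unfolding bilin_def using assms
  by (intro integral_dirac_cont integral_section_continuous)

lemma bilin_dirac_left:
  fixes v :: "'a::metric_space \<times> 'b::metric_space \<Rightarrow> real"
  assumes "continuous_on (X \<times> Y) v" "q \<in> Delta Y" "x \<in> X"
  shows "bilin v (dirac X x) q = E q (\<lambda>y. v (x, y))"
  unfolding bilin_def using assms
  by (intro integral_cong_Delta[OF assms(2)] integral_dirac_cont section_continuous)

lemma osc_integral_le:
  assumes S: "compact S" and f: "continuous_on S f" and p: "p \<in> Delta S" "p' \<in> Delta S"
    and b: "\<And>s t. s \<in> S \<Longrightarrow> t \<in> S \<Longrightarrow> f s - f t \<le> b"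
  shows "E p f - E p' f \<le> b"
proof -
  note I = continuous_integrable[OF S f]
  have ic: "integrable m (\<lambda>s. c::real)" if "m \<in> Delta S" for m c
    using Delta_prob[OF that] by (simp add: prob_space.finite_measure finite_measure.integrable_const)
  have "E p f - f t \<le> b" if "t \<in> S" for t
    using E_diff_le[OF p(1) I[OF p(1)] ic[OF p(1)], of "f t" b] b that
      prob_space.prob_space[OF Delta_prob[OF p(1)]] by simp
  then have "E p' (\<lambda>t. E p f) - E p' f \<le> b" by (intro E_diff_le[OF p(2) ic I] p) auto
  then show ?thesis using prob_space.prob_space[OF Delta_prob[OF p(2)]] by simp
qed

section \<open>The Kantorovich-Rubinstein distance\<close>

lemma dKR_le:
  assumes S: "compact S" and p: "p \<in> Delta S" "p' \<in> Delta S"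
    and b: "\<And>f. 1-lipschitz_on S f \<Longrightarrow> \<bar>E p f - E p' f\<bar> \<le> b"
  shows "dKR S p p' \<le> b"
  unfolding dKR_def
proof (rule cSUP_least)
  have "1-lipschitz_on S (\<lambda>_. 0::real)" by (rule lipschitz_onI) auto
  then show "{f :: _ \<Rightarrow> real. 1-lipschitz_on S f} \<noteq> {}" by blast
qed (use b in blast)

lemma lipschitz_integral_le_diam:
  assumes S: "compact S" and p: "p \<in> Delta S" "p' \<in> Delta S"
    and b: "\<And>s t. s \<in> S \<Longrightarrow> t \<in> S \<Longrightarrow> dist s t \<le> b" and f: "1-lipschitz_on S f"
  shows "\<bar>E p f - E p' f\<bar> \<le> b"
proof -
  have "f s - f t \<le> b" if "s \<in> S" "t \<in> S" for s t
    using lipschitz_onD[OF f that] b[OF that] by (simp add: dist_real_def)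
  then have "E p f - E p' f \<le> b" "E p' f - E p f \<le> b"
    using S p lipschitz_on_continuous_on[OF f] by (blast intro: osc_integral_le)+
  then show ?thesis by linarith
qed

text \<open>The supremum defining \<open>dKR\<close> is meaningful because a diameter bound for
  \<open>S\<close> also bounds every difference of integrals of a 1-Lipschitz function.\<close>

lemma dKR_upper:
  assumes S: "compact S" and p: "p \<in> Delta S" "p' \<in> Delta S" and f: "1-lipschitz_on S f"
  shows "\<bar>E p f - E p' f\<bar> \<le> dKR S p p'"
proof -
  obtain b where b: "\<And>s t. s \<in> S \<Longrightarrow> t \<in> S \<Longrightarrow> dist s t \<le> b"
    using compact_imp_bounded[OF S] unfolding bounded_two_points by blast
  show ?thesis unfolding dKR_def
  proof (rule cSUP_upper)
    show "bdd_above ((\<lambda>f. \<bar>E p f - E p' f\<bar>) ` {f. 1-lipschitz_on S f})"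
      using lipschitz_integral_le_diam[OF S p b] by (intro bdd_aboveI[of _ b]) auto
  qed (use f in simp)
qed

lemma dKR_lipschitz:
  assumes S: "compact S" and p: "p \<in> Delta S" "p' \<in> Delta S" and f: "L-lipschitz_on S f" and L: "L > 0"
  shows "E p f - E p' f \<le> L * dKR S p p'"
proof -
  have "1-lipschitz_on S (\<lambda>s. f s / L)"
    using lipschitz_onD[OF f] L
    by (intro lipschitz_onI) (auto simp: dist_real_def diff_divide_distrib[symmetric] field_simps)
  from dKR_upper[OF S p this] show ?thesis using L by (simp add: diff_divide_distrib[symmetric] field_simps)
qed

lemma dKR_dirac:
  assumes S: "compact S" and s: "s \<in> S" "t \<in> S"
  shows "dKR S (dirac S s) (dirac S t) \<le> dist s t"
proof (rule dKR_le[OF S dirac_in_Delta[OF s(1)] dirac_in_Delta[OF s(2)]])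
  fix f :: "_ \<Rightarrow> real" assume f: "1-lipschitz_on S f"
  then show "\<bar>E (dirac S s) f - E (dirac S t) f\<bar> \<le> dist s t"
    using lipschitz_onD[OF f s] s lipschitz_on_continuous_on[OF f]
    by (simp add: integral_dirac_cont dist_real_def)
qed

text \<open>An approximate Lipschitz condition: every continuous function satisfies it for each \<open>e > 0\<close>
  with a suitable \<open>L\<close>, and it passes to integrals against measures that are close in \<open>dKR\<close>.\<close>

definition modulus ::
  "'a::metric_space set \<Rightarrow> 'b::metric_space set \<Rightarrow> ('a \<times> 'b \<Rightarrow> real) \<Rightarrow> real \<Rightarrow> real \<Rightarrow> bool" where
  "modulus X Y v e L \<longleftrightarrow> (\<forall>x\<in>X. \<forall>x'\<in>X. \<forall>y\<in>Y. \<forall>y'\<in>Y.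
     v (x, y) - v (x', y') \<le> e + L * (dist x x' + dist y y'))"

lemma modulusD:
  "modulus X Y v e L \<Longrightarrow> x \<in> X \<Longrightarrow> x' \<in> X \<Longrightarrow> y \<in> Y \<Longrightarrow> y' \<in> Y \<Longrightarrow>
    v (x, y) - v (x', y') \<le> e + L * (dist x x' + dist y y')"
  by (auto simp: modulus_def)

text \<open>Below the scale \<open>d\<close> of uniform continuity the error \<open>e\<close>
  suffices; from \<open>d\<close> onwards the slope \<open>2*B/d\<close> already covers the total
  oscillation \<open>2*B\<close>.\<close>

lemma continuous_imp_modulus:
  fixes v :: "'a::metric_space \<times> 'b::metric_space \<Rightarrow> real"
  assumes X: "compact X" and Y: "compact Y" and v: "continuous_on (X \<times> Y) v" and e: "e > 0"
  shows "\<exists>L>0. modulus X Y v e L"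
proof -
  obtain d where d: "d > 0" "\<And>x x' y y'. x \<in> X \<Longrightarrow> x' \<in> X \<Longrightarrow> y \<in> Y \<Longrightarrow> y' \<in> Y \<Longrightarrow>
      dist x x' + dist y y' < d \<Longrightarrow> \<bar>v (x, y) - v (x', y')\<bar> < e"
    using product_uniformly_continuous[OF assms] by blast
  obtain B where B: "B > 0" "\<And>z. z \<in> X \<times> Y \<Longrightarrow> \<bar>v z\<bar> \<le> B"
    using compact_imp_bounded[OF compact_continuous_image[OF v compact_Times[OF X Y]]]
    unfolding bounded_pos by auto
  have "modulus X Y v e (2*B/d)"
    unfolding modulus_def
  proof (intro ballI)
    fix x x' y y' assume *: "x \<in> X" "x' \<in> X" "y \<in> Y" "y' \<in> Y"
    show "v (x, y) - v (x', y') \<le> e + 2*B/d * (dist x x' + dist y y')"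
    proof (cases "dist x x' + dist y y' < d")
      case True
      then have "v (x, y) - v (x', y') \<le> e" using d(2)[OF *] by linarith
      moreover have "0 \<le> 2*B/d * (dist x x' + dist y y')" using B(1) d(1) by simp
      ultimately show ?thesis by linarith
    next
      case False
      have "v (x, y) - v (x', y') \<le> 2*B/d * d"
        using B(2)[of "(x, y)"] B(2)[of "(x', y')"] * d(1) by simp
      also have "\<dots> \<le> 2*B/d * (dist x x' + dist y y')"
        using False B(1) d(1) by (intro mult_left_mono) auto
      finally show ?thesis using e by linarith
    qed
  qed
  then show ?thesis using B(1) d(1) by (intro exI[of _ "2*B/d"]) simp
qed

lemma modulus_imp_continuous:
  fixes v :: "'a::metric_space \<times> 'b::metric_space \<Rightarrow> real"
  assumes "\<And>e. e > 0 \<Longrightarrow> \<exists>L>0. modulus X Y v e L"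
  shows "continuous_on (X \<times> Y) v"
  unfolding continuous_on_iff
proof (intro ballI allI impI)
  fix z and e :: real assume z: "z \<in> X \<times> Y" and e: "e > 0"
  obtain L where L: "L > 0" "modulus X Y v (e/2) L" using assms[of "e/2"] e by auto
  show "\<exists>d>0. \<forall>z'\<in>X \<times> Y. dist z' z < d \<longrightarrow> dist (v z') (v z) < e"
  proof (intro exI[of _ "e/(4*L)"] conjI ballI impI)
    fix z' assume z': "z' \<in> X \<times> Y" "dist z' z < e/(4*L)"
    have "dist (fst z') (fst z) + dist (snd z') (snd z) \<le> 2 * dist z' z"
      using dist_fst_le[of z' z] dist_snd_le[of z' z] by simp
    then have "L * (dist (fst z') (fst z) + dist (snd z') (snd z)) \<le> L * (2 * dist z' z)"
      using L(1) by simp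
    also have "\<dots> < e/2" using z'(2) L(1) by (simp add: field_simps)
    finally have "e/2 + L * (dist (fst z') (fst z) + dist (snd z') (snd z)) < e" by simp
    moreover have "v z' - v z \<le> e/2 + L * (dist (fst z') (fst z) + dist (snd z') (snd z))"
      using modulusD[OF L(2), of "fst z'" "fst z" "snd z'" "snd z"] z z' by auto
    moreover have "v z - v z' \<le> e/2 + L * (dist (fst z') (fst z) + dist (snd z') (snd z))"
      using modulusD[OF L(2), of "fst z" "fst z'" "snd z" "snd z'"] z z' by (auto simp: dist_commute)
    ultimately show "dist (v z') (v z) < e" by (simp add: dist_real_def)
  qed (use e L in simp)
qed

text \<open>The inf-convolution \<open>g\<close> of \<open>v\<close> with the cone \<open>L * dist\<close> is \<open>L\<close>-Lipschitz and \<open>v - e \<le> g \<le> v\<close>;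
  this way the error \<open>e\<close> is paid only once, although both measures vary.\<close>

lemma bilin_dKR:
  fixes v :: "'a::metric_space \<times> 'b::metric_space \<Rightarrow> real"
  assumes X: "compact X" and Y: "compact Y" and v: "continuous_on (X \<times> Y) v"
    and m: "modulus X Y v e L" and L: "L > 0"
    and p: "p \<in> Delta X" "p' \<in> Delta X" and q: "q \<in> Delta Y" "q' \<in> Delta Y"
  shows "bilin v p q - bilin v p' q' \<le> e + L * (dKR X p p' + dKR Y q q')"
proof -
  define G where "G = (\<lambda>(x, y) z. v z + L * (dist x (fst z) + dist y (snd z)))"
  define g where "g z = (INF z'\<in>X \<times> Y. G z z')" for z
  have Gl: "v z - e \<le> G z z'" if "z \<in> X \<times> Y" "z' \<in> X \<times> Y" for z z'
    using modulusD[OF m, of "fst z" "fst z'" "snd z" "snd z'"] that by (auto simp: G_def)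
  have bdd: "bdd_below (G z ` (X \<times> Y))" if "z \<in> X \<times> Y" for z
    by (rule bdd_belowI2[of _ "v z - e"]) (rule Gl[OF that])
  have gv: "g z \<le> v z" if "z \<in> X \<times> Y" for z
    using cINF_lower[OF bdd[OF that] that] by (auto simp: g_def G_def split: prod.splits)
  have vg: "v z - e \<le> g z" if "z \<in> X \<times> Y" for z
    unfolding g_def using Gl[OF that] that by (intro cINF_greatest) auto
  have gL: "g (x, y) \<le> g (x', y') + L * (dist x x' + dist y y')"
    if "x \<in> X" "x' \<in> X" "y \<in> Y" "y' \<in> Y" for x x' y y'
  proof -
    have "g (x, y) - L * (dist x x' + dist y y') \<le> g (x', y')"
      unfolding g_def[of "(x', y')"]
    proof (rule cINF_greatest)
      fix z assume z: "z \<in> X \<times> Y"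
      have "g (x, y) \<le> G (x, y) z"
        unfolding g_def using that by (intro cINF_lower[OF bdd z]) auto
      also have "\<dots> \<le> v z + L * ((dist x x' + dist x' (fst z)) + (dist y y' + dist y' (snd z)))"
        unfolding G_def using L by (auto intro!: mult_left_mono add_mono dist_triangle)
      also have "\<dots> = G (x', y') z + L * (dist x x' + dist y y')" by (simp add: G_def algebra_simps)
      finally show "g (x, y) - L * (dist x x' + dist y y') \<le> G (x', y') z" by simp
    qed (use that in blast)
    then show ?thesis by simp
  qed
  have g: "continuous_on (X \<times> Y) g"
    using gL L by (intro modulus_imp_continuous exI[of _ L]) (force simp: modulus_def)
  have iv: "integrable q (\<lambda>y. E p (\<lambda>x. f (x, y)))"
    if "continuous_on (X \<times> Y) f" "p \<in> Delta X" "q \<in> Delta Y" for f p q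
    by (rule continuous_integrable[OF Y integral_section_continuous(1)[OF X Y that(1,2)] that(3)])
  have ix: "integrable p (\<lambda>x. f (x, y))"
    if "continuous_on (X \<times> Y) f" "p \<in> Delta X" "y \<in> Y" for f :: "_ \<Rightarrow> real" and p y
    by (rule continuous_integrable[OF X section_continuous(1)[OF that(1,3)] that(2)])
  have 1: "bilin v p q - bilin g p q \<le> e"
    unfolding bilin_def using vg
    by (intro E_diff_le[OF q(1)] iv v g p q E_diff_le[OF p(1)] ix) (auto simp: algebra_simps)
  have 2: "bilin g p' q' - bilin v p' q' \<le> 0"
    unfolding bilin_def using gv
    by (intro E_diff_le[OF q(2)] iv v g p q E_diff_le[OF p(2)] ix) auto
  have 3: "bilin g p q - bilin g p' q \<le> L * dKR X p p'"
    unfolding bilin_def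
  proof (intro E_diff_le[OF q(1)] iv g p q)
    fix y assume y: "y \<in> Y"
    have "L-lipschitz_on X (\<lambda>x. g (x, y))"
    proof (rule lipschitz_onI)
      fix x x' assume "x \<in> X" "x' \<in> X"
      then show "dist (g (x, y)) (g (x', y)) \<le> L * dist x x'"
        using gL[of x x' y y] gL[of x' x y y] y by (simp add: dist_real_def dist_commute abs_le_iff)
    qed (use L in simp)
    from dKR_lipschitz[OF X p this L] show "E p (\<lambda>x. g (x, y)) - E p' (\<lambda>x. g (x, y)) \<le> L * dKR X p p'" .
  qed
  have 4: "bilin g p' q - bilin g p' q' \<le> L * dKR Y q q'"
    unfolding bilin_def
  proof (rule dKR_lipschitz[OF Y q _ L], rule lipschitz_onI)
    fix y y' assume y: "y \<in> Y" "y' \<in> Y"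
    have "E p' (\<lambda>x. g (x, y)) - E p' (\<lambda>x. g (x, y')) \<le> L * dist y y'"
      using gL[OF _ _ y] y by (intro E_diff_le[OF p(2)] ix g p) fastforce+
    moreover have "E p' (\<lambda>x. g (x, y')) - E p' (\<lambda>x. g (x, y)) \<le> L * dist y y'"
      using gL[OF _ _ y(2,1)] y by (intro E_diff_le[OF p(2)] ix g p) (fastforce simp: dist_commute)+
    ultimately show "dist (E p' (\<lambda>x. g (x, y))) (E p' (\<lambda>x. g (x, y'))) \<le> L * dist y y'"
      by (simp add: dist_real_def)
  qed (use L in simp)
  show ?thesis using 1 2 3 4 by (simp add: algebra_simps)
qed

section \<open>Gambling houses\<close>

lemma house_subset_Delta: "gambling_house S \<Gamma> \<Longrightarrow> x \<in> S \<Longrightarrow> \<Gamma> x \<subseteq> Delta S"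
  and house_nonempty: "gambling_house S \<Gamma> \<Longrightarrow> x \<in> S \<Longrightarrow> \<Gamma> x \<noteq> {}"
  and house_compactin: "gambling_house S \<Gamma> \<Longrightarrow> x \<in> S \<Longrightarrow> compactin (weak_star S) (\<Gamma> x)"
  and house_dirac: "gambling_house S \<Gamma> \<Longrightarrow> x \<in> S \<Longrightarrow> dirac S x \<in> \<Gamma> x"
  and house_nonexpansive: "gambling_house S \<Gamma> \<Longrightarrow> x \<in> S \<Longrightarrow> x' \<in> S \<Longrightarrow> p \<in> \<Gamma> x \<Longrightarrow>
    \<exists>p'\<in>\<Gamma> x'. dKR S p p' \<le> dist x x'"
  unfolding gambling_house_def by auto

text \<open>A maximum theorem: nonexpansiveness turns a maximizer at \<open>x\<close> into a nearby
  competitor at \<open>x'\<close>, so the maximum \<open>W\<close> inherits every approximate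
  Lipschitz constant of \<open>v\<close> and is continuous.\<close>

lemma house_max:
  fixes v :: "'a::metric_space \<times> 'b::metric_space \<Rightarrow> real"
  assumes X: "compact X" and Y: "compact Y" and v: "continuous_on (X \<times> Y) v"
    and H: "gambling_house X \<Gamma>"
  obtains W where "continuous_on (X \<times> Y) W"
    "\<And>x y. x \<in> X \<Longrightarrow> y \<in> Y \<Longrightarrow> \<exists>p\<in>\<Gamma> x. E p (\<lambda>x. v (x, y)) = W (x, y)"
    "\<And>x y p. x \<in> X \<Longrightarrow> y \<in> Y \<Longrightarrow> p \<in> \<Gamma> x \<Longrightarrow> E p (\<lambda>x. v (x, y)) \<le> W (x, y)"
proof -
  have "\<exists>p\<in>\<Gamma> x. \<forall>q\<in>\<Gamma> x. E q (\<lambda>x. v (x, y)) \<le> E p (\<lambda>x. v (x, y))" if "x \<in> X" "y \<in> Y" for x y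
    using compactin_attains_max[OF house_compactin[OF H that(1)] house_nonempty[OF H that(1)]
        section_continuous(1)[OF v that(2)]] .
  then obtain P where P: "\<And>x y. x \<in> X \<Longrightarrow> y \<in> Y \<Longrightarrow> P x y \<in> \<Gamma> x"
    "\<And>x y q. x \<in> X \<Longrightarrow> y \<in> Y \<Longrightarrow> q \<in> \<Gamma> x \<Longrightarrow> E q (\<lambda>x. v (x, y)) \<le> E (P x y) (\<lambda>x. v (x, y))"
    by metis
  define W where "W z = E (P (fst z) (snd z)) (\<lambda>x. v (x, snd z))" for z
  show thesis
  proof
    show "continuous_on (X \<times> Y) W"
    proof (rule modulus_imp_continuous)
      fix e :: real assume "e > 0"
      then obtain L where L: "L > 0" "modulus X Y v e L" using continuous_imp_modulus[OF X Y v] by blast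
      have "modulus X Y W e L"
        unfolding modulus_def
      proof (intro ballI)
        fix x x' y y' assume *: "x \<in> X" "x' \<in> X" "y \<in> Y" "y' \<in> Y"
        obtain p where p: "p \<in> \<Gamma> x'" "dKR X (P x y) p \<le> dist x x'"
          using house_nonexpansive[OF H *(1,2) P(1)[OF *(1,3)]] by blast
        have D: "P x y \<in> Delta X" "p \<in> Delta X" using house_subset_Delta[OF H] P(1) p(1) * by blast+
        have "W (x, y) - W (x', y') \<le> bilin v (P x y) (dirac Y y) - bilin v p (dirac Y y')"
          using P(2)[OF *(2,4) p(1)] by (simp add: W_def bilin_dirac_right[OF X Y v] D *)
        also have "\<dots> \<le> e + L * (dKR X (P x y) p + dKR Y (dirac Y y) (dirac Y y'))"
          by (intro bilin_dKR[OF X Y v L(2,1) D] dirac_in_Delta *)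
        also have "\<dots> \<le> e + L * (dist x x' + dist y y')"
          using p(2) dKR_dirac[OF Y *(3,4)] L(1) by (intro add_left_mono mult_left_mono add_mono) auto
        finally show "W (x, y) - W (x', y') \<le> e + L * (dist x x' + dist y y')" .
      qed
      then show "\<exists>L>0. modulus X Y W e L" using L(1) by blast
    qed
  qed (use P in \<open>auto simp: W_def\<close>)
qed

section \<open>Measures reached by iterated moves, and their limits\<close>

lemma house_inf_subset_Delta:
  assumes "gambling_house S \<Gamma>" shows "house_inf S \<Gamma> x \<subseteq> Delta S"
  using closure_of_subset_topspace[of "weak_star S"] unfolding house_inf_def topspace_weak_star .

lemma house_iterates_subset_Delta:
  assumes H: "gambling_house S \<Gamma>" and x: "x \<in> S"
  shows "(\<Union>n. (house_ext S \<Gamma> ^^ n) `` {dirac S x}) \<subseteq> Delta S"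
proof -
  have sub: "house_ext S \<Gamma> \<subseteq> Delta S \<times> Delta S"
    using house_ext_props house_subset_Delta[OF H] by blast
  have "q \<in> Delta S" if "(dirac S x, q) \<in> house_ext S \<Gamma> ^^ n" for n q
    using that sub dirac_in_Delta[OF x] by (cases n) auto
  then show ?thesis by blast
qed

lemma iterates_subset_house_inf:
  assumes H: "gambling_house S \<Gamma>" and x: "x \<in> S" and p: "(dirac S x, p) \<in> house_ext S \<Gamma> ^^ n"
  shows "p \<in> house_inf S \<Gamma> x"
  unfolding house_inf_def
  using closure_of_subset[of _ "weak_star S"] house_iterates_subset_Delta[OF H x] p
  unfolding topspace_weak_star by (meson UN_I UNIV_I Image_singleton_iff subsetD)

lemma house_subset_house_inf:
  assumes H: "gambling_house S \<Gamma>" and x: "x \<in> S"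
  shows "\<Gamma> x \<subseteq> house_inf S \<Gamma> x"
proof
  fix p assume "p \<in> \<Gamma> x"
  then have "(dirac S x, p) \<in> house_ext S \<Gamma> ^^ 1" using house_ext_gen[OF x] by simp
  then show "p \<in> house_inf S \<Gamma> x" by (rule iterates_subset_house_inf[OF H x])
qed

lemma house_inf_limit:
  assumes H: "gambling_house S \<Gamma>" and x: "x \<in> S" and p: "p \<in> Delta S"
    and P: "\<And>k::nat. \<exists>n. (dirac S x, P k) \<in> house_ext S \<Gamma> ^^ n"
    and lim: "\<And>f. continuous_on S f \<Longrightarrow> (\<lambda>k. E (P k) f) \<longlonglongrightarrow> E p f"
  shows "p \<in> house_inf S \<Gamma> x"
proof -
  have inf: "P k \<in> house_inf S \<Gamma> x" for k using P[of k] iterates_subset_house_inf[OF H x] by blast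
  then have "limitin (weak_star S) P p sequentially"
    using house_inf_subset_Delta[OF H] p lim by (intro limitin_weak_star) auto
  then show ?thesis
    using inf by (intro limitin_closedin[where X = "weak_star S" and S = "house_inf S \<Gamma> x"])
      (auto simp: house_inf_def closedin_closure_of)
qed

text \<open>The pairs of measures along which the integral of \<open>f\<close> does not increase
  form a closed convex set. It contains the generators of the extended house, hence the whole graph;
  iteration and closure preserve the bound.\<close>

lemma house_inf_excessive:
  assumes S: "compact S" and H: "gambling_house S \<Gamma>" and f: "continuous_on S f"
    and exc: "\<And>x p. x \<in> S \<Longrightarrow> p \<in> \<Gamma> x \<Longrightarrow> E p f \<le> f x"
    and x: "x \<in> S" and p: "p \<in> house_inf S \<Gamma> x"
  shows "E p f \<le> f x"
proof -
  let ?T = "prod_topology (weak_star S) (weak_star S)"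
  let ?C = "{z \<in> topspace ?T. E (fst z) f - E (snd z) f \<in> {0..}}"
  have "house_ext S \<Gamma> \<subseteq> ?C"
  proof -
    have gen: "{(dirac S x, p) |x p. x \<in> S \<and> p \<in> \<Gamma> x} \<subseteq> ?C"
      using exc house_subset_Delta[OF H] integral_dirac_cont[OF _ f]
      by (auto simp: topspace_weak_star dirac_in_Delta)
    have sub: "?C \<subseteq> Delta S \<times> Delta S" by (auto simp: topspace_weak_star)
    have conv: "convex_measure_pairs ?C"
      unfolding convex_measure_pairs_def split_def
    proof (intro ballI)
      fix z z' and t :: real assume *: "z \<in> ?C" "z' \<in> ?C" "t \<in> {0..1}"
      then have "(1-t) * E (snd z) f + t * E (snd z') f \<le> (1-t) * E (fst z) f + t * E (fst z') f"
        by (intro add_mono mult_left_mono) auto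
      then show "(mix t (fst z) (fst z'), mix t (snd z) (snd z')) \<in> ?C"
        using * by (auto simp: topspace_weak_star mix_in_Delta integral_mix_Delta[OF S f])
    qed
    have "closedin ?T ?C"
    proof (rule closedin_continuous_map_preimage)
      have "continuous_map ?T euclideanreal (\<lambda>z. E (fst z) f)" "continuous_map ?T euclideanreal (\<lambda>z. E (snd z) f)"
        using continuous_map_compose[OF continuous_map_fst continuous_map_integral[OF f]]
          continuous_map_compose[OF continuous_map_snd continuous_map_integral[OF f]]
        by (simp_all add: o_def)
      then show "continuous_map ?T euclideanreal (\<lambda>z. E (fst z) f - E (snd z) f)" by (rule continuous_map_diff)
    qed simp
    then show ?thesis
      unfolding house_ext_def using gen sub conv by (intro hull_minimal conjI)
  qed
  then have step: "E q' f \<le> E q f" if "(q, q') \<in> house_ext S \<Gamma>" for q q' using that by auto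
  have iter: "E q f \<le> f x" if "(dirac S x, q) \<in> house_ext S \<Gamma> ^^ n" for n q
    using that
  proof (induction n arbitrary: q)
    case 0
    then show ?case using integral_dirac_cont[OF x f] by simp
  next
    case (Suc n)
    then show ?case using step by fastforce
  qed
  let ?D = "{q \<in> topspace (weak_star S). E q f \<in> {..f x}}"
  have "closedin (weak_star S) ?D"
    by (rule closedin_continuous_map_preimage[OF continuous_map_integral[OF f]]) simp
  moreover have "(\<Union>n. (house_ext S \<Gamma> ^^ n) `` {dirac S x}) \<subseteq> ?D"
    using iter house_iterates_subset_Delta[OF H x] unfolding topspace_weak_star by auto
  ultimately have "house_inf S \<Gamma> x \<subseteq> ?D"
    unfolding house_inf_def by (rule closure_of_minimal[rotated])
  then show ?thesis using p by auto
qed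

text \<open>Convexity is given for two measures at a time. The weights are left unnormalized, so
  that the induction hypothesis applies directly to an initial segment of them; the combination is
  described by its integrals, which is all that is used of it.\<close>

lemma convex_pairs_finite_combination:
  fixes S :: "'a::metric_space set"
  assumes S: "compact S" and C: "C \<subseteq> Delta S \<times> Delta S" "convex_measure_pairs C"
    and PQ: "\<And>i. i < n \<Longrightarrow> (P i, Q i) \<in> C" and w: "\<And>i. i < n \<Longrightarrow> 0 \<le> w i" and pos: "0 < (\<Sum>i<n::nat. w i)"
  shows "\<exists>p q. (p, q) \<in> C \<and> (\<forall>f. continuous_on S f \<longrightarrow>
     (\<Sum>i<n. w i) * E p f = (\<Sum>i<n. w i * E (P i) f) \<and> (\<Sum>i<n. w i) * E q f = (\<Sum>i<n. w i * E (Q i) f))"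
  using PQ w pos
proof (induction n)
  case (Suc n)
  show ?case
  proof (cases "(\<Sum>i<n. w i) = 0")
    \<comment> \<open>The earlier weights all vanish; they cannot be renormalized, and the last pair
      alone is the combination.\<close>
    case True
    then have "w i = 0" if "i < n" for i
      using Suc.prems(2) that sum_nonneg_eq_0_iff[of "{..<n}" w] by force
    then show ?thesis using Suc.prems(1)[of n] by (intro exI[of _ "P n"] exI[of _ "Q n"]) simp
  next
    case False
    moreover have "0 \<le> (\<Sum>i<n. w i)" using Suc.prems(2) by (intro sum_nonneg) auto
    ultimately have pos: "0 < (\<Sum>i<n. w i)" by linarith
    obtain p q where pq: "(p, q) \<in> C" "\<And>f. continuous_on S f \<Longrightarrow>
       (\<Sum>i<n. w i) * E p f = (\<Sum>i<n. w i * E (P i) f) \<and> (\<Sum>i<n. w i) * E q f = (\<Sum>i<n. w i * E (Q i) f)"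
      using Suc.IH[OF Suc.prems(1,2) pos] by auto
    define t where "t = w n / (\<Sum>i<Suc n. w i)"
    have t: "t \<in> {0..1}" using Suc.prems(2)[of n] pos by (auto simp: t_def divide_simps)
    have tw: "(\<Sum>i<Suc n. w i) * t = w n" "(\<Sum>i<Suc n. w i) * (1-t) = (\<Sum>i<n. w i)"
      using Suc.prems(3) by (auto simp: t_def field_simps)
    have n: "(P n, Q n) \<in> C" using Suc.prems(1) by simp
    have D: "p \<in> Delta S" "q \<in> Delta S" "P n \<in> Delta S" "Q n \<in> Delta S" using pq(1) n C(1) by auto
    show ?thesis
    proof (intro exI conjI allI impI)
      show "(mix t p (P n), mix t q (Q n)) \<in> C"
        using C(2) pq(1) n t unfolding convex_measure_pairs_def by fast
      fix f :: "'a \<Rightarrow> real" assume f: "continuous_on S f"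
      have "(\<Sum>i<Suc n. w i) * E (mix t p (P n)) f =
          ((\<Sum>i<Suc n. w i) * (1-t)) * E p f + ((\<Sum>i<Suc n. w i) * t) * E (P n) f"
        unfolding integral_mix_Delta[OF S f D(1,3) t] by (simp only: distrib_left mult.assoc)
      then show "(\<Sum>i<Suc n. w i) * E (mix t p (P n)) f = (\<Sum>i<Suc n. w i * E (P i) f)"
        unfolding tw using pq(2)[OF f] by simp
      have "(\<Sum>i<Suc n. w i) * E (mix t q (Q n)) f =
          ((\<Sum>i<Suc n. w i) * (1-t)) * E q f + ((\<Sum>i<Suc n. w i) * t) * E (Q n) f"
        unfolding integral_mix_Delta[OF S f D(2,4) t] by (simp only: distrib_left mult.assoc)
      then show "(\<Sum>i<Suc n. w i) * E (mix t q (Q n)) f = (\<Sum>i<Suc n. w i * E (Q i) f)"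
        unfolding tw using pq(2)[OF f] by simp
    qed
  qed
qed simp

text \<open>Replaces a measurable selection of \<open>p' \<in> \<Gamma> x\<close>: approximate \<open>p\<close> by finitely supported measures,
  combine finitely many choices, and pass to the limit by compactness of \<open>Delta S\<close>.\<close>

lemma house_ext_lift:
  assumes S: "compact S" and H: "gambling_house S \<Gamma>" and a: "continuous_on S a" and b: "continuous_on S b"
    and sel: "\<And>x. x \<in> S \<Longrightarrow> \<exists>p'\<in>\<Gamma> x. a x \<le> E p' b" and p: "p \<in> Delta S"
  shows "\<exists>p'. (p, p') \<in> house_ext S \<Gamma> \<and> E p a \<le> E p' b"
proof -
  have ext: "house_ext S \<Gamma> \<subseteq> Delta S \<times> Delta S" "convex_measure_pairs (house_ext S \<Gamma>)"
    "closedin (prod_topology (weak_star S) (weak_star S)) (house_ext S \<Gamma>)"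
    using house_ext_props[of S \<Gamma>] house_subset_Delta[OF H] by blast+
  obtain s where s: "\<And>x. x \<in> S \<Longrightarrow> s x \<in> \<Gamma> x" "\<And>x. x \<in> S \<Longrightarrow> a x \<le> E (s x) b" using sel by metis
  have "\<exists>P Q. (P, Q) \<in> house_ext S \<Gamma> \<and> E P a \<le> E Q b \<and>
     (\<forall>f e. continuous_on S f \<longrightarrow> (\<forall>s\<in>S. \<forall>t\<in>S. dist s t < d \<longrightarrow> \<bar>f s - f t\<bar> \<le> e) \<longrightarrow> \<bar>E p f - E P f\<bar> \<le> e)"
    if d: "d > 0" for d :: real
  proof -
    obtain n :: nat and x w where n: "\<And>i. i < n \<Longrightarrow> x i \<in> S" "\<And>i. i < n \<Longrightarrow> 0 \<le> w i" "(\<Sum>i<n. w i) = 1"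
      "\<And>f e. continuous_on S f \<Longrightarrow> (\<forall>s\<in>S. \<forall>t\<in>S. dist s t < d \<longrightarrow> \<bar>f s - f t\<bar> \<le> e) \<Longrightarrow>
        \<bar>E p f - (\<Sum>i<n. w i * f (x i))\<bar> \<le> e"
      by (fact finite_approx[OF S p d])
    have "(dirac S (x i), s (x i)) \<in> house_ext S \<Gamma>" if "i < n" for i
      using n(1)[OF that] s(1) house_ext_gen by blast
    then have "\<exists>P Q. (P, Q) \<in> house_ext S \<Gamma> \<and> (\<forall>f. continuous_on S f \<longrightarrow>
       (\<Sum>i<n. w i) * E P f = (\<Sum>i<n. w i * E (dirac S (x i)) f) \<and> (\<Sum>i<n. w i) * E Q f = (\<Sum>i<n. w i * E (s (x i)) f))"
      using n(2,3) by (intro convex_pairs_finite_combination[OF S ext(1,2)]) auto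
    then obtain P Q where PQ: "(P, Q) \<in> house_ext S \<Gamma>"
      "\<And>f. continuous_on S f \<Longrightarrow> E P f = (\<Sum>i<n. w i * E (dirac S (x i)) f) \<and> E Q f = (\<Sum>i<n. w i * E (s (x i)) f)"
      unfolding n(3) mult_1 by blast
    have EP: "E P f = (\<Sum>i<n. w i * f (x i))" if "continuous_on S f" for f
      using PQ(2)[OF that] integral_dirac_cont[OF n(1) that] by simp
    have "E P a \<le> E Q b"
      using EP[OF a] PQ(2)[OF b] s(2) n(1,2) by (auto intro!: sum_mono mult_left_mono)
    moreover have "\<bar>E p f - E P f\<bar> \<le> e"
      if "continuous_on S f" "\<forall>s\<in>S. \<forall>t\<in>S. dist s t < d \<longrightarrow> \<bar>f s - f t\<bar> \<le> e" for f e
      using n(4)[OF that] EP[OF that(1)] by simp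
    ultimately show ?thesis using PQ(1) by (intro exI[of _ P] exI[of _ Q]) simp
  qed
  then have "\<exists>P Q. (P, Q) \<in> house_ext S \<Gamma> \<and> E P a \<le> E Q b \<and>
     (\<forall>f e. continuous_on S f \<longrightarrow> (\<forall>s\<in>S. \<forall>t\<in>S. dist s t < 1 / real (Suc k) \<longrightarrow> \<bar>f s - f t\<bar> \<le> e) \<longrightarrow> \<bar>E p f - E P f\<bar> \<le> e)" for k
    by simp
  then obtain P Q where PQ: "\<And>k. (P k, Q k) \<in> house_ext S \<Gamma>" "\<And>k. E (P k) a \<le> E (Q k) b"
    "\<And>k f e. continuous_on S f \<Longrightarrow> (\<forall>s\<in>S. \<forall>t\<in>S. dist s t < 1 / real (Suc k) \<longrightarrow> \<bar>f s - f t\<bar> \<le> e) \<Longrightarrow> \<bar>E p f - E (P k) f\<bar> \<le> e"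
    by metis
  have D: "P k \<in> Delta S" "Q k \<in> Delta S" for k using PQ(1) ext(1) by blast+
  have limP: "(\<lambda>k. E (P k) f) \<longlonglongrightarrow> E p f" if f: "continuous_on S f" for f
  proof (rule LIMSEQ_I)
    fix e :: real assume e: "e > 0"
    then obtain d where d: "d > 0" "\<And>s t. s \<in> S \<Longrightarrow> t \<in> S \<Longrightarrow> dist s t < d \<Longrightarrow> dist (f s) (f t) < e/2"
      using compact_uniformly_continuous[OF f S] unfolding uniformly_continuous_on_def by (metis dist_commute half_gt_zero)
    obtain N where N: "1 / real (Suc N) < d" using reals_Archimedean[OF d(1)] by (auto simp: field_simps)
    show "\<exists>N. \<forall>k\<ge>N. norm (E (P k) f - E p f) < e"
    proof (intro exI allI impI)
      fix k assume "N \<le> k"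
      then have "1 / real (Suc k) \<le> 1 / real (Suc N)" by (simp add: field_simps)
      then have "\<bar>E p f - E (P k) f\<bar> \<le> e/2"
        using d(2) N by (intro PQ(3)[OF f]) (force simp: dist_real_def)
      then show "norm (E (P k) f - E p f) < e" using e by (simp add: abs_minus_commute)
    qed
  qed
  \<comment> \<open>The first components converge to \<open>p\<close> by construction; a subsequence
    has to be extracted for the second ones only.\<close>
  obtain r q where r: "strict_mono r" "q \<in> Delta S" "\<And>f. continuous_on S f \<Longrightarrow> (\<lambda>k. E (Q (r k)) f) \<longlonglongrightarrow> E q f"
    by (fact Delta_seq_compact[OF S D(2)])
  have limPr: "(\<lambda>k. E (P (r k)) f) \<longlonglongrightarrow> E p f" if "continuous_on S f" for f
    using LIMSEQ_subseq_LIMSEQ[OF limP[OF that] r(1)] by (simp add: o_def)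
  have "limitin (prod_topology (weak_star S) (weak_star S)) (\<lambda>k. (P (r k), Q (r k))) (p, q) sequentially"
    unfolding limitin_pairwise using limitin_weak_star[OF p D(1) limPr] limitin_weak_star[OF r(2) D(2) r(3)]
    by (simp add: o_def)
  then have "(p, q) \<in> house_ext S \<Gamma>"
    by (rule limitin_closedin[OF _ ext(3)]) (simp_all add: PQ(1))
  moreover have "E p a \<le> E q b"
    using PQ(2) by (intro LIMSEQ_le[OF limPr[OF a] r(3)[OF b]]) auto
  ultimately show ?thesis by blast
qed

text \<open>Leavability: the Dirac mass at \<open>x\<close> is an allowed move with integral
  \<open>v (x, y)\<close>, so the maximum is attained as soon as the inequality holds.\<close>

lemma excessive_iff:
  fixes v :: "'a::metric_space \<times> 'b::metric_space \<Rightarrow> real"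
  assumes X: "compact X" and Y: "compact Y" and v: "continuous_on (X \<times> Y) v" and H: "gambling_house X \<Gamma>"
  shows "excessive X Y \<Gamma> v \<longleftrightarrow> (\<forall>x\<in>X. \<forall>y\<in>Y. \<forall>p\<in>\<Gamma> x. E p (\<lambda>x. v (x, y)) \<le> v (x, y))"
proof -
  have "is_max ((\<lambda>p. bilin v p (dirac Y y)) ` \<Gamma> x) (v (x, y)) \<longleftrightarrow> (\<forall>p\<in>\<Gamma> x. E p (\<lambda>x. v (x, y)) \<le> v (x, y))"
    if xy: "x \<in> X" "y \<in> Y" for x y
  proof -
    have eq: "bilin v p (dirac Y y) = E p (\<lambda>x. v (x, y))" if "p \<in> \<Gamma> x" for p
      using bilin_dirac_right[OF X Y v _ xy(2)] house_subset_Delta[OF H xy(1)] that by blast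
    have "v (x, y) = E (dirac X x) (\<lambda>x. v (x, y))"
      using integral_dirac_cont[OF xy(1) section_continuous(1)[OF v xy(2)]] by simp
    then have "v (x, y) \<in> (\<lambda>p. bilin v p (dirac Y y)) ` \<Gamma> x"
      using eq house_dirac[OF H xy(1)] by (metis image_eqI)
    then show ?thesis using eq by (simp add: is_max_def)
  qed
  then show ?thesis by (simp add: excessive_def)
qed

lemma depressive_iff:
  fixes v :: "'a::metric_space \<times> 'b::metric_space \<Rightarrow> real"
  assumes v: "continuous_on (X \<times> Y) v" and H: "gambling_house Y \<Lambda>"
  shows "depressive X Y \<Lambda> v \<longleftrightarrow> (\<forall>x\<in>X. \<forall>y\<in>Y. \<forall>q\<in>\<Lambda> y. v (x, y) \<le> E q (\<lambda>y. v (x, y)))"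
proof -
  have "is_min ((\<lambda>q. bilin v (dirac X x) q) ` \<Lambda> y) (v (x, y)) \<longleftrightarrow> (\<forall>q\<in>\<Lambda> y. v (x, y) \<le> E q (\<lambda>y. v (x, y)))"
    if xy: "x \<in> X" "y \<in> Y" for x y
  proof -
    have eq: "bilin v (dirac X x) q = E q (\<lambda>y. v (x, y))" if "q \<in> \<Lambda> y" for q
      using bilin_dirac_left[OF v _ xy(1)] house_subset_Delta[OF H xy(2)] that by blast
    have "v (x, y) = E (dirac Y y) (\<lambda>y. v (x, y))"
      using integral_dirac_cont[OF xy(2) section_continuous(2)[OF v xy(1)]] by simp
    then have "v (x, y) \<in> (\<lambda>q. bilin v (dirac X x) q) ` \<Lambda> y"
      using eq house_dirac[OF H xy(2)] by (metis image_eqI)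
    then show ?thesis using eq by (simp add: is_min_def)
  qed
  then show ?thesis by (simp add: depressive_def)
qed

lemma P1_iff:
  fixes v :: "'a::metric_space \<times> 'b::metric_space \<Rightarrow> real"
  assumes X: "compact X" and Y: "compact Y" and v: "continuous_on (X \<times> Y) v" and u: "continuous_on (X \<times> Y) u"
    and H: "gambling_house X \<Gamma>"
  shows "P1 X Y \<Gamma> u v \<longleftrightarrow> (\<forall>x\<in>X. \<forall>y\<in>Y. \<exists>p\<in>house_inf X \<Gamma> x.
    E p (\<lambda>x. v (x, y)) = v (x, y) \<and> v (x, y) \<le> E p (\<lambda>x. u (x, y)))"
proof -
  have eq: "bilin w p (dirac Y y) = E p (\<lambda>x. w (x, y))"
    if "w \<in> {u, v}" "p \<in> house_inf X \<Gamma> x" "y \<in> Y" for w p x y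
    using that house_inf_subset_Delta[OF H] by (intro bilin_dirac_right[OF X Y]) (auto simp: u v)
  show ?thesis
    unfolding P1_def by (intro ball_cong bex_cong refl) (auto simp: eq)
qed

lemma P2_iff:
  fixes v :: "'a::metric_space \<times> 'b::metric_space \<Rightarrow> real"
  assumes v: "continuous_on (X \<times> Y) v" and u: "continuous_on (X \<times> Y) u"
    and H: "gambling_house Y \<Lambda>"
  shows "P2 X Y \<Lambda> u v \<longleftrightarrow> (\<forall>x\<in>X. \<forall>y\<in>Y. \<exists>q\<in>house_inf Y \<Lambda> y.
    E q (\<lambda>y. v (x, y)) = v (x, y) \<and> E q (\<lambda>y. u (x, y)) \<le> v (x, y))"
proof -
  have eq: "bilin w (dirac X x) q = E q (\<lambda>y. w (x, y))"
    if "w \<in> {u, v}" "q \<in> house_inf Y \<Lambda> y" "x \<in> X" for w q x y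
    using that house_inf_subset_Delta[OF H] by (intro bilin_dirac_left) (auto simp: u v)
  show ?thesis
    unfolding P2_def by (intro ball_cong bex_cong refl) (auto simp: eq)
qed

section \<open>Discounted values and their limits\<close>

text \<open>The part of the discounted equation that the convergence proof uses: each player has a
  move that guarantees \<open>w\<close>. In this form exchanging the players amounts to a change of
  sign, and the inner extrema need not be mentioned.\<close>

definition saddle_value ::
  "'a::metric_space set \<Rightarrow> 'b::metric_space set \<Rightarrow> ('a \<Rightarrow> 'a measure set) \<Rightarrow>
   ('b \<Rightarrow> 'b measure set) \<Rightarrow> ('a \<times> 'b \<Rightarrow> real) \<Rightarrow> real \<Rightarrow> ('a \<times> 'b \<Rightarrow> real) \<Rightarrow> bool" where
  "saddle_value X Y \<Gamma> \<Lambda> u l w \<longleftrightarrow> continuous_on (X \<times> Y) w \<and> (\<forall>x\<in>X. \<forall>y\<in>Y.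
     (\<exists>p\<in>\<Gamma> x. \<forall>q\<in>\<Lambda> y. w (x, y) \<le> l * u (x, y) + (1 - l) * bilin w p q) \<and>
     (\<exists>q\<in>\<Lambda> y. \<forall>p\<in>\<Gamma> x. l * u (x, y) + (1 - l) * bilin w p q \<le> w (x, y)))"

lemma is_max_minD:
  assumes "is_max_min A B F w" shows "\<exists>p\<in>A. \<forall>q\<in>B. w \<le> F p q"
proof -
  obtain m where m: "\<forall>p\<in>A. is_min (F p ` B) (m p)" "is_max (m ` A) w"
    using assms unfolding is_max_min_def by auto
  then obtain p where "p \<in> A" "w = m p" unfolding is_max_def by auto
  then show ?thesis using m(1) unfolding is_min_def by auto
qed

lemma is_min_maxD:
  assumes "is_min_max A B F w" shows "\<exists>q\<in>B. \<forall>p\<in>A. F p q \<le> w"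
proof -
  obtain m where m: "\<forall>q\<in>B. is_max ((\<lambda>p. F p q) ` A) (m q)" "is_min (m ` B) w"
    using assms[unfolded is_min_max_def] by (elim exE conjE)
  then obtain q where q: "q \<in> B" "w = m q" unfolding is_min_def by auto
  then have "\<forall>p\<in>A. F p q \<le> w" using m(1) unfolding is_max_def by simp
  then show ?thesis using q(1) by blast
qed

lemma discounted_imp_saddle_value:
  assumes "discounted_value X Y \<Gamma> \<Lambda> u l w" shows "saddle_value X Y \<Gamma> \<Lambda> u l w"
  unfolding saddle_value_def
proof (intro conjI ballI)
  fix x y assume "x \<in> X" "y \<in> Y"
  then have "is_max_min (\<Gamma> x) (\<Lambda> y) (\<lambda>p q. l * u (x, y) + (1 - l) * bilin w p q) (w (x, y))"
    "is_min_max (\<Gamma> x) (\<Lambda> y) (\<lambda>p q. l * u (x, y) + (1 - l) * bilin w p q) (w (x, y))"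
    using assms by (simp_all add: discounted_value_def)
  from is_max_minD[OF this(1)] is_min_maxD[OF this(2)]
  show "\<exists>p\<in>\<Gamma> x. \<forall>q\<in>\<Lambda> y. w (x, y) \<le> l * u (x, y) + (1 - l) * bilin w p q"
    "\<exists>q\<in>\<Lambda> y. \<forall>p\<in>\<Gamma> x. l * u (x, y) + (1 - l) * bilin w p q \<le> w (x, y)" .
qed (use assms in \<open>simp add: discounted_value_def\<close>)

text \<open>Exchanging the players turns the game with payoff \<open>u\<close> into the one with payoff \<open>negswap u\<close>.\<close>

definition negswap :: "('a \<times> 'b \<Rightarrow> real) \<Rightarrow> 'b \<times> 'a \<Rightarrow> real" where
  "negswap v = (\<lambda>(y, x). - v (x, y))"

lemma negswap_Pair [simp]: "negswap v (y, x) = - v (x, y)"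
  by (simp add: negswap_def)

lemma continuous_negswap:
  assumes "continuous_on (X \<times> Y) v" shows "continuous_on (Y \<times> X) (negswap v)"
proof -
  have "continuous_on (Y \<times> X) (\<lambda>z. v (snd z, fst z))"
    by (rule continuous_on_compose2[OF assms]) (auto intro!: continuous_intros)
  then show ?thesis unfolding negswap_def split_def by (rule continuous_on_minus)
qed

lemma bilin_negswap:
  fixes v :: "'a::metric_space \<times> 'b::metric_space \<Rightarrow> real"
  assumes "compact X" "compact Y" "continuous_on (X \<times> Y) v" "p \<in> Delta X" "q \<in> Delta Y"
  shows "bilin (negswap v) q p = - bilin v p q"
  using integral_swap_Delta[OF assms] by (simp add: bilin_def)

section \<open>Estimates for discounted values of a fixed game\<close>

locale game =
  fixes X :: "'a::metric_space set" and Y :: "'b::metric_space set" and \<Gamma> \<Lambda> u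
  assumes std: "standard_gambling_game X Y \<Gamma> \<Lambda> u"
begin

lemma X: "compact X" "X \<noteq> {}" and Y: "compact Y" "Y \<noteq> {}" and u: "continuous_on (X \<times> Y) u"
  and H1: "gambling_house X \<Gamma>" and H2: "gambling_house Y \<Lambda>"
  using std by (auto simp: standard_gambling_game_def)

lemma swap: "game Y X \<Lambda> \<Gamma> (negswap u)"
  using std continuous_negswap by unfold_locales (auto simp: standard_gambling_game_def)

lemma D1: "x \<in> X \<Longrightarrow> p \<in> \<Gamma> x \<Longrightarrow> p \<in> Delta X" and D2: "y \<in> Y \<Longrightarrow> q \<in> \<Lambda> y \<Longrightarrow> q \<in> Delta Y"
  using house_subset_Delta[OF H1] house_subset_Delta[OF H2] by blast+

lemma saddle_value_swap:
  assumes "saddle_value X Y \<Gamma> \<Lambda> u l w"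
  shows "saddle_value Y X \<Lambda> \<Gamma> (negswap u) l (negswap w)"
proof -
  have w: "continuous_on (X \<times> Y) w" using assms by (simp add: saddle_value_def)
  have eq: "l * negswap u (y, x) + (1 - l) * bilin (negswap w) q p = - (l * u (x, y) + (1 - l) * bilin w p q)"
    if "x \<in> X" "y \<in> Y" "p \<in> \<Gamma> x" "q \<in> \<Lambda> y" for x y p q
    using bilin_negswap[OF X(1) Y(1) w D1 D2] that by simp
  show ?thesis
    unfolding saddle_value_def
  proof (intro conjI ballI)
    fix y x assume xy: "y \<in> Y" "x \<in> X"
    obtain p q where p: "p \<in> \<Gamma> x" "\<forall>q\<in>\<Lambda> y. w (x, y) \<le> l * u (x, y) + (1 - l) * bilin w p q"
      and q: "q \<in> \<Lambda> y" "\<forall>p\<in>\<Gamma> x. l * u (x, y) + (1 - l) * bilin w p q \<le> w (x, y)"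
      using assms xy unfolding saddle_value_def by blast
    show "\<exists>q\<in>\<Lambda> y. \<forall>p\<in>\<Gamma> x. negswap w (y, x) \<le> l * negswap u (y, x) + (1 - l) * bilin (negswap w) q p"
    proof (intro bexI[OF _ q(1)] ballI)
      fix p' assume p': "p' \<in> \<Gamma> x"
      show "negswap w (y, x) \<le> l * negswap u (y, x) + (1 - l) * bilin (negswap w) q p'"
        unfolding eq[OF xy(2,1) p' q(1)] unfolding negswap_Pair neg_le_iff_le using q(2) p' by blast
    qed
    show "\<exists>p\<in>\<Gamma> x. \<forall>q\<in>\<Lambda> y. l * negswap u (y, x) + (1 - l) * bilin (negswap w) q p \<le> negswap w (y, x)"
    proof (intro bexI[OF _ p(1)] ballI)
      fix q' assume q': "q' \<in> \<Lambda> y"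
      show "l * negswap u (y, x) + (1 - l) * bilin (negswap w) q' p \<le> negswap w (y, x)"
        unfolding eq[OF xy(2,1) p(1) q'] unfolding negswap_Pair neg_le_iff_le using p(2) q' by blast
    qed
  qed (rule continuous_negswap[OF w])
qed

text \<open>A contraction argument. If \<open>M\<close> is the excess of \<open>w\<close> over the
  bound, pairing an optimal move at one point with a nearby move at the other, for both players,
  reduces the excess to \<open>(1-l) * M\<close>. As the largest excess is attained, it cannot be
  positive.\<close>

lemma saddle_value_modulus:
  assumes l: "l \<in> {0<..1}" and w: "saddle_value X Y \<Gamma> \<Lambda> u l w"
    and m: "modulus X Y u e L" and L: "L > 0"
  shows "modulus X Y w e L"
proof -
  have wc: "continuous_on (X \<times> Y) w" using w by (simp add: saddle_value_def)
  have step: "modulus X Y w (e + (1-l) * M) L" if M: "modulus X Y w (e + M) L" for M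
    unfolding modulus_def
  proof (intro ballI)
    fix x x' y y' assume *: "x \<in> X" "x' \<in> X" "y \<in> Y" "y' \<in> Y"
    let ?d = "L * (dist x x' + dist y y')"
    obtain p where p: "p \<in> \<Gamma> x" "\<And>q. q \<in> \<Lambda> y \<Longrightarrow> w (x, y) \<le> l * u (x, y) + (1 - l) * bilin w p q"
      using w *(1,3) unfolding saddle_value_def by blast
    obtain q' where q': "q' \<in> \<Lambda> y'" "\<And>p. p \<in> \<Gamma> x' \<Longrightarrow> l * u (x', y') + (1 - l) * bilin w p q' \<le> w (x', y')"
      using w *(2,4) unfolding saddle_value_def by blast
    obtain p' where p': "p' \<in> \<Gamma> x'" "dKR X p p' \<le> dist x x'"
      using house_nonexpansive[OF H1 *(1,2) p(1)] by blast
    obtain q where q: "q \<in> \<Lambda> y" "dKR Y q' q \<le> dist y' y"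
      using house_nonexpansive[OF H2 *(4,3) q'(1)] by blast
    have D: "p \<in> Delta X" "p' \<in> Delta X" "q \<in> Delta Y" "q' \<in> Delta Y"
      using D1 D2 p(1) p'(1) q(1) q'(1) * by blast+
    have sym: "dKR Y q q' = dKR Y q' q" by (simp add: dKR_def abs_minus_commute)
    have "bilin w p q - bilin w p' q' \<le> (e + M) + L * (dKR X p p' + dKR Y q q')"
      by (rule bilin_dKR[OF X(1) Y(1) wc M L D])
    also have "\<dots> \<le> (e + M) + ?d"
      using p'(2) q(2) L sym by (intro add_left_mono mult_left_mono add_mono) (auto simp: dist_commute)
    finally have "(1-l) * (bilin w p q - bilin w p' q') \<le> (1-l) * (e + M + ?d)"
      using l by (intro mult_left_mono) auto
    moreover have "l * (u (x, y) - u (x', y')) \<le> l * (e + ?d)"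
      using modulusD[OF m *] l by (intro mult_left_mono) auto
    moreover have "w (x, y) - w (x', y') \<le> l * (u (x, y) - u (x', y')) + (1-l) * (bilin w p q - bilin w p' q')"
      using p(2)[OF q(1)] q'(2)[OF p'(1)] by (simp add: algebra_simps)
    ultimately have "w (x, y) - w (x', y') \<le> l * (e + ?d) + (1-l) * (e + M + ?d)" by linarith
    also have "\<dots> = e + (1-l) * M + ?d" by algebra
    finally show "w (x, y) - w (x', y') \<le> e + (1-l) * M + ?d" .
  qed
  \<comment> \<open>The excess over the desired bound; its maximum over all pairs of points is the
    sharp \<open>M\<close>.\<close>
  let ?F = "\<lambda>(z, z'). w z - w z' - L * (dist (fst z) (fst z') + dist (snd z) (snd z')) - e"
  let ?K = "(X \<times> Y) \<times> (X \<times> Y)"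
  have w1: "continuous_on ?K (\<lambda>z. w (fst z))" "continuous_on ?K (\<lambda>z. w (snd z))"
    by (rule continuous_on_compose2[OF wc], auto intro!: continuous_intros)+
  have "continuous_on ?K ?F"
    unfolding split_def by (intro continuous_intros w1)
  moreover have "compact ?K" "?K \<noteq> {}" using X Y by (auto intro!: compact_Times)
  ultimately obtain z0 where z0: "z0 \<in> ?K" "\<And>z. z \<in> ?K \<Longrightarrow> ?F z \<le> ?F z0"
    using continuous_attains_sup[of ?K ?F] by blast
  define M where "M = ?F z0"
  have MM: "modulus X Y w (e + M) L"
    unfolding modulus_def
  proof (intro ballI)
    fix x x' y y' assume "x \<in> X" "x' \<in> X" "y \<in> Y" "y' \<in> Y"
    then show "w (x, y) - w (x', y') \<le> e + M + L * (dist x x' + dist y y')"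
      using z0(2)[of "((x, y), (x', y'))"] by (simp add: M_def)
  qed
  obtain a b a' b' where z0': "z0 = ((a, b), (a', b'))" by (metis surj_pair)
  have "M \<le> (1-l) * M"
    using modulusD[OF step[OF MM], of a a' b b'] z0(1) by (simp add: M_def z0')
  then have "l * M \<le> 0" by (simp add: algebra_simps)
  then have "M \<le> 0" using l by (simp add: mult_le_0_iff)
  then show ?thesis using MM unfolding modulus_def by (smt (verit))
qed

text \<open>At a maximum point of \<open>w\<close> let player 2 stay put: the continuation is worth
  at most the current value, so the discounted equation leaves \<open>w \<le> u\<close>
  there.\<close>

lemma saddle_value_le:
  assumes l: "l \<in> {0<..1}" and w: "saddle_value X Y \<Gamma> \<Lambda> u l w"
    and B: "\<And>z. z \<in> X \<times> Y \<Longrightarrow> u z \<le> B" and z: "z \<in> X \<times> Y"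
  shows "w z \<le> B"
proof -
  have wc: "continuous_on (X \<times> Y) w" using w by (simp add: saddle_value_def)
  obtain x y where xy: "x \<in> X" "y \<in> Y" "\<And>z. z \<in> X \<times> Y \<Longrightarrow> w z \<le> w (x, y)"
    using continuous_attains_sup[OF compact_Times[OF X(1) Y(1)] _ wc] X(2) Y(2) by auto
  obtain p where p: "p \<in> \<Gamma> x" "\<And>q. q \<in> \<Lambda> y \<Longrightarrow> w (x, y) \<le> l * u (x, y) + (1 - l) * bilin w p q"
    using w xy(1,2) unfolding saddle_value_def by blast
  have "bilin w p (dirac Y y) = E p (\<lambda>x. w (x, y))"
    by (rule bilin_dirac_right[OF X(1) Y(1) wc D1[OF xy(1) p(1)] xy(2)])
  also have "\<dots> \<le> (LINT s|p. w (x, y))"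
    using xy D1[OF xy(1) p(1)]
    by (intro integral_le continuous_integrable[OF X(1)] section_continuous[OF wc] continuous_on_const) auto
  also have "\<dots> = w (x, y)" by (rule integral_const_Delta[OF D1[OF xy(1) p(1)]])
  finally have "w (x, y) \<le> l * u (x, y) + (1 - l) * w (x, y)"
    using p(2)[OF house_dirac[OF H2 xy(2)]] l mult_left_mono[of "bilin w p (dirac Y y)" "w (x, y)" "1 - l"] by auto
  then have "l * w (x, y) \<le> l * u (x, y)" by (simp add: algebra_simps)
  then have "w (x, y) \<le> u (x, y)" using l by simp
  then show ?thesis using xy(3)[OF z] B[of "(x, y)"] xy(1,2) by force
qed

lemma saddle_value_abs_le:
  assumes l: "l \<in> {0<..1}" and w: "saddle_value X Y \<Gamma> \<Lambda> u l w"
    and B: "\<And>z. z \<in> X \<times> Y \<Longrightarrow> \<bar>u z\<bar> \<le> B" and z: "z \<in> X \<times> Y"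
  shows "\<bar>w z\<bar> \<le> B"
proof -
  interpret S: game Y X \<Lambda> \<Gamma> "negswap u" by (rule swap)
  obtain x y where z': "z = (x, y)" "x \<in> X" "y \<in> Y" using z by blast
  have "w z \<le> B" using B by (intro saddle_value_le[OF l w _ z]) force
  moreover have "negswap w (y, x) \<le> B"
  proof (rule S.saddle_value_le[OF l saddle_value_swap[OF w]])
    fix t assume "t \<in> Y \<times> X"
    then show "negswap u t \<le> B" using B[of "(snd t, fst t)"] by (auto simp: abs_le_iff)
  qed (use z' in simp)
  ultimately show ?thesis using z'(1) by simp
qed

text \<open>The optimal moves at discount \<open>l n\<close> vary with \<open>n\<close>. Once
  \<open>q\<close> is fixed, all of them are dominated by one maximizer of the limit payoff against
  \<open>q\<close>; this is why \<open>p\<close> depends on \<open>q\<close> in the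
  conclusion.\<close>

lemma limit_balanced:
  assumes l: "\<And>n::nat. l n \<in> {0<..1}" "l \<longlonglongrightarrow> 0" and w: "\<And>n. saddle_value X Y \<Gamma> \<Lambda> u (l n) (w n)"
    and lim: "uniform_limit (X \<times> Y) w v sequentially" and v: "continuous_on (X \<times> Y) v"
    and xy: "x \<in> X" "y \<in> Y" and q: "q \<in> \<Lambda> y"
  shows "\<exists>p\<in>\<Gamma> x. v (x, y) \<le> bilin v p q"
proof -
  note q' = D2[OF xy(2) q]
  have wc: "continuous_on (X \<times> Y) (w n)" for n using w by (simp add: saddle_value_def)
  have fub: "bilin v p q = E p (\<lambda>x. E q (\<lambda>y. v (x, y)))" if "p \<in> \<Gamma> x" for p
    unfolding bilin_def using integral_swap_Delta[OF X(1) Y(1) v D1[OF xy(1) that] q'] by simp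
  obtain p where p: "p \<in> \<Gamma> x" "\<And>p'. p' \<in> \<Gamma> x \<Longrightarrow> bilin v p' q \<le> bilin v p q"
    using compactin_attains_max[OF house_compactin[OF H1 xy(1)] house_nonempty[OF H1 xy(1)]
        integral_section_continuous(2)[OF X(1) Y(1) v q']] fub by auto
  have le: "v (x, y) - e \<le> bilin v p q + e" if e: "e > 0" for e
  proof -
    have "\<forall>\<^sub>F n in sequentially. \<forall>z\<in>X \<times> Y. dist (w n z) (v z) < e"
      using uniform_limitD[OF lim e] .
    moreover have "v (x, y) - e \<le> l n * u (x, y) + (1 - l n) * (bilin v p q + e)"
      if n: "\<forall>z\<in>X \<times> Y. dist (w n z) (v z) < e" for n
    proof -
      obtain p' where p': "p' \<in> \<Gamma> x" "\<And>q. q \<in> \<Lambda> y \<Longrightarrow> w n (x, y) \<le> l n * u (x, y) + (1 - l n) * bilin (w n) p' q"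
        using w[of n] xy unfolding saddle_value_def by blast
      note D = D1[OF xy(1) p'(1)]
      have "bilin (w n) p' q - bilin v p' q \<le> e"
        unfolding bilin_def
      proof (intro E_diff_le[OF q'] continuous_integrable[OF Y(1)] integral_section_continuous[OF X(1) Y(1)]
          wc v D q' E_diff_le[OF D] continuous_integrable[OF X(1)] section_continuous[OF wc] section_continuous[OF v])
        fix s t assume "s \<in> Y" "t \<in> X"
        then show "w n (t, s) - v (t, s) \<le> e" using n by (force simp: dist_real_def)
      qed
      then have "(1 - l n) * bilin (w n) p' q \<le> (1 - l n) * (bilin v p q + e)"
        using p(2)[OF p'(1)] l(1)[of n] by (intro mult_left_mono) auto
      moreover have "\<bar>w n (x, y) - v (x, y)\<bar> < e" using n xy by (force simp: dist_real_def)
      ultimately show ?thesis using p'(2)[OF q] by linarith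
    qed
    ultimately have ev: "\<forall>\<^sub>F n in sequentially. v (x, y) - e \<le> l n * u (x, y) + (1 - l n) * (bilin v p q + e)"
      by (auto elim: eventually_mono)
    have "(\<lambda>n. l n * u (x, y) + (1 - l n) * (bilin v p q + e)) \<longlonglongrightarrow> 0 * u (x, y) + (1 - 0) * (bilin v p q + e)"
      by (intro tendsto_intros l(2))
    from tendsto_lowerbound[OF this ev] show ?thesis by simp
  qed
  have "v (x, y) \<le> bilin v p q"
  proof (rule field_le_epsilon)
    fix e :: real assume "e > 0"
    then show "v (x, y) \<le> bilin v p q + e" using le[of "e/2"] by simp
  qed
  then show ?thesis using p(1) by blast
qed

text \<open>While \<open>f = v\<^sub>\<lambda>(\<cdot>, y)\<close> exceeds \<open>g = u(\<cdot>, y)\<close> by \<open>e\<close> on average, an optimal move of player 1 against an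
  immobile opponent raises the mean of \<open>f\<close> by at least \<open>\<lambda> e\<close>; as \<open>f\<close> is bounded this has to stop.\<close>

lemma saddle_value_reach:
  assumes l: "l \<in> {0<..1}" and w: "saddle_value X Y \<Gamma> \<Lambda> u l w" and xy: "x \<in> X" "y \<in> Y" and e: "e > 0"
  shows "\<exists>n p. (dirac X x, p) \<in> house_ext X \<Gamma> ^^ n \<and> w (x, y) \<le> E p (\<lambda>x. w (x, y)) \<and>
     E p (\<lambda>x. w (x, y)) - e \<le> E p (\<lambda>x. u (x, y))"
proof (rule ccontr)
  assume neg: "\<not> ?thesis"
  let ?f = "\<lambda>x. w (x, y)" and ?g = "\<lambda>x. u (x, y)"
  have wc: "continuous_on (X \<times> Y) w" using w by (simp add: saddle_value_def)
  have f: "continuous_on X ?f" and g: "continuous_on X ?g"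
    using section_continuous(1)[OF wc xy(2)] section_continuous(1)[OF u xy(2)] by auto
  have it: "p \<in> Delta X" if "(dirac X x, p) \<in> house_ext X \<Gamma> ^^ n" for p n
    using house_iterates_subset_Delta[OF H1 xy(1)] that by blast
  \<comment> \<open>The discounted inequality against a motionless opponent, with the current payoff
    moved to the left: the form in which \<open>house_ext_lift\<close> can extend it from points to
    measures.\<close>
  have sel: "\<exists>p'\<in>\<Gamma> x'. ?f x' - l * ?g x' \<le> E p' (\<lambda>x. (1 - l) * ?f x)" if x': "x' \<in> X" for x'
  proof -
    obtain p where p: "p \<in> \<Gamma> x'" "\<And>q. q \<in> \<Lambda> y \<Longrightarrow> w (x', y) \<le> l * u (x', y) + (1 - l) * bilin w p q"
      using w x' xy(2) unfolding saddle_value_def by blast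
    have "bilin w p (dirac Y y) = E p ?f"
      by (rule bilin_dirac_right[OF X(1) Y(1) wc D1[OF x' p(1)] xy(2)])
    then show ?thesis using p(1) p(2)[OF house_dirac[OF H2 xy(2)]] by (intro bexI[of _ p]) auto
  qed
  have "\<exists>k p. (dirac X x, p) \<in> house_ext X \<Gamma> ^^ k \<and> ?f x + real n * (l * e) \<le> E p ?f" for n
  proof (induction n)
    case 0
    have "(dirac X x, dirac X x) \<in> house_ext X \<Gamma> ^^ 0" by simp
    then show ?case using integral_dirac_cont[OF xy(1) f] by (intro exI[of _ 0] exI[of _ "dirac X x"]) simp
  next
    case (Suc n)
    then obtain k p where p: "(dirac X x, p) \<in> house_ext X \<Gamma> ^^ k" "?f x + real n * (l * e) \<le> E p ?f" by blast
    have pD: "p \<in> Delta X" by (rule it[OF p(1)])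
    have "0 \<le> real n * (l * e)" using l e by simp
    then have "?f x \<le> E p ?f" using p(2) by linarith
    then have lt: "E p ?g < E p ?f - e" using neg p(1) by (meson not_le)
    obtain p' where p': "(p, p') \<in> house_ext X \<Gamma>" "E p (\<lambda>x. ?f x - l * ?g x) \<le> E p' (\<lambda>x. (1 - l) * ?f x)"
      using house_ext_lift[OF X(1) H1 continuous_on_diff[OF f continuous_on_mult_left[OF g]]
          continuous_on_mult_left[OF f] sel pD] by blast
    have rel: "(dirac X x, p') \<in> house_ext X \<Gamma> ^^ Suc k" using p(1) p'(1) by (rule relpow_Suc_I)
    have "E p ?f - l * E p ?g \<le> (1 - l) * E p' ?f"
      using p'(2) continuous_integrable[OF X(1) f pD] continuous_integrable[OF X(1) g pD] by simp
    moreover have "l * E p ?g < l * (E p ?f - e)" using lt l by simp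
    ultimately have inc: "l * e < (1 - l) * (E p' ?f - E p ?f)" by (simp add: algebra_simps)
    moreover have "0 < l * e" using l e by simp
    ultimately have "0 < (1 - l) * (E p' ?f - E p ?f)" by linarith
    then have "0 < E p' ?f - E p ?f" using l by (auto simp: zero_less_mult_iff)
    \<comment> \<open>As the increase is positive, the factor \<open>1 - l\<close> can be replaced
      by 1; there is no division by it.\<close>
    then have "(1 - l) * (E p' ?f - E p ?f) \<le> 1 * (E p' ?f - E p ?f)" using l by (intro mult_right_mono) auto
    then have "?f x + real (Suc n) * (l * e) \<le> E p' ?f" using inc p(2) by (simp add: algebra_simps)
    then show ?case using rel by blast
  qed
  moreover obtain B where B: "\<And>z. z \<in> X \<Longrightarrow> ?f z \<le> B"
    using compact_imp_bounded[OF compact_continuous_image[OF f X(1)]] unfolding bounded_iff by (auto simp: abs_le_iff)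
  have "E p ?f \<le> B" if "p \<in> Delta X" for p
    using integral_le[OF that continuous_integrable[OF X(1) f that] continuous_integrable[OF X(1) continuous_on_const that] B]
      prob_space.prob_space[OF Delta_prob[OF that]] by simp
  ultimately have bound: "?f x + real n * (l * e) \<le> B" for n using it by (meson order.trans)
  obtain n where "B - ?f x < real n * (l * e)" using reals_Archimedean3[of "l * e"] l e by auto
  then show False using bound[of n] by linarith
qed

text \<open>Near the limit, \<open>saddle_value_reach\<close> supplies reachable measures that
  satisfy both inequalities of (P1) up to a small error, and a weak-* limit removes the error.
  Excessiveness extends to \<open>house_inf\<close> and turns the first inequality into an
  equality.\<close>

lemma limit_P1:
  assumes l: "\<And>n::nat. l n \<in> {0<..1}" and w: "\<And>n. saddle_value X Y \<Gamma> \<Lambda> u (l n) (w n)"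
    and lim: "uniform_limit (X \<times> Y) w v sequentially" and v: "continuous_on (X \<times> Y) v"
    and exc: "excessive X Y \<Gamma> v"
  shows "P1 X Y \<Gamma> u v"
  unfolding P1_iff[OF X(1) Y(1) v u H1]
proof (intro ballI)
  fix x y assume xy: "x \<in> X" "y \<in> Y"
  have vs: "continuous_on X (\<lambda>x. v (x, y))" and us: "continuous_on X (\<lambda>x. u (x, y))"
    using section_continuous(1)[OF v xy(2)] section_continuous(1)[OF u xy(2)] by auto
  have "\<exists>p. (\<exists>n. (dirac X x, p) \<in> house_ext X \<Gamma> ^^ n) \<and> v (x, y) - e \<le> E p (\<lambda>x. v (x, y)) \<and>
      v (x, y) - e \<le> E p (\<lambda>x. u (x, y))" if e: "e > 0" for e
  proof -
    have "\<forall>\<^sub>F n in sequentially. \<forall>z\<in>X \<times> Y. dist (w n z) (v z) < e/3"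
      using uniform_limitD[OF lim, of "e/3"] e by simp
    then obtain n where n: "\<And>z. z \<in> X \<times> Y \<Longrightarrow> dist (w n z) (v z) < e/3"
      using eventually_happens'[OF sequentially_bot] by blast
    have wc: "continuous_on (X \<times> Y) (w n)" using w by (simp add: saddle_value_def)
    obtain k p where p: "(dirac X x, p) \<in> house_ext X \<Gamma> ^^ k" "w n (x, y) \<le> E p (\<lambda>x. w n (x, y))"
      "E p (\<lambda>x. w n (x, y)) - e/3 \<le> E p (\<lambda>x. u (x, y))"
      using saddle_value_reach[OF l w xy, of "e/3" n] e by auto
    have pD: "p \<in> Delta X" using house_iterates_subset_Delta[OF H1 xy(1)] p(1) by blast
    have "E p (\<lambda>x. w n (x, y)) - E p (\<lambda>x. v (x, y)) \<le> e/3"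
    proof (rule E_diff_le[OF pD continuous_integrable[OF X(1) section_continuous(1)[OF wc xy(2)] pD]
          continuous_integrable[OF X(1) vs pD]])
      fix s assume "s \<in> X"
      then show "w n (s, y) - v (s, y) \<le> e/3"
        using n[of "(s, y)"] xy(2) abs_ge_self[of "w n (s, y) - v (s, y)"] by (simp add: dist_real_def)
    qed
    moreover have "\<bar>w n (x, y) - v (x, y)\<bar> < e/3" using n[of "(x, y)"] xy by (simp add: dist_real_def)
    ultimately have "v (x, y) - e \<le> E p (\<lambda>x. v (x, y))" "v (x, y) - e \<le> E p (\<lambda>x. u (x, y))"
      using p(2,3) by linarith+
    then show ?thesis using p(1) by blast
  qed
  from this[of "1 / real (Suc _)"] have "\<exists>p. (\<exists>n. (dirac X x, p) \<in> house_ext X \<Gamma> ^^ n) \<and>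
      v (x, y) - 1 / real (Suc k) \<le> E p (\<lambda>x. v (x, y)) \<and> v (x, y) - 1 / real (Suc k) \<le> E p (\<lambda>x. u (x, y))" for k
    by simp
  then obtain P where P: "\<And>k. \<exists>n. (dirac X x, P k) \<in> house_ext X \<Gamma> ^^ n"
    "\<And>k. v (x, y) - 1 / real (Suc k) \<le> E (P k) (\<lambda>x. v (x, y))"
    "\<And>k. v (x, y) - 1 / real (Suc k) \<le> E (P k) (\<lambda>x. u (x, y))" by metis
  have PD: "P k \<in> Delta X" for k using house_iterates_subset_Delta[OF H1 xy(1)] P(1)[of k] by blast
  obtain r p where r: "strict_mono r" "p \<in> Delta X" "\<And>f. continuous_on X f \<Longrightarrow> (\<lambda>n. E (P (r n)) f) \<longlonglongrightarrow> E p f"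
    by (fact Delta_seq_compact[OF X(1) PD])
  have pinf: "p \<in> house_inf X \<Gamma> x"
    by (rule house_inf_limit[OF H1 xy(1) r(2) P(1) r(3)])
  have inv: "(\<lambda>k. v (x, y) - 1 / real (Suc (r k))) \<longlonglongrightarrow> v (x, y) - 0"
    using LIMSEQ_subseq_LIMSEQ[OF LIMSEQ_inverse_real_of_nat r(1)]
    by (intro tendsto_intros) (simp add: o_def inverse_eq_divide)
  have "v (x, y) \<le> E p (\<lambda>x. v (x, y))" "v (x, y) \<le> E p (\<lambda>x. u (x, y))"
    using LIMSEQ_le[OF inv r(3)[OF vs]] LIMSEQ_le[OF inv r(3)[OF us]] P(2,3) by auto
  moreover have "E p (\<lambda>x. v (x, y)) \<le> v (x, y)"
    using exc xy unfolding excessive_iff[OF X(1) Y(1) v H1]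
    by (intro house_inf_excessive[OF X(1) H1 vs _ xy(1) pinf]) auto
  ultimately show "\<exists>p\<in>house_inf X \<Gamma> x. E p (\<lambda>x. v (x, y)) = v (x, y) \<and> v (x, y) \<le> E p (\<lambda>x. u (x, y))"
    using pinf by (intro bexI[of _ p]) auto
qed

end

section \<open>Potentials and the maximum principle\<close>

text \<open>Acyclicity as a strict decrease along every move other than staying put.
  \<open>G\<close> is either the house itself or \<open>house_inf\<close>.\<close>

definition strict_potential ::
  "'a::metric_space set \<Rightarrow> ('a \<Rightarrow> 'a measure set) \<Rightarrow> ('a \<Rightarrow> real) \<Rightarrow> bool" where
  "strict_potential S G \<phi> \<longleftrightarrow> bdd_measurable S \<phi> \<and> lsc_on S \<phi> \<and>
     (\<forall>x\<in>S. \<forall>p\<in>G x. p \<noteq> dirac S x \<longrightarrow> E p \<phi> < \<phi> x)"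

lemma acyclic_max_potential:
  assumes "acyclic_max S G" obtains \<phi> where "strict_potential S G \<phi>"
proof -
  obtain \<phi> where \<phi>: "bdd_measurable S \<phi>" "lsc_on S \<phi>"
    "\<And>x. x \<in> S \<Longrightarrow> {p. is_arg_max (\<lambda>p. E p \<phi>) (\<lambda>p. p \<in> G x) p} = {dirac S x}"
    using assms unfolding acyclic_max_def by auto
  have "E p \<phi> < \<phi> x" if x: "x \<in> S" and p: "p \<in> G x" "p \<noteq> dirac S x" for x p
  proof -
    have am: "is_arg_max (\<lambda>p. E p \<phi>) (\<lambda>p. p \<in> G x) q \<longleftrightarrow> q = dirac S x" for q
      using \<phi>(3)[OF x] by blast
    have "E q \<phi> \<le> E (dirac S x) \<phi>" if "q \<in> G x" for q
      using am[of "dirac S x"] that unfolding is_arg_max_def by force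
    moreover have "\<not> is_arg_max (\<lambda>p. E p \<phi>) (\<lambda>p. p \<in> G x) p" using am p(2) by blast
    then obtain q where "q \<in> G x" "E p \<phi> < E q \<phi>" using p(1) unfolding is_arg_max_def by blast
    ultimately have "E p \<phi> < E (dirac S x) \<phi>" by fastforce
    also have "\<dots> = \<phi> x" using \<phi>(1) x by (intro integral_dirac) (auto simp: bdd_measurable_def)
    finally show ?thesis .
  qed
  then show thesis using that \<phi>(1,2) unfolding strict_potential_def by blast
qed

lemma acyclic_min_imp_max:
  assumes "acyclic_min S G" shows "acyclic_max S G"
proof -
  obtain \<psi> where \<psi>: "bdd_measurable S \<psi>" "usc_on S \<psi>"
    "\<And>x. x \<in> S \<Longrightarrow> {p. is_arg_min (\<lambda>p. E p \<psi>) (\<lambda>p. p \<in> G x) p} = {dirac S x}"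
    using assms unfolding acyclic_min_def by auto
  have "bounded ((\<lambda>s. - \<psi> s) ` S)"
    using \<psi>(1) bounded_uminus[of "\<psi> ` S"] by (simp add: bdd_measurable_def image_image)
  then have "bdd_measurable S (\<lambda>s. - \<psi> s)" using \<psi>(1) by (simp add: bdd_measurable_def)
  moreover have "lsc_on S (\<lambda>s. - \<psi> s)"
    unfolding lsc_on_def
  proof (intro ballI allI impI)
    fix s c assume "s \<in> S" "c < - \<psi> s"
    then have "\<forall>\<^sub>F s' in at s within S. \<psi> s' < - c" using \<psi>(2) unfolding usc_on_def by auto
    then show "\<forall>\<^sub>F s' in at s within S. c < - \<psi> s'" by eventually_elim simp
  qed
  moreover have "is_arg_max (\<lambda>p. E p (\<lambda>s. - \<psi> s)) P = is_arg_min (\<lambda>p. E p \<psi>) P" for P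
    by (simp add: fun_eq_iff is_arg_max_def is_arg_min_def)
  ultimately show ?thesis unfolding acyclic_max_def using \<psi>(3) by (intro exI[of _ "\<lambda>s. - \<psi> s"] conjI ballI) (simp only:)+
qed

lemma strict_potential_mono:
  "strict_potential S G \<phi> \<Longrightarrow> (\<And>x. x \<in> S \<Longrightarrow> G' x \<subseteq> G x) \<Longrightarrow> strict_potential S G' \<phi>"
  unfolding strict_potential_def by blast

lemma lsc_attains_min:
  fixes K :: "'a::metric_space set"
  assumes S: "lsc_on S \<phi>" "bounded (\<phi> ` S)" and K: "compact K" "K \<noteq> {}" "K \<subseteq> S"
  obtains x where "x \<in> K" "\<And>x'. x' \<in> K \<Longrightarrow> \<phi> x \<le> \<phi> x'"
proof -
  define m where "m = Inf (\<phi> ` K)"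
  have bdd: "bdd_below (\<phi> ` K)"
    using bounded_imp_bdd_below[OF S(2)] K(3) by (meson bdd_below_mono image_mono)
  have m: "m \<le> \<phi> x" if "x \<in> K" for x unfolding m_def using cINF_lower[OF bdd that] by simp
  have "\<exists>x\<in>K. \<phi> x < m + 1 / real (Suc n)" for n
  proof -
    have "Inf (\<phi> ` K) < m + 1 / real (Suc n)" by (simp add: m_def)
    from cInf_lessD[OF _ this] show ?thesis using K(2) by blast
  qed
  then obtain X where X: "\<And>n. X n \<in> K" "\<And>n. \<phi> (X n) < m + 1 / real (Suc n)" by metis
  obtain x r where x: "x \<in> K" "strict_mono r" "(X \<circ> r) \<longlonglongrightarrow> x"
    using K(1) X(1) unfolding compact_eq_seq_compact_metric seq_compact_def by blast
  have "\<phi> x \<le> m"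
  proof (rule ccontr)
    assume "\<not> \<phi> x \<le> m"
    then obtain c where c: "m < c" "c < \<phi> x" using dense[of m "\<phi> x"] by auto
    have "\<forall>\<^sub>F s' in at x within S. c < \<phi> s'" using S(1) x(1) K(3) c(2) unfolding lsc_on_def by blast
    then obtain d where d: "d > 0" "\<And>s'. s' \<in> S \<Longrightarrow> s' \<noteq> x \<Longrightarrow> dist s' x < d \<Longrightarrow> c < \<phi> s'"
      unfolding eventually_at by blast
    obtain N1 where N1: "\<And>n. n \<ge> N1 \<Longrightarrow> dist (X (r n)) x < d"
      using metric_LIMSEQ_D[OF x(3) d(1)] by auto
    obtain N2 where N2: "1 / real (Suc N2) < c - m" using reals_Archimedean[of "c - m"] c(1) by (auto simp: field_simps)
    define n where "n = max N1 N2"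
    \<comment> \<open>The filter \<open>at x\<close> ignores \<open>x\<close> itself, so the case
      where the sequence hits its limit is treated apart, by the choice of \<open>c\<close>.\<close>
    have "c < \<phi> (X (r n))"
      using d(2)[of "X (r n)"] N1[of n] X(1) K(3) c(2) by (cases "X (r n) = x") (auto simp: n_def)
    moreover have "1 / real (Suc (r n)) \<le> 1 / real (Suc N2)"
      using seq_suble[OF x(2), of n] by (simp add: n_def field_simps)
    ultimately show False using X(2)[of "r n"] N2 by linarith
  qed
  then show thesis using that[OF x(1)] m by force
qed

lemma exists_ge_integral:
  assumes S: "compact S" and f: "continuous_on S f" and p: "p \<in> Delta S"
  shows "\<exists>s\<in>S. E p f \<le> f s"
proof -
  have "S \<noteq> {}" using prob_space.not_empty[OF Delta_prob[OF p]] Delta_space[OF p] by simp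
  then obtain s where s: "s \<in> S" "\<And>t. t \<in> S \<Longrightarrow> f t \<le> f s"
    using continuous_attains_sup[OF S _ f] by blast
  then have "E p f \<le> E p (\<lambda>_. f s)"
    by (intro integral_le[OF p] continuous_integrable[OF S _ p] f continuous_on_const) auto
  then show ?thesis using s(1) prob_space.prob_space[OF Delta_prob[OF p]] by (intro bexI[of _ s]) simp_all
qed

text \<open>The maximizers of \<open>f\<close> form a compact set, and so does its projection to
  \<open>X\<close>, where the lower semicontinuous potential attains a minimum. The potential sees
  the first coordinate only, so minimality holds against maximizers with any second
  coordinate.\<close>

lemma argmax_min_potential:
  fixes f :: "'a::metric_space \<times> 'b::metric_space \<Rightarrow> real"
  assumes X: "compact X" "X \<noteq> {}" and Y: "compact Y" "Y \<noteq> {}" and f: "continuous_on (X \<times> Y) f"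
    and pot: "strict_potential X G \<phi>"
  obtains x y where "x \<in> X" "y \<in> Y" "\<And>z. z \<in> X \<times> Y \<Longrightarrow> f z \<le> f (x, y)"
    "\<And>x' y'. x' \<in> X \<Longrightarrow> y' \<in> Y \<Longrightarrow> f (x', y') = f (x, y) \<Longrightarrow> \<phi> x \<le> \<phi> x'"
proof -
  obtain z0 where z0: "z0 \<in> X \<times> Y" "\<And>z. z \<in> X \<times> Y \<Longrightarrow> f z \<le> f z0"
    using continuous_attains_sup[OF compact_Times[OF X(1) Y(1)] _ f] X(2) Y(2) by blast
  define Z where "Z = {z \<in> X \<times> Y. f z = f z0}"
  have "closedin (top_of_set (X \<times> Y)) Z"
    unfolding Z_def using continuous_closedin_preimage_constant[OF f] .
  then have "compact Z" by (rule closedin_compact[OF compact_Times[OF X(1) Y(1)]])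
  then have "compact (fst ` Z)" by (intro compact_continuous_image continuous_intros)
  moreover have "fst ` Z \<noteq> {}" "fst ` Z \<subseteq> X" using z0(1) by (auto simp: Z_def)
  moreover have "lsc_on X \<phi>" "bounded (\<phi> ` X)" using pot by (auto simp: strict_potential_def bdd_measurable_def)
  ultimately obtain x where x: "x \<in> fst ` Z" "\<And>x'. x' \<in> fst ` Z \<Longrightarrow> \<phi> x \<le> \<phi> x'"
    using lsc_attains_min by blast
  then obtain y where xy: "(x, y) \<in> Z" by auto
  show thesis
  proof (rule that[of x y])
    fix x' y' assume "x' \<in> X" "y' \<in> Y" "f (x', y') = f (x, y)"
    then have "(x', y') \<in> Z" using xy by (simp add: Z_def)
    then show "\<phi> x \<le> \<phi> x'" using x(2) by force
  qed (use xy z0(2) in \<open>auto simp: Z_def\<close>)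
qed

text \<open>A mean that reaches the upper bound \<open>M\<close> forces \<open>p\<close> to be
  concentrated on the points where \<open>f = M\<close>; a lower bound valid there passes to the
  integral. No continuity of \<open>\<phi>\<close> is involved.\<close>

lemma potential_ge_on_argmax:
  assumes S: "compact S" and f: "continuous_on S f" and p: "p \<in> Delta S" and \<phi>: "bdd_measurable S \<phi>"
    and le: "\<And>s. s \<in> S \<Longrightarrow> f s \<le> M" and ge: "M \<le> E p f"
    and min: "\<And>s. s \<in> S \<Longrightarrow> f s = M \<Longrightarrow> c \<le> \<phi> s"
  shows "c \<le> E p \<phi>"
proof -
  interpret prob_space p by (rule Delta_prob[OF p])
  have fi: "integrable p f" by (rule continuous_integrable[OF S f p])
  have "E p f \<le> E p (\<lambda>_. M)" using le fi by (intro integral_le[OF p]) auto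
  then have "E p (\<lambda>s. M - f s) = 0" using ge fi by (simp add: prob_space)
  moreover have "AE s in p. 0 \<le> M - f s" using le by (intro AE_I2) (simp add: Delta_space[OF p])
  ultimately have "AE s in p. M - f s = 0"
    using integral_nonneg_eq_0_iff_AE[of p "\<lambda>s. M - f s"] fi by simp
  moreover have "AE s in p. s \<in> S" by (intro AE_I2) (simp add: Delta_space[OF p])
  ultimately have "AE s in p. c \<le> \<phi> s" by eventually_elim (use min in simp)
  then have "E p (\<lambda>_. c) \<le> E p \<phi>"
    using bdd_measurable_integrable[OF \<phi> p] by (intro integral_mono_AE) auto
  then show ?thesis by (simp add: prob_space)
qed

context game
begin

text \<open>Let \<open>d\<close> be the best gain of player 2 from a single move against an immobile opponent, and \<open>e\<close>
  that of player 1.  Balancedness gives \<open>max d = max e\<close>, and shows that a move out of an argmax point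
  of one leads to argmax points of the other; so player 1 can move along points where \<open>d\<close> is maximal with
  strictly decreasing potential, unless \<open>max d = 0\<close>.\<close>

lemma balanced_imp_excessive_depressive:
  assumes v: "continuous_on (X \<times> Y) v" and pot: "strict_potential X \<Gamma> \<phi>"
    and B1: "\<And>x y p. x \<in> X \<Longrightarrow> y \<in> Y \<Longrightarrow> p \<in> \<Gamma> x \<Longrightarrow> \<exists>q\<in>\<Lambda> y. bilin v p q \<le> v (x, y)"
    and B2: "\<And>x y q. x \<in> X \<Longrightarrow> y \<in> Y \<Longrightarrow> q \<in> \<Lambda> y \<Longrightarrow> \<exists>p\<in>\<Gamma> x. v (x, y) \<le> bilin v p q"
  shows "excessive X Y \<Gamma> v \<and> depressive X Y \<Lambda> v"
proof -
  have vx: "continuous_on X (\<lambda>x. v (x, y))" if "y \<in> Y" for y by (rule section_continuous(1)[OF v that])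
  have vy: "continuous_on Y (\<lambda>y. v (x, y))" if "x \<in> X" for x by (rule section_continuous(2)[OF v that])
  have Ey: "continuous_on Y (\<lambda>y. E p (\<lambda>x. v (x, y)))" if "p \<in> Delta X" for p
    by (rule integral_section_continuous(1)[OF X(1) Y(1) v that])
  have Ex: "continuous_on X (\<lambda>x. E q (\<lambda>y. v (x, y)))" if "q \<in> Delta Y" for q
    by (rule integral_section_continuous(2)[OF X(1) Y(1) v that])
  have bil: "bilin v p q = E q (\<lambda>y. E p (\<lambda>x. v (x, y)))" for p q by (simp add: bilin_def)
  have bil': "bilin v p q = E p (\<lambda>x. E q (\<lambda>y. v (x, y)))" if "p \<in> Delta X" "q \<in> Delta Y" for p q
    unfolding bilin_def using integral_swap_Delta[OF X(1) Y(1) v that] by simp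
  obtain W where W: "continuous_on (Y \<times> X) W"
    "\<And>y x. y \<in> Y \<Longrightarrow> x \<in> X \<Longrightarrow> \<exists>q\<in>\<Lambda> y. E q (\<lambda>y. negswap v (y, x)) = W (y, x)"
    "\<And>y x q. y \<in> Y \<Longrightarrow> x \<in> X \<Longrightarrow> q \<in> \<Lambda> y \<Longrightarrow> E q (\<lambda>y. negswap v (y, x)) \<le> W (y, x)"
    using house_max[OF Y(1) X(1) continuous_negswap[OF v] H2] by blast
  \<comment> \<open>\<open>W\<close> is a maximum of negated means, so \<open>d\<close> is the
    largest drop of \<open>v\<close> that a single move of player 2 produces.\<close>
  define d where "d z = v z + W (snd z, fst z)" for z
  have dc: "continuous_on (X \<times> Y) d"
    unfolding d_def by (intro continuous_intros v continuous_on_compose2[OF W(1)]) auto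
  have d1: "\<exists>q\<in>\<Lambda> y. v (x, y) - E q (\<lambda>y. v (x, y)) = d (x, y)" if "x \<in> X" "y \<in> Y" for x y
    using W(2)[OF that(2,1)] by (auto simp: d_def)
  have d2: "v (x, y) - E q (\<lambda>y. v (x, y)) \<le> d (x, y)" if "x \<in> X" "y \<in> Y" "q \<in> \<Lambda> y" for x y q
    using W(3)[OF that(2,1,3)] by (simp add: d_def)
  obtain x y where xy: "x \<in> X" "y \<in> Y" and dmax: "\<And>z. z \<in> X \<times> Y \<Longrightarrow> d z \<le> d (x, y)"
    and xmin: "\<And>x' y'. x' \<in> X \<Longrightarrow> y' \<in> Y \<Longrightarrow> d (x', y') = d (x, y) \<Longrightarrow> \<phi> x \<le> \<phi> x'"
    using argmax_min_potential[OF X Y dc pot] by metis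
  define M where "M = d (x, y)"
  have e_le: "E p (\<lambda>x. v (x, y)) - v (x, y) \<le> M" if "x \<in> X" "y \<in> Y" "p \<in> \<Gamma> x" for x y p
  proof -
    obtain q where q: "q \<in> \<Lambda> y" "bilin v p q \<le> v (x, y)" using B1 \<open>x \<in> X\<close> \<open>y \<in> Y\<close> \<open>p \<in> \<Gamma> x\<close> by blast
    have D: "p \<in> Delta X" "q \<in> Delta Y" using D1 D2 that q(1) by blast+
    have "E p (\<lambda>x. v (x, y)) - E p (\<lambda>x. E q (\<lambda>y. v (x, y))) \<le> M"
    proof (rule E_diff_le[OF D(1)])
      fix s assume "s \<in> X"
      then show "v (s, y) - E q (\<lambda>y. v (s, y)) \<le> M"
        using d2[of s y q] dmax[of "(s, y)"] q(1) \<open>y \<in> Y\<close> by (force simp: M_def)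
    qed (intro continuous_integrable[OF X(1)] vx Ex D that)+
    then show ?thesis using q(2) bil'[OF D] by linarith
  qed
  have "M \<le> 0"
  proof (rule ccontr)
    assume "\<not> M \<le> 0"
    then have M: "M > 0" by simp
    obtain q where q: "q \<in> \<Lambda> y" "v (x, y) - E q (\<lambda>y. v (x, y)) = M"
      using d1[OF xy] unfolding M_def by blast
    obtain p where p: "p \<in> \<Gamma> x" "v (x, y) \<le> bilin v p q" using B2 xy q(1) by blast
    have D: "p \<in> Delta X" "q \<in> Delta Y" using D1 D2 xy p(1) q(1) by blast+
    \<comment> \<open>The move \<open>p\<close> compensates the drop \<open>M\<close> caused by
      \<open>q\<close>. Averaged over \<open>q\<close>, player 1 thus gains at least
      \<open>M\<close> by \<open>p\<close>, and some \<open>y'\<close> realizes this gain.\<close>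
    have "E q (\<lambda>y. E p (\<lambda>x. v (x, y)) - v (x, y)) = bilin v p q - E q (\<lambda>y. v (x, y))"
      unfolding bil
      by (intro Bochner_Integration.integral_diff continuous_integrable[OF Y(1)] Ey vy D xy)
    then have "M \<le> E q (\<lambda>y. E p (\<lambda>x. v (x, y)) - v (x, y))" using p(2) q(2) by simp
    moreover have "continuous_on Y (\<lambda>y. E p (\<lambda>x. v (x, y)) - v (x, y))"
      by (intro continuous_intros Ey vy D xy)
    ultimately obtain y' where y': "y' \<in> Y" "M \<le> E p (\<lambda>x. v (x, y')) - v (x, y')"
      using exists_ge_integral[OF Y(1) _ D(2)] by (meson order.trans)
    have ne: "p \<noteq> dirac X x"
      using y' M integral_dirac_cont[OF xy(1) vx[OF y'(1)]] by auto
    \<comment> \<open>At \<open>y'\<close> the answer \<open>q'\<close> takes back the gain of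
      \<open>p\<close>: the mean under \<open>p\<close> of the drop caused by \<open>q'\<close> is
      at least \<open>M\<close>, so \<open>p\<close> is carried by maximizers of
      \<open>d\<close>.\<close>
    obtain q' where q': "q' \<in> \<Lambda> y'" "bilin v p q' \<le> v (x, y')" using B1[OF xy(1) y'(1) p(1)] by blast
    have Dq': "q' \<in> Delta Y" by (rule D2[OF y'(1) q'(1)])
    let ?f = "\<lambda>s. v (s, y') - E q' (\<lambda>y. v (s, y))"
    have f_le: "?f s \<le> M" "?f s \<le> d (s, y')" "d (s, y') \<le> M" if "s \<in> X" for s
      using d2[of s y' q'] dmax[of "(s, y')"] q'(1) y'(1) that by (auto simp: M_def)
    have "\<phi> x \<le> E p \<phi>"
    proof (rule potential_ge_on_argmax[OF X(1) _ D(1) _ f_le(1)])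
      show "bdd_measurable X \<phi>" using pot by (simp add: strict_potential_def)
      show "continuous_on X ?f" by (intro continuous_intros vx Ex Dq' y')
      have "E p ?f = E p (\<lambda>x. v (x, y')) - E p (\<lambda>x. E q' (\<lambda>y. v (x, y)))"
        by (intro Bochner_Integration.integral_diff continuous_integrable[OF X(1)] vx Ex D Dq' y')
      then show "M \<le> E p ?f" using y'(2) q'(2) bil'[OF D(1) Dq'] by simp
      fix s assume s: "s \<in> X" "?f s = M"
      then have "d (s, y') = d (x, y)" using f_le[OF s(1)] unfolding M_def by linarith
      then show "\<phi> x \<le> \<phi> s" by (rule xmin[OF s(1) y'(1)])
    qed
    then show False using pot ne p(1) xy(1) unfolding strict_potential_def by force
  qed
  then show ?thesis
    unfolding excessive_iff[OF X(1) Y(1) v H1] depressive_iff[OF v H2]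
  proof (intro conjI ballI)
    fix x y p assume "x \<in> X" "y \<in> Y" "p \<in> \<Gamma> x"
    then show "E p (\<lambda>x. v (x, y)) \<le> v (x, y)" using e_le \<open>M \<le> 0\<close> by fastforce
  next
    fix x y q assume *: "x \<in> X" "y \<in> Y" "q \<in> \<Lambda> y"
    show "v (x, y) \<le> E q (\<lambda>y. v (x, y))" using d2[OF *] dmax[of "(x, y)"] * \<open>M \<le> 0\<close> by (simp add: M_def)
  qed
qed

text \<open>The measures of (P1) and (P2) do not lower the mean of \<open>v - w\<close>, because
  \<open>w\<close> is excessive and \<open>v\<close> depressive; started at an argmax point, they
  stay on the argmax.\<close>

lemma comparison:
  assumes pot: "strict_potential X (house_inf X \<Gamma>) \<phi>"
    and v: "continuous_on (X \<times> Y) v" "depressive X Y \<Lambda> v" "P1 X Y \<Gamma> u v"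
    and w: "continuous_on (X \<times> Y) w" "excessive X Y \<Gamma> w" "P2 X Y \<Lambda> u w"
    and z: "z \<in> X \<times> Y"
  shows "v z \<le> w z"
proof -
  have vwc: "continuous_on (X \<times> Y) (\<lambda>z. v z - w z)" by (intro continuous_intros v w)
  obtain x y where xy: "x \<in> X" "y \<in> Y"
    and vwmax: "\<And>z. z \<in> X \<times> Y \<Longrightarrow> v z - w z \<le> v (x, y) - w (x, y)"
    and xmin: "\<And>x' y'. x' \<in> X \<Longrightarrow> y' \<in> Y \<Longrightarrow> v (x', y') - w (x', y') = v (x, y) - w (x, y) \<Longrightarrow> \<phi> x \<le> \<phi> x'"
    using argmax_min_potential[OF X Y vwc pot] by metis
  define M where "M = v (x, y) - w (x, y)"
  have le: "v z - w z \<le> M" if "z \<in> X \<times> Y" for z using vwmax[OF that] by (simp add: M_def)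
  have \<phi>: "bdd_measurable X \<phi>" using pot by (simp add: strict_potential_def)
  have "M \<le> 0"
  proof (rule ccontr)
    assume "\<not> M \<le> 0"
    then have M: "M > 0" by simp
    \<comment> \<open>Established on the whole argmax slice above \<open>x\<close>, since the
      measure \<open>q\<close> given by (P2) may spread over that slice.\<close>
    have vu: "v (x, y') \<le> u (x, y')" if y': "y' \<in> Y" "v (x, y') - w (x, y') = M" for y'
    proof -
      have vx: "continuous_on X (\<lambda>x. v (x, y'))" and wx: "continuous_on X (\<lambda>x. w (x, y'))"
        using section_continuous(1)[OF v(1) y'(1)] section_continuous(1)[OF w(1) y'(1)] .
      obtain p where p: "p \<in> house_inf X \<Gamma> x" "E p (\<lambda>x. v (x, y')) = v (x, y')" "v (x, y') \<le> E p (\<lambda>x. u (x, y'))"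
        using v(3) xy(1) y'(1) unfolding P1_iff[OF X(1) Y(1) v(1) u H1] by blast
      have pD: "p \<in> Delta X" using house_inf_subset_Delta[OF H1] p(1) by blast
      have "E p (\<lambda>x. w (x, y')) \<le> w (x, y')"
        using w(2) y'(1) unfolding excessive_iff[OF X(1) Y(1) w(1) H1]
        by (intro house_inf_excessive[OF X(1) H1 wx _ xy(1) p(1)]) blast
      then have ge: "M \<le> E p (\<lambda>x. v (x, y') - w (x, y'))"
        using p(2) y'(2) continuous_integrable[OF X(1) vx pD] continuous_integrable[OF X(1) wx pD] by simp
      have "\<phi> x \<le> E p \<phi>"
      proof (rule potential_ge_on_argmax[OF X(1) _ pD \<phi> _ ge])
        fix s assume "s \<in> X" "v (s, y') - w (s, y') = M"
        then show "\<phi> x \<le> \<phi> s" using y'(1) xmin by (simp add: M_def)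
      qed (use le y'(1) vx wx in \<open>auto intro!: continuous_intros\<close>)
      then have "p = dirac X x" using pot p(1) xy(1) unfolding strict_potential_def by force
      then show ?thesis using p(3) integral_dirac_cont[OF xy(1) section_continuous(1)[OF u y'(1)]] by simp
    qed
    have vy: "continuous_on Y (\<lambda>y. v (x, y))" and wy: "continuous_on Y (\<lambda>y. w (x, y))"
      and uy: "continuous_on Y (\<lambda>y. u (x, y))"
      using section_continuous(2)[OF v(1) xy(1)] section_continuous(2)[OF w(1) xy(1)] section_continuous(2)[OF u xy(1)] .
    obtain q where q: "q \<in> house_inf Y \<Lambda> y" "E q (\<lambda>y. w (x, y)) = w (x, y)" "E q (\<lambda>y. u (x, y)) \<le> w (x, y)"
      using w(3) xy(1,2) unfolding P2_iff[OF w(1) u H2] by blast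
    have qD: "q \<in> Delta Y" using house_inf_subset_Delta[OF H2] q(1) by blast
    note iv = continuous_integrable[OF Y(1) vy qD] and iw = continuous_integrable[OF Y(1) wy qD]
      and iu = continuous_integrable[OF Y(1) uy qD]
    have "E q (\<lambda>y. - v (x, y)) \<le> - v (x, y)"
      using v(2) xy(1) unfolding depressive_iff[OF v(1) H2]
      by (intro house_inf_excessive[OF Y(1) H2 _ _ xy(2) q(1)] continuous_intros vy) auto
    then have ge: "M \<le> E q (\<lambda>y. v (x, y) - w (x, y))"
      using q(2) iv iw by (simp add: M_def)
    txt \<open>Apply the same lemma with \<open>u - v\<close> in place of a potential: it is nonnegative where \<open>v - w = M\<close>.\<close>
    have "0 \<le> E q (\<lambda>y. u (x, y) - v (x, y))"
    proof (rule potential_ge_on_argmax[OF Y(1) _ qD _ _ ge])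
      show "continuous_on Y (\<lambda>y. v (x, y) - w (x, y))" by (intro continuous_intros vy wy)
      show "bdd_measurable Y (\<lambda>y. u (x, y) - v (x, y))"
        by (intro continuous_bdd_measurable[OF Y(1)] continuous_intros uy vy)
    qed (use le vu xy(1) in auto)
    then have "E q (\<lambda>y. v (x, y)) \<le> w (x, y)" using q(3) iu iv by simp
    moreover have "v (x, y) \<le> E q (\<lambda>y. v (x, y))" using \<open>E q (\<lambda>y. - v (x, y)) \<le> - v (x, y)\<close> by simp
    ultimately show False using M by (simp add: M_def)
  qed
  then show ?thesis using le[OF z] by simp
qed

end

section \<open>Convergence under strong acyclicity\<close>

text \<open>Arzela-Ascoli: a diagonal extraction on the countable union of finite nets, made uniform
  by equicontinuity.\<close>

lemma equicontinuous_subsequence: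
  fixes F :: "nat \<Rightarrow> 'c::metric_space \<Rightarrow> real"
  assumes S: "compact S" and B: "\<And>n x. x \<in> S \<Longrightarrow> \<bar>F n x\<bar> \<le> B"
    and eq: "\<And>e. e > 0 \<Longrightarrow> \<exists>d>0. \<forall>n. \<forall>x\<in>S. \<forall>y\<in>S. dist x y < d \<longrightarrow> \<bar>F n x - F n y\<bar> \<le> e"
  obtains r v where "strict_mono r" "uniform_limit S (\<lambda>n. F (r n)) v sequentially"
proof -
  have "\<exists>N. finite N \<and> N \<subseteq> S \<and> S \<subseteq> (\<Union>x\<in>N. ball x (1 / real (Suc k)))" for k
    by (rule compact_finite_net[OF S, of "1 / real (Suc k)"]) auto
  then obtain N where N: "\<And>k. finite (N k)" "\<And>k. N k \<subseteq> S" "\<And>k. S \<subseteq> (\<Union>x\<in>N k. ball x (1 / real (Suc k)))"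
    by metis
  have cnt: "countable (\<Union>k. N k)" using N(1) by (auto intro: countable_finite)
  have bd: "norm (F n x) \<le> B" if "x \<in> (\<Union>k. N k)" for n x using that N(2) B by auto
  have "\<exists>r. strict_mono r \<and> (\<forall>x\<in>\<Union>k. N k. \<exists>l. (\<lambda>n. F (r n) x) \<longlonglongrightarrow> l)"
  proof (rule function_convergent_subsequence[where f = F and M = B, OF cnt bd])
    fix k :: "nat \<Rightarrow> nat" assume "strict_mono k" "\<And>x. x \<in> (\<Union>k. N k) \<Longrightarrow> \<exists>l. (\<lambda>n. F (k n) x) \<longlonglongrightarrow> l"
    then show ?thesis by (intro exI[of _ k]) simp
  qed
  then obtain r where r: "strict_mono r" "\<And>x. x \<in> (\<Union>k. N k) \<Longrightarrow> \<exists>l. (\<lambda>n. F (r n) x) \<longlonglongrightarrow> l"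
    by auto
  have "uniformly_Cauchy_on S (\<lambda>n. F (r n))"
    unfolding uniformly_Cauchy_on_def
  proof (intro allI impI)
    fix e :: real assume e: "e > 0"
    obtain d where d: "d > 0" "\<And>n x y. x \<in> S \<Longrightarrow> y \<in> S \<Longrightarrow> dist x y < d \<Longrightarrow> \<bar>F n x - F n y\<bar> \<le> e/4"
      using eq[of "e/4"] e by auto
    obtain k where k: "1 / real (Suc k) < d" using reals_Archimedean[OF d(1)] by (auto simp: field_simps)
    have "\<exists>M. \<forall>m\<ge>M. \<forall>n\<ge>M. dist (F (r m) s) (F (r n) s) < e/4" if "s \<in> N k" for s
    proof -
      have "Cauchy (\<lambda>n. F (r n) s)" using r(2) that LIMSEQ_imp_Cauchy by blast
      from metric_CauchyD[OF this, of "e/4"] e show ?thesis by simp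
    qed
    then obtain M where M: "\<And>s m n. s \<in> N k \<Longrightarrow> m \<ge> M s \<Longrightarrow> n \<ge> M s \<Longrightarrow> dist (F (r m) s) (F (r n) s) < e/4"
      by metis
    have "dist (F (r m) x) (F (r n) x) < e"
      if mn: "x \<in> S" "m \<ge> Max (M ` N k)" "n \<ge> Max (M ` N k)" for m n x
    proof -
      obtain s where s: "s \<in> N k" "dist s x < 1 / real (Suc k)" using N(3)[of k] mn(1) by auto
      have sS: "s \<in> S" using s(1) N(2) by blast
      have "M s \<le> Max (M ` N k)" using s(1) N(1) by simp
      then have "dist (F (r m) s) (F (r n) s) < e/4" using M[OF s(1)] mn by simp
      moreover have "\<bar>F (r m) s - F (r m) x\<bar> \<le> e/4" "\<bar>F (r n) s - F (r n) x\<bar> \<le> e/4"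
        using d(2)[OF sS mn(1)] s(2) k by auto
      ultimately show ?thesis using e unfolding dist_real_def by linarith
    qed
    then show "\<exists>M. \<forall>x\<in>S. \<forall>m\<ge>M. \<forall>n\<ge>M. dist (F (r m) x) (F (r n) x) < e" by blast
  qed
  then have "uniformly_convergent_on S (\<lambda>n. F (r n))" by (rule Cauchy_uniformly_convergent)
  then show thesis using that r(1) unfolding uniformly_convergent_on_def by blast
qed

lemma uniform_limit_negswap:
  assumes "uniform_limit (X \<times> Y) w v F"
  shows "uniform_limit (Y \<times> X) (\<lambda>n. negswap (w n)) (negswap v) F"
proof (rule uniform_limitI)
  fix e :: real assume "e > 0"
  from uniform_limitD[OF assms this]
  show "\<forall>\<^sub>F n in F. \<forall>z\<in>Y \<times> X. dist (negswap (w n) z) (negswap v z) < e"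
    by eventually_elim (auto simp: dist_minus)
qed

context game
begin

lemma excessive_negswap: "continuous_on (X \<times> Y) v \<Longrightarrow> excessive Y X \<Lambda> (negswap v) \<longleftrightarrow> depressive X Y \<Lambda> v"
  using excessive_iff[OF Y(1) X(1) continuous_negswap H2, of v] depressive_iff[OF _ H2, of X v] by auto

lemma depressive_negswap: "continuous_on (X \<times> Y) v \<Longrightarrow> depressive Y X \<Gamma> (negswap v) \<longleftrightarrow> excessive X Y \<Gamma> v"
  using depressive_iff[OF continuous_negswap H1, of Y v] excessive_iff[OF X(1) Y(1) _ H1, of v] by auto

lemma P1_negswap: "continuous_on (X \<times> Y) v \<Longrightarrow> P1 Y X \<Lambda> (negswap u) (negswap v) \<longleftrightarrow> P2 X Y \<Lambda> u v"
  using P1_iff[OF Y(1) X(1) continuous_negswap continuous_negswap[OF u] H2, of v] P2_iff[OF _ u H2, of v] by auto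

lemma P2_negswap: "continuous_on (X \<times> Y) v \<Longrightarrow> P2 Y X \<Gamma> (negswap u) (negswap v) \<longleftrightarrow> P1 X Y \<Gamma> u v"
  using P2_iff[OF continuous_negswap continuous_negswap[OF u] H1, of v] P1_iff[OF X(1) Y(1) _ u H1, of v] by auto

lemma comparison_strongly_acyclic:
  assumes ac: "acyclic_max X (house_inf X \<Gamma>) \<or> acyclic_min Y (house_inf Y \<Lambda>)"
    and v: "continuous_on (X \<times> Y) v" "excessive X Y \<Gamma> v" "depressive X Y \<Lambda> v" "P1 X Y \<Gamma> u v"
    and w: "continuous_on (X \<times> Y) w" "excessive X Y \<Gamma> w" "depressive X Y \<Lambda> w" "P2 X Y \<Lambda> u w"
    and z: "z \<in> X \<times> Y"
  shows "v z \<le> w z"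
  using ac
proof
  assume "acyclic_max X (house_inf X \<Gamma>)"
  then obtain \<phi> where "strict_potential X (house_inf X \<Gamma>) \<phi>" by (rule acyclic_max_potential)
  from comparison[OF this v(1,3,4) w(1,2,4) z] show ?thesis .
next
  assume "acyclic_min Y (house_inf Y \<Lambda>)"
  then have "acyclic_max Y (house_inf Y \<Lambda>)" by (rule acyclic_min_imp_max)
  then obtain \<psi> where pot: "strict_potential Y (house_inf Y \<Lambda>) \<psi>" by (rule acyclic_max_potential)
  interpret S: game Y X \<Lambda> \<Gamma> "negswap u" by (rule swap)
  \<comment> \<open>In the swapped game (P2) for \<open>w\<close> becomes (P1) for
    \<open>negswap w\<close>, so the two functions exchange their roles and the order is
    reversed.\<close>
  have "negswap w (snd z, fst z) \<le> negswap v (snd z, fst z)"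
    using v w z
    by (intro S.comparison[OF pot] continuous_negswap)
      (auto simp: depressive_negswap P1_negswap excessive_negswap P2_negswap)
  then show ?thesis by simp
qed

text \<open>Collects what a limit of discounted values inherits. Each fact about player 2 is the
  fact about player 1 in the swapped game.\<close>

lemma accumulation_point:
  assumes l: "\<And>n::nat. l n \<in> {0<..1}" "l \<longlonglongrightarrow> 0" and w: "\<And>n. saddle_value X Y \<Gamma> \<Lambda> u (l n) (w n)"
    and ac: "acyclic_max X (house_inf X \<Gamma>) \<or> acyclic_min Y (house_inf Y \<Lambda>)"
  obtains r v where "strict_mono r" "uniform_limit (X \<times> Y) (\<lambda>n. w (r n)) v sequentially"
    "continuous_on (X \<times> Y) v" "excessive X Y \<Gamma> v" "depressive X Y \<Lambda> v" "P1 X Y \<Gamma> u v" "P2 X Y \<Lambda> u v"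
proof -
  interpret S: game Y X \<Lambda> \<Gamma> "negswap u" by (rule swap)
  have cpt: "compact (X \<times> Y)" by (rule compact_Times[OF X(1) Y(1)])
  obtain B where B: "\<And>z. z \<in> X \<times> Y \<Longrightarrow> \<bar>u z\<bar> \<le> B"
    using compact_imp_bounded[OF compact_continuous_image[OF u cpt]] unfolding bounded_iff by auto
  have equi: "\<exists>d>0. \<forall>n. \<forall>z\<in>X \<times> Y. \<forall>z'\<in>X \<times> Y. dist z z' < d \<longrightarrow> \<bar>w n z - w n z'\<bar> \<le> e" if e: "e > 0" for e
  proof -
    obtain L where L: "L > 0" "modulus X Y u (e/2) L" using continuous_imp_modulus[OF X(1) Y(1) u, of "e/2"] e by auto
    have m: "modulus X Y (w n) (e/2) L" for n by (rule saddle_value_modulus[OF l(1) w L(2,1)])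
    have le: "w n z - w n z' \<le> e" if z: "z \<in> X \<times> Y" "z' \<in> X \<times> Y" "dist z z' < e/(4*L)" for n z z'
    proof -
      have "w n z - w n z' \<le> e/2 + L * (dist (fst z) (fst z') + dist (snd z) (snd z'))"
        using modulusD[OF m, of "fst z" "fst z'" "snd z" "snd z'" n] z by auto
      also have "\<dots> \<le> e/2 + L * (2 * dist z z')"
        using dist_fst_le[of z z'] dist_snd_le[of z z'] L(1) by simp
      also have "\<dots> \<le> e" using z(3) L(1) by (simp add: field_simps)
      finally show ?thesis .
    qed
    show ?thesis
    proof (intro exI[of _ "e/(4*L)"] conjI allI ballI impI)
      fix n z z' assume "z \<in> X \<times> Y" "z' \<in> X \<times> Y" "dist z z' < e/(4*L)"
      then show "\<bar>w n z - w n z'\<bar> \<le> e" using le[of z z' n] le[of z' z n] by (simp add: dist_commute abs_le_iff)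
    qed (use e L in simp)
  qed
  obtain r v where r: "strict_mono r" and v: "uniform_limit (X \<times> Y) (\<lambda>n. w (r n)) v sequentially"
    using equicontinuous_subsequence[OF cpt saddle_value_abs_le[OF l(1) w B] equi] by blast
  have wc: "continuous_on (X \<times> Y) (w n)" for n using w by (simp add: saddle_value_def)
  have vc: "continuous_on (X \<times> Y) v"
    by (rule uniform_limit_theorem[OF _ v]) (simp_all add: wc)
  have lr: "l (r n) \<in> {0<..1}" "saddle_value X Y \<Gamma> \<Lambda> u (l (r n)) (w (r n))"
    "saddle_value Y X \<Lambda> \<Gamma> (negswap u) (l (r n)) (negswap (w (r n)))" for n
    using l(1) w saddle_value_swap by auto
  have lr0: "(\<lambda>n. l (r n)) \<longlonglongrightarrow> 0" using LIMSEQ_subseq_LIMSEQ[OF l(2) r] by (simp add: o_def)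
  note vs = uniform_limit_negswap[OF v]
  have B2: "\<exists>p\<in>\<Gamma> x. v (x, y) \<le> bilin v p q" if "x \<in> X" "y \<in> Y" "q \<in> \<Lambda> y" for x y q
    by (rule limit_balanced[OF lr(1) lr0 lr(2) v vc that])
  have B2s: "\<exists>q\<in>\<Lambda> y. negswap v (y, x) \<le> bilin (negswap v) q p" if "y \<in> Y" "x \<in> X" "p \<in> \<Gamma> x" for x y p
    by (rule S.limit_balanced[OF lr(1) lr0 lr(3) vs continuous_negswap[OF vc] that])
  have bs: "bilin (negswap v) q p = - bilin v p q" if "x \<in> X" "y \<in> Y" "p \<in> \<Gamma> x" "q \<in> \<Lambda> y" for x y p q
    using bilin_negswap[OF X(1) Y(1) vc D1 D2] that by blast
  have B1: "\<exists>q\<in>\<Lambda> y. bilin v p q \<le> v (x, y)" if "x \<in> X" "y \<in> Y" "p \<in> \<Gamma> x" for x y p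
    using B2s[OF that(2,1,3)] bs[OF that] by fastforce
  have B1s: "\<exists>p\<in>\<Gamma> x. bilin (negswap v) q p \<le> negswap v (y, x)" if "y \<in> Y" "x \<in> X" "q \<in> \<Lambda> y" for x y q
    using B2[OF that(2,1,3)] bs[OF that(2,1) _ that(3)] by fastforce
  have ed: "excessive X Y \<Gamma> v \<and> depressive X Y \<Lambda> v"
    using ac
  proof
    assume "acyclic_max X (house_inf X \<Gamma>)"
    then obtain \<phi> where "strict_potential X (house_inf X \<Gamma>) \<phi>" by (rule acyclic_max_potential)
    then have "strict_potential X \<Gamma> \<phi>" by (rule strict_potential_mono) (rule house_subset_house_inf[OF H1])
    then show ?thesis by (rule balanced_imp_excessive_depressive[OF vc _ B1 B2])
  next
    assume "acyclic_min Y (house_inf Y \<Lambda>)"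
    then have "acyclic_max Y (house_inf Y \<Lambda>)" by (rule acyclic_min_imp_max)
    then obtain \<psi> where "strict_potential Y (house_inf Y \<Lambda>) \<psi>" by (rule acyclic_max_potential)
    then have "strict_potential Y \<Lambda> \<psi>" by (rule strict_potential_mono) (rule house_subset_house_inf[OF H2])
    then have "excessive Y X \<Lambda> (negswap v) \<and> depressive Y X \<Gamma> (negswap v)"
      by (rule S.balanced_imp_excessive_depressive[OF continuous_negswap[OF vc] _ B1s B2s])
    then show ?thesis by (simp add: excessive_negswap[OF vc] depressive_negswap[OF vc])
  qed
  have "P1 X Y \<Gamma> u v" by (rule limit_P1[OF lr(1,2) v vc]) (use ed in simp)
  moreover have "P1 Y X \<Lambda> (negswap u) (negswap v)"
    by (rule S.limit_P1[OF lr(1,3) vs continuous_negswap[OF vc]]) (simp add: ed excessive_negswap[OF vc])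
  ultimately show thesis using that[OF r v vc] ed P1_negswap[OF vc] by blast
qed

text \<open>Any two limits along sequences of discounts tending to 0 compare in both directions and
  hence agree. A sequence of discounts that stays away from \<open>v\<close> would have a further
  limit.\<close>

lemma strongly_acyclic_convergence:
  assumes vl: "\<And>l. l \<in> {0<..1} \<Longrightarrow> saddle_value X Y \<Gamma> \<Lambda> u l (vl l)"
    and ac: "acyclic_max X (house_inf X \<Gamma>) \<or> acyclic_min Y (house_inf Y \<Lambda>)"
  obtains v where "uniform_limit (X \<times> Y) vl v (at_right 0)"
    "continuous_on (X \<times> Y) v" "excessive X Y \<Gamma> v" "depressive X Y \<Lambda> v" "P1 X Y \<Gamma> u v" "P2 X Y \<Lambda> u v"
proof -
  have l0: "1 / real (Suc n) \<in> {0<..1}" for n by simp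
  have lim0: "(\<lambda>n. 1 / real (Suc n)) \<longlonglongrightarrow> 0"
    using LIMSEQ_inverse_real_of_nat by (simp add: inverse_eq_divide)
  obtain v where v: "continuous_on (X \<times> Y) v" "excessive X Y \<Gamma> v" "depressive X Y \<Lambda> v" "P1 X Y \<Gamma> u v" "P2 X Y \<Lambda> u v"
    using accumulation_point[OF l0 lim0 vl[OF l0] ac] by blast
  have "uniform_limit (X \<times> Y) vl v (at_right 0)"
  proof (rule ccontr)
    assume "\<not> ?thesis"
    then obtain e where e: "e > 0" "\<not> (\<forall>\<^sub>F l in at_right 0. \<forall>z\<in>X \<times> Y. dist (vl l z) (v z) < e)"
      unfolding uniform_limit_iff by blast
    have "\<exists>l. 0 < l \<and> l < 1 / real (Suc n) \<and> \<not> (\<forall>z\<in>X \<times> Y. dist (vl l z) (v z) < e)" for n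
      using e(2) unfolding eventually_at_right_field by (meson of_nat_0_less_iff zero_less_Suc zero_less_divide_1_iff)
    then obtain l where l: "\<And>n. 0 < l n" "\<And>n. l n < 1 / real (Suc n)"
      "\<And>n. \<not> (\<forall>z\<in>X \<times> Y. dist (vl (l n) z) (v z) < e)" by metis
    have "l n \<le> 1" for n using l(2)[of n] l0[of n] by (meson greaterThanAtMost_iff less_imp_le order.trans)
    then have l1: "l n \<in> {0<..1}" for n using l(1) by simp
    have "l \<longlonglongrightarrow> 0"
      by (rule tendsto_sandwich[OF _ _ tendsto_const lim0]) (use l(1,2) in \<open>auto intro!: always_eventually less_imp_le\<close>)
    from accumulation_point[OF l1 this vl[OF l1] ac]
    obtain r w where w: "strict_mono r" "uniform_limit (X \<times> Y) (\<lambda>n. vl (l (r n))) w sequentially"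
      "continuous_on (X \<times> Y) w" "excessive X Y \<Gamma> w" "depressive X Y \<Lambda> w" "P1 X Y \<Gamma> u w" "P2 X Y \<Lambda> u w"
      by blast
    have "w z = v z" if "z \<in> X \<times> Y" for z
      using comparison_strongly_acyclic[OF ac w(3-6) v(1-3,5) that] comparison_strongly_acyclic[OF ac v(1-4) w(3-5,7) that]
      by simp
    moreover obtain n where "\<forall>z\<in>X \<times> Y. dist (vl (l (r n)) z) (w z) < e"
      using eventually_happens'[OF sequentially_bot uniform_limitD[OF w(2) e(1)]] by blast
    ultimately show False using l(3)[of "r n"] by simp
  qed
  then show thesis using that v by blast
qed

end

section \<open>Houses on three points\<close>

text \<open>A saddle point determines both iterated extrema. The inner extrema have to be attained
  for every move, not only for the optimal ones, which is what \<open>mins\<close> and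
  \<open>maxs\<close> provide.\<close>

lemma saddle_point_values:
  assumes p: "p \<in> A" and q: "q \<in> B" and le: "\<And>p'. p' \<in> A \<Longrightarrow> F p' q \<le> w" and ge: "\<And>q'. q' \<in> B \<Longrightarrow> w \<le> F p q'"
    and mins: "\<And>p'. p' \<in> A \<Longrightarrow> \<exists>m. is_min (F p' ` B) m" and maxs: "\<And>q'. q' \<in> B \<Longrightarrow> \<exists>m. is_max ((\<lambda>p'. F p' q') ` A) m"
  shows "is_max_min A B F w" "is_min_max A B F w"
proof -
  have w: "F p q = w" using le[OF p] ge[OF q] by simp
  define m where "m p' = (SOME m. is_min (F p' ` B) m)" for p'
  have m: "is_min (F p' ` B) (m p')" if "p' \<in> A" for p' unfolding m_def using someI_ex[OF mins[OF that]] .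
  have mw: "m p' \<le> w" if "p' \<in> A" for p'
  proof -
    have "m p' \<le> F p' q" using m[OF that] q by (simp add: is_min_def)
    then show ?thesis using le[OF that] by simp
  qed
  moreover have "w \<le> m p" using m[OF p] ge by (auto simp: is_min_def)
  then have "m p = w" using mw[OF p] by simp
  ultimately have "is_max (m ` A) w" using p by (auto simp: is_max_def)
  then show "is_max_min A B F w" using m unfolding is_max_min_def by blast
  define n where "n q' = (SOME m. is_max ((\<lambda>p'. F p' q') ` A) m)" for q'
  have n: "is_max ((\<lambda>p'. F p' q') ` A) (n q')" if "q' \<in> B" for q' unfolding n_def using someI_ex[OF maxs[OF that]] .
  have nw: "w \<le> n q'" if "q' \<in> B" for q'
  proof -
    have "F p q' \<le> n q'" using n[OF that] p by (simp add: is_max_def)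
    then show ?thesis using ge[OF that] by simp
  qed
  moreover have "n q \<le> w" using n[OF q] le by (auto simp: is_max_def)
  then have "n q = w" using nw[OF q] by simp
  ultimately have "is_min (n ` B) w" using q by (auto simp: is_min_def)
  then show "is_min_max A B F w" using n unfolding is_min_max_def by blast
qed

text \<open>The parabola makes every proper move risky, and small moves only to second order. The
  bound 1/4 keeps \<open>1 - 2 * \<alpha> - \<gamma>\<close> nonnegative, so that no move
  interchanges the order of two positions.\<close>

definition move_set :: "(real \<times> real) set" where
  "move_set = {(\<alpha>, \<gamma>). 0 \<le> \<alpha> \<and> \<alpha> \<le> 1/4 \<and> \<alpha>\<^sup>2 \<le> \<gamma> \<and> \<gamma> \<le> \<alpha>}"

lemma move_setD:
  assumes "z \<in> move_set"
  shows "0 \<le> fst z" "fst z \<le> 1/4" "(fst z)\<^sup>2 \<le> snd z" "snd z \<le> fst z" "0 \<le> snd z"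
  using assms by (auto simp: move_set_def intro: order.trans[OF zero_le_power2])

text \<open>In \<open>chord_set\<close> the parabola \<open>\<gamma> = \<alpha>\<^sup>2\<close> is replaced by its chords between consecutive points \<open>\<alpha> = 4 ^ -n\<close>.\<close>

definition chord_set :: "(real \<times> real) set" where
  "chord_set = {(\<alpha>, \<gamma>) \<in> move_set. \<forall>n::nat. 5 * (1/4)^n * \<alpha> - 4 * ((1/4)^n)\<^sup>2 \<le> \<gamma>}"

text \<open>A player in state \<open>a\<close> or \<open>b\<close> chooses \<open>(\<alpha>, \<gamma>)\<close> in a set \<open>P\<close>, reaches the other one of these two states
  with probability \<open>\<alpha>\<close> and is absorbed in \<open>c\<close> with probability \<open>\<gamma>\<close>.\<close>

locale triangle =
  fixes a b c :: "'a::metric_space"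
  assumes dists: "dist a b = 1" "dist a c = 1" "dist b c = 1"
begin

lemma ne [simp]: "a \<noteq> b" "a \<noteq> c" "b \<noteq> c" "b \<noteq> a" "c \<noteq> a" "c \<noteq> b"
  using dists by auto

definition "T = {a, b, c}"

lemma T_mem [simp]: "a \<in> T" "b \<in> T" "c \<in> T" and finite_T [simp]: "finite T"
  by (auto simp: T_def)

lemma dist_T: "x \<in> T \<Longrightarrow> y \<in> T \<Longrightarrow> x \<noteq> y \<Longrightarrow> dist x y = 1"
  using dists by (auto simp: T_def dist_commute)

lemma compact_T: "compact T" by (simp add: finite_imp_compact)

lemma continuous_T: "continuous_on T (f :: 'a \<Rightarrow> real)"
  by (rule continuous_on_finite) simp

lemma continuous_TT: "continuous_on (T \<times> T) (f :: 'a \<times> 'a \<Rightarrow> real)"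
  by (rule continuous_on_finite) simp

lemma sets_T: "sets (borel_on T) = Pow T"
proof -
  have "B \<in> sets borel" if "B \<subseteq> T" for B
    using finite_subset[OF that] by (intro borel_closed finite_imp_closed) simp
  then show ?thesis by (auto simp: sets_restrict_space)
qed

definition pt :: "('a \<Rightarrow> real) \<Rightarrow> 'a measure" where
  "pt f = point_measure T (\<lambda>s. ennreal (f s))"

lemma sets_pt [simp]: "sets (pt f) = Pow T" and space_pt [simp]: "space (pt f) = T"
  by (simp_all add: pt_def sets_point_measure space_point_measure)

lemma emeasure_pt: "A \<subseteq> T \<Longrightarrow> emeasure (pt f) A = (\<Sum>s\<in>A. ennreal (f s))"
  unfolding pt_def by (rule emeasure_point_measure_finite) auto

lemma E_pt: "(\<And>s. s \<in> T \<Longrightarrow> 0 \<le> f s) \<Longrightarrow> E (pt f) g = (\<Sum>s\<in>T. f s * g s)"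
  unfolding pt_def by (subst lebesgue_integral_point_measure_finite) auto

lemma pt_in_Delta:
  assumes "\<And>s. s \<in> T \<Longrightarrow> 0 \<le> f s" "sum f T = 1" shows "pt f \<in> Delta T"
  unfolding Delta_def
proof (intro CollectI conjI prob_spaceI)
  show "emeasure (pt f) (space (pt f)) = 1"
    using assms by (simp add: emeasure_pt sum_ennreal)
qed (simp add: sets_T)

lemma pt_cong: "(\<And>s. s \<in> T \<Longrightarrow> f s = g s) \<Longrightarrow> pt f = pt g"
  by (rule measure_eqI) (auto simp: emeasure_pt intro!: sum.cong)

lemma mix_pt:
  assumes "\<And>s. s \<in> T \<Longrightarrow> 0 \<le> f s" "\<And>s. s \<in> T \<Longrightarrow> 0 \<le> g s" and t: "t \<in> {0..1}"
  shows "mix t (pt f) (pt g) = pt (\<lambda>s. (1-t) * f s + t * g s)"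
proof (rule measure_eqI)
  fix A assume "A \<in> sets (mix t (pt f) (pt g))"
  then have A: "A \<subseteq> T" by simp
  have "emeasure (mix t (pt f) (pt g)) A = (\<Sum>s\<in>A. ennreal (1-t) * ennreal (f s) + ennreal t * ennreal (g s))"
    using A by (simp add: emeasure_mix emeasure_pt sum.distrib sum_distrib_left)
  also have "\<dots> = (\<Sum>s\<in>A. ennreal ((1-t) * f s + t * g s))"
    using A assms by (intro sum.cong refl) (auto simp: ennreal_mult ennreal_plus subset_iff)
  finally show "emeasure (mix t (pt f) (pt g)) A = emeasure (pt (\<lambda>s. (1-t) * f s + t * g s)) A"
    using A by (simp add: emeasure_pt)
qed simp

lemma dirac_pt: "s \<in> T \<Longrightarrow> dirac T s = pt (indicator {s})"
proof (rule measure_eqI)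
  fix A assume s: "s \<in> T" and "A \<in> sets (dirac T s)"
  then have A: "A \<subseteq> T" by (simp add: dirac_def sets_T)
  then have "finite A" using finite_subset by fastforce
  have "emeasure (dirac T s) A = indicator A s"
    unfolding dirac_def using A by (intro emeasure_return) (simp add: sets_T)
  also have "\<dots> = (\<Sum>r\<in>A. if r = s then 1 else 0)" using \<open>finite A\<close> by (simp add: indicator_def)
  also have "\<dots> = emeasure (pt (indicator {s})) A"
    unfolding emeasure_pt[OF A] by (rule sum.cong) auto
  finally show "emeasure (dirac T s) A = emeasure (pt (indicator {s})) A" .
qed (simp add: dirac_def sets_T)

definition other :: "'a \<Rightarrow> 'a" where "other x = (if x = a then b else a)"

definition wt :: "'a \<Rightarrow> real \<times> real \<Rightarrow> 'a \<Rightarrow> real" where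
  "wt x z s = (if x = c then indicator {c} s
     else if s = x then 1 - fst z - snd z else if s = c then snd z else fst z)"

definition house :: "(real \<times> real) set \<Rightarrow> 'a \<Rightarrow> 'a measure set" where
  "house P x = (\<lambda>z. pt (wt x z)) ` P"

lemma wt_nonneg: "z \<in> move_set \<Longrightarrow> 0 \<le> wt x z s"
  using move_setD[of z] by (auto simp: wt_def)

lemma wt_sum: "x \<in> T \<Longrightarrow> sum (wt x z) T = 1"
  by (auto simp: T_def wt_def)

lemma wt_in_Delta: "x \<in> T \<Longrightarrow> z \<in> move_set \<Longrightarrow> pt (wt x z) \<in> Delta T"
  by (intro pt_in_Delta wt_nonneg wt_sum)

lemma E_wt:
  assumes "z \<in> move_set" "x \<in> {a, b}"
  shows "E (pt (wt x z)) f = (1 - fst z - snd z) * f x + fst z * f (other x) + snd z * f c"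
  unfolding E_pt[OF wt_nonneg[OF assms(1)]] using assms(2) by (auto simp: T_def wt_def other_def)

lemma E_wt_c:
  assumes "z \<in> move_set" shows "E (pt (wt c z)) f = f c"
  unfolding E_pt[OF wt_nonneg[OF assms]] by (simp add: T_def) (simp add: wt_def)

lemma dirac_wt: "x \<in> T \<Longrightarrow> dirac T x = pt (wt x (0, 0))"
  unfolding dirac_pt by (rule pt_cong) (auto simp: wt_def T_def)

lemma dKR_T_le:
  assumes p: "p \<in> Delta T" "p' \<in> Delta T" shows "dKR T p p' \<le> 1"
proof (rule dKR_le[OF compact_T p])
  fix f :: "'a \<Rightarrow> real" assume f: "1-lipschitz_on T f"
  show "\<bar>E p f - E p' f\<bar> \<le> 1"
  proof (rule lipschitz_integral_le_diam[OF compact_T p _ f])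
    fix s t assume "s \<in> T" "t \<in> T"
    then show "dist s t \<le> 1" using dist_T[of s t] by (cases "s = t") auto
  qed
qed

text \<open>Integrals against these measures are affine in the chosen pair (constant in state
  \<open>c\<close>); this makes the values of the house compact.\<close>

lemma continuous_map_wt:
  assumes P: "P \<subseteq> move_set" and x: "x \<in> T"
  shows "continuous_map (top_of_set P) (weak_star T) (\<lambda>z. pt (wt x z))"
  unfolding weak_star_def
proof (rule continuous_on_generated_topo)
  let ?S = "{{p \<in> Delta T. E p f \<in> U} |f U. continuous_on T f \<and> open U}"
  have "\<Union>?S = Delta T"
    using topspace_weak_star[of T] unfolding weak_star_def by (simp only: topology_generated_by_topspace)
  then show "(\<lambda>z. pt (wt x z)) ` topspace (top_of_set P) \<subseteq> \<Union>?S"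
    using wt_in_Delta[OF x] P by auto
  fix B assume "B \<in> ?S"
  then obtain f U where B: "B = {p \<in> Delta T. E p f \<in> U}" "open U" by auto
  let ?g = "\<lambda>z. E (pt (wt x z)) f"
  have "continuous_on P ?g"
  proof (cases "x = c")
    case True
    then have "?g z = f c" if "z \<in> P" for z using E_wt_c[of z f] P that by auto
    then show ?thesis by (simp add: continuous_on_cong[OF refl])
  next
    case False
    then have "?g z = (1 - fst z - snd z) * f x + fst z * f (other x) + snd z * f c" if "z \<in> P" for z
      using E_wt[of z x f] P that x by (auto simp: T_def)
    then show ?thesis by (subst continuous_on_cong[OF refl]) (auto intro!: continuous_intros)
  qed
  then have "openin (top_of_set P) (P \<inter> ?g -` U)" by (rule continuous_openin_preimage_gen[OF _ B(2)])
  moreover have "(\<lambda>z. pt (wt x z)) -` B \<inter> topspace (top_of_set P) = P \<inter> ?g -` U"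
    using wt_in_Delta[OF x] P by (auto simp: B(1))
  ultimately show "openin (top_of_set P) ((\<lambda>z. pt (wt x z)) -` B \<inter> topspace (top_of_set P))" by simp
qed

text \<open>Distinct states are at distance 1, and no two probabilities on \<open>T\<close> are
  further apart than 1, so nonexpansiveness only has content when the states coincide.\<close>

lemma gambling_house_house:
  assumes P: "P \<subseteq> move_set" "compact P" "convex P" "(0, 0) \<in> P"
  shows "gambling_house T (house P)"
  unfolding gambling_house_def
proof (intro conjI ballI)
  fix x assume x: "x \<in> T"
  show sub: "house P x \<subseteq> Delta T" using wt_in_Delta[OF x] P(1) by (auto simp: house_def)
  show "house P x \<noteq> {}" using P(4) by (auto simp: house_def)
  show "dirac T x \<in> house P x" unfolding dirac_wt[OF x] house_def using P(4) by blast
  have "compactin (top_of_set P) P" using P(2) by (simp add: compactin_subtopology)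
  from image_compactin[OF this continuous_map_wt[OF P(1) x]]
  show "compactin (weak_star T) (house P x)" by (simp add: house_def)
  show "convex_measures (house P x)"
    unfolding convex_measures_def
  proof (intro ballI)
    fix p q and t :: real assume "p \<in> house P x" "q \<in> house P x" and t: "t \<in> {0..1}"
    then obtain z z' where z: "z \<in> P" "p = pt (wt x z)" "z' \<in> P" "q = pt (wt x z')" by (auto simp: house_def)
    let ?z = "(1-t) *\<^sub>R z + t *\<^sub>R z'"
    have "mix t p q = pt (\<lambda>s. (1-t) * wt x z s + t * wt x z' s)"
      unfolding z(2,4) using z(1,3) P(1) by (intro mix_pt wt_nonneg t) auto
    also have "\<dots> = pt (wt x ?z)" by (rule pt_cong) (auto simp: wt_def indicator_def algebra_simps)
    finally show "mix t p q \<in> house P x"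
      using convexD_alt[OF P(3) z(1,3), of t] t by (auto simp: house_def)
  qed
next
  fix x x' p assume *: "x \<in> T" "x' \<in> T" "p \<in> house P x"
  have sub: "house P y \<subseteq> Delta T" if "y \<in> T" for y using wt_in_Delta[OF that] P(1) by (auto simp: house_def)
  show "\<exists>p'\<in>house P x'. dKR T p p' \<le> dist x x'"
  proof (cases "x = x'")
    case True
    have "p \<in> Delta T" using sub * by blast
    then have "dKR T p p \<le> 0" by (intro dKR_le[OF compact_T]) auto
    then show ?thesis using True *(3) by auto
  next
    case False
    obtain z where "z \<in> P" using P(4) by blast
    then have "pt (wt x' z) \<in> house P x'" by (simp add: house_def)
    then show ?thesis using dKR_T_le sub * dist_T[OF *(1,2) False] by (intro bexI[of _ "pt (wt x' z)"]) auto
  qed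
qed

lemma bdd_measurable_T: "bdd_measurable T f"
  by (rule continuous_bdd_measurable[OF compact_T continuous_T])

lemma eventually_at_T: "s \<in> T \<Longrightarrow> \<forall>\<^sub>F s' in at s within T. Q s'"
  unfolding eventually_at using dist_T by (intro exI[of _ 1]) force

lemma wt_eq_dirac:
  assumes P: "P \<subseteq> move_set" and x: "x \<in> {a, b}" and z: "z \<in> P" "snd z \<le> 0"
  shows "pt (wt x z) = dirac T x"
proof -
  have m: "z \<in> move_set" using P z(1) by blast
  have "(fst z)\<^sup>2 \<le> 0" "snd z = 0" using move_setD[OF m] z(2) by auto
  then have "z = (0, 0)" by (auto simp: prod_eq_iff)
  then show ?thesis using x dirac_wt by auto
qed

text \<open>The risk of absorption is the potential: \<open>\<gamma> \<ge> \<alpha>\<^sup>2\<close>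
  makes it positive for every move except staying put. All functions on the finite set
  \<open>T\<close> are semicontinuous.\<close>

lemma acyclic_house:
  assumes P: "P \<subseteq> move_set" "(0, 0) \<in> P"
  shows "acyclic_max T (house P)" "acyclic_min T (house P)"
proof -
  let ?\<phi> = "\<lambda>s. if s = c then 0 else 1::real" and ?\<psi> = "\<lambda>s. if s = c then 1 else 0::real"
  have ne: "z \<in> move_set" if "z \<in> P" for z using P that by blast
  have E: "E (pt (wt x z)) ?\<phi> = 1 - snd z" "E (pt (wt x z)) ?\<psi> = snd z" if "x \<in> {a, b}" "z \<in> P" for x z
    using that by (auto simp: E_wt ne other_def)
  have nn: "0 \<le> snd z" if "z \<in> P" for z using move_setD(5)[OF ne[OF that]] .
  have c: "house P c = {dirac T c}"
    using P(2) by (auto simp: house_def dirac_pt wt_def fun_eq_iff intro!: pt_cong image_eqI[of _ _ "(0, 0)"])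
  have z0: "dirac T x \<in> house P x" if "x \<in> T" for x
    unfolding dirac_wt[OF that] house_def using P(2) by blast
  have d: "p = dirac T x \<or> E p ?\<phi> < 1" "p = dirac T x \<or> 0 < E p ?\<psi>" if x: "x \<in> {a, b}" and p: "p \<in> house P x" for x p
  proof -
    obtain z where z: "z \<in> P" "p = pt (wt x z)" using p by (auto simp: house_def)
    show "p = dirac T x \<or> E p ?\<phi> < 1" "p = dirac T x \<or> 0 < E p ?\<psi>"
      using wt_eq_dirac[OF P(1) x z(1)] E[OF x z(1)] z(2) by fastforce+
  qed
  have d0: "E (dirac T x) ?\<phi> = 1" "E (dirac T x) ?\<psi> = 0" if "x \<in> {a, b}" for x
    using that by (auto simp: integral_dirac_cont continuous_T)
  have "{p. is_arg_max (\<lambda>p. E p ?\<phi>) (\<lambda>p. p \<in> house P x) p} = {dirac T x}"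
    "{p. is_arg_min (\<lambda>p. E p ?\<psi>) (\<lambda>p. p \<in> house P x) p} = {dirac T x}" if x: "x \<in> T" for x
  proof -
    have "is_arg_max (\<lambda>p. E p ?\<phi>) (\<lambda>p. p \<in> house P x) p \<longleftrightarrow> p = dirac T x" for p
    proof (cases "x = c")
      case False
      then have x': "x \<in> {a, b}" using x by (auto simp: T_def)
      show ?thesis
        unfolding is_arg_max_def using d(1)[OF x'] d0(1)[OF x'] z0[OF x] by (metis less_asym' less_irrefl)
    qed (auto simp: is_arg_max_def c)
    then show "{p. is_arg_max (\<lambda>p. E p ?\<phi>) (\<lambda>p. p \<in> house P x) p} = {dirac T x}" by auto
    have "is_arg_min (\<lambda>p. E p ?\<psi>) (\<lambda>p. p \<in> house P x) p \<longleftrightarrow> p = dirac T x" for p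
    proof (cases "x = c")
      case False
      then have x': "x \<in> {a, b}" using x by (auto simp: T_def)
      show ?thesis
        unfolding is_arg_min_def using d(2)[OF x'] d0(2)[OF x'] z0[OF x] by (metis less_asym' less_irrefl)
    qed (auto simp: is_arg_min_def c)
    then show "{p. is_arg_min (\<lambda>p. E p ?\<psi>) (\<lambda>p. p \<in> house P x) p} = {dirac T x}" by auto
  qed
  then show "acyclic_max T (house P)" "acyclic_min T (house P)"
    unfolding acyclic_max_def acyclic_min_def lsc_on_def usc_on_def
    using bdd_measurable_T eventually_at_T by blast+
qed

end

section \<open>Oscillating values\<close>

lemma compact_move_set: "compact move_set"
proof -
  have "closed {z :: real \<times> real. (fst z)\<^sup>2 \<le> snd z}" "closed {z :: real \<times> real. snd z \<le> fst z}"
    by (intro closed_Collect_le continuous_intros)+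
  then have "compact (({0..1/4} \<times> {0..1}) \<inter> ({z :: real \<times> real. (fst z)\<^sup>2 \<le> snd z} \<inter> {z. snd z \<le> fst z}))"
    by (intro compact_Int_closed compact_Times closed_Int) auto
  also have "(({0..1/4} \<times> {0..1}) \<inter> ({z :: real \<times> real. (fst z)\<^sup>2 \<le> snd z} \<inter> {z. snd z \<le> fst z})) = move_set"
    by (auto simp: move_set_def intro: order.trans[OF zero_le_power2])
  finally show ?thesis .
qed

lemma convex_move_set: "convex move_set"
proof (rule convexI)
  fix z z' :: "real \<times> real" and r s :: real
  assume z: "z \<in> move_set" "z' \<in> move_set" and rs: "0 \<le> r" "0 \<le> s" "r + s = 1"
  note m = move_setD[OF z(1)] move_setD[OF z(2)]
  have "(r * fst z + s * fst z')\<^sup>2 = r * (fst z)\<^sup>2 + s * (fst z')\<^sup>2 - r * s * (fst z - fst z')\<^sup>2"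
    using rs(3) by algebra
  also have "\<dots> \<le> r * (fst z)\<^sup>2 + s * (fst z')\<^sup>2" using rs by simp
  also have "\<dots> \<le> r * snd z + s * snd z'" using m rs by (intro add_mono mult_left_mono)
  finally have "(r * fst z + s * fst z')\<^sup>2 \<le> r * snd z + s * snd z'" .
  moreover have "r * snd z + s * snd z' \<le> r * fst z + s * fst z'" using m rs by (intro add_mono mult_left_mono)
  moreover have "r * fst z + s * fst z' \<le> 1/4" using m rs by (intro convex_bound_le)
  moreover have "0 \<le> r * fst z + s * fst z'" using m rs by simp
  ultimately show "r *\<^sub>R z + s *\<^sub>R z' \<in> move_set" by (simp add: move_set_def split_def)
qed

lemma zero_in_move_set: "(0, 0) \<in> move_set" by (simp add: move_set_def)

lemma chord_set_subset: "chord_set \<subseteq> move_set" by (auto simp: chord_set_def)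

lemma zero_in_chord_set: "(0, 0) \<in> chord_set" by (simp add: chord_set_def zero_in_move_set)

lemma chord_set_eq: "chord_set = move_set \<inter> (\<Inter>n::nat. {z. 5 * (1/4)^n * fst z - 4 * ((1/4)^n)\<^sup>2 \<le> snd z})"
  by (auto simp: chord_set_def)

lemma compact_chord_set: "compact chord_set"
  unfolding chord_set_eq
  by (intro compact_Int_closed compact_move_set closed_INT ballI closed_Collect_le continuous_intros)

lemma convex_chord_set: "convex chord_set"
  unfolding chord_set_eq
proof (intro convex_Int convex_move_set convex_INT)
  fix n :: nat
  have "{z :: real \<times> real. 5 * (1/4)^n * fst z - 4 * ((1/4)^n)\<^sup>2 \<le> snd z}
      = {z. inner (5 * (1/4)^n, - 1) z \<le> 4 * ((1/4)^n)\<^sup>2}"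
    by (auto simp: inner_prod_def)
  then show "convex {z :: real \<times> real. 5 * (1/4)^n * fst z - 4 * ((1/4)^n)\<^sup>2 \<le> snd z}"
    by (simp add: convex_halfspace_le)
qed

text \<open>The chord of the parabola between abscissas \<open>s\<close> and \<open>4 * s\<close> is
  \<open>5 * s * \<alpha> - 4 * s\<^sup>2\<close>, and at \<open>t\<close> the parabola exceeds it
  by \<open>(t - s) * (t - 4 * s)\<close>. No power of 1/4 lies strictly between
  \<open>s = (1/4)^n\<close> and \<open>4 * s\<close>.\<close>

lemma parabola_in_chord_set: "((1/4)^Suc m, ((1/4)^Suc m)\<^sup>2) \<in> chord_set"
proof -
  define t :: real where "t = (1/4)^Suc m"
  have t: "0 < t" "t \<le> 1/4" by (auto simp: t_def power_le_one)
  have "t\<^sup>2 \<le> t" using t by (simp add: power2_eq_square mult_left_le)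
  then have "(t, t\<^sup>2) \<in> move_set" using t by (simp add: move_set_def)
  moreover have "5 * (1/4)^n * t - 4 * ((1/4)^n)\<^sup>2 \<le> t\<^sup>2" for n
  proof -
    define s :: real where "s = (1/4)^n"
    have "0 \<le> (t - s) * (t - 4 * s)"
    proof (cases "n \<le> Suc m")
      case True
      then have "t \<le> s" unfolding t_def s_def by (intro power_decreasing) auto
      moreover have "0 < s" by (simp add: s_def)
      ultimately show ?thesis by (intro mult_nonpos_nonpos) auto
    next
      case False
      then have "(1/4::real)^n \<le> (1/4)^Suc (Suc m)" by (intro power_decreasing) auto
      then have "4 * s \<le> t" by (simp add: s_def t_def)
      moreover have "0 < s" by (simp add: s_def)
      ultimately show ?thesis by (intro mult_nonneg_nonneg) auto
    qed
    then show ?thesis unfolding s_def[symmetric] by (simp add: algebra_simps power2_eq_square)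
  qed
  ultimately show ?thesis by (simp add: chord_set_def t_def)
qed

text \<open>The maximum over \<open>P\<close> of
  \<open>(1 - l) * \<alpha> / (l + (1 - l) * \<gamma>)\<close>, written without division. It
  measures how much a player gains by repeating one move until it succeeds, against discounting and
  absorption.\<close>

definition best_ratio :: "(real \<times> real) set \<Rightarrow> real \<Rightarrow> real \<Rightarrow> bool" where
  "best_ratio P l k \<longleftrightarrow> 0 \<le> k \<and> (\<forall>z\<in>P. (1 - l) * fst z \<le> k * (l + (1 - l) * snd z)) \<and>
     (\<exists>z\<in>P. (1 - l) * fst z = k * (l + (1 - l) * snd z))"

lemma best_ratio_exists:
  assumes P: "P \<subseteq> move_set" "compact P" "P \<noteq> {}" and l: "l \<in> {0<..1}"
  shows "\<exists>k. best_ratio P l k"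
proof -
  have pos: "0 < l + (1 - l) * snd z" if "z \<in> P" for z
    using l move_setD(5)[of z] P(1) that by (intro add_pos_nonneg) auto
  let ?g = "\<lambda>z. (1 - l) * fst z / (l + (1 - l) * snd z)"
  have "continuous_on P ?g" by (intro continuous_intros) (use pos in force)
  then obtain z0 where z0: "z0 \<in> P" "\<And>z. z \<in> P \<Longrightarrow> ?g z \<le> ?g z0"
    using continuous_attains_sup[OF P(2,3)] by blast
  have "best_ratio P l (?g z0)"
    unfolding best_ratio_def
  proof (intro conjI ballI bexI[OF _ z0(1)])
    show "0 \<le> ?g z0" using pos[OF z0(1)] l move_setD(1)[of z0] P(1) z0(1) by auto
    show "(1 - l) * fst z0 = ?g z0 * (l + (1 - l) * snd z0)" using pos[OF z0(1)] by simp
    fix z assume z: "z \<in> P"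
    show "(1 - l) * fst z \<le> ?g z0 * (l + (1 - l) * snd z)"
      using z0(2)[OF z] pos[OF z] by (simp add: pos_divide_le_eq)
  qed
  then show ?thesis ..
qed

text \<open>With \<open>m = l / (1 - l)\<close>, that is \<open>l = m / (1 + m)\<close>, the ratio
  becomes \<open>\<alpha> / (m + \<gamma>)\<close>.\<close>

lemma best_ratio_lower:
  assumes k: "best_ratio P (m / (1 + m)) k" and m: "0 < m" and z: "z \<in> P"
  shows "fst z \<le> k * (m + snd z)"
proof -
  have "1 - m / (1 + m) = 1 / (1 + m)" using m by (simp add: field_simps)
  then have "1 / (1 + m) * fst z \<le> k * (m / (1 + m) + 1 / (1 + m) * snd z)"
    using k z unfolding best_ratio_def by metis
  also have "\<dots> = 1 / (1 + m) * (k * (m + snd z))" by (simp add: algebra_simps add_divide_distrib)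
  finally show ?thesis using m by (subst (asm) mult_le_cancel_left_pos) auto
qed

text \<open>If the line of slope \<open>s\<close> through \<open>(0, -m)\<close> passes below
  \<open>P\<close>, then \<open>\<alpha> / (m + \<gamma>)\<close> is at most \<open>1 / s\<close>
  for positive \<open>s\<close>.\<close>

lemma best_ratio_upper:
  assumes k: "best_ratio P (m / (1 + m)) k" and m: "0 < m" and P: "P \<subseteq> move_set"
    and s: "\<And>z. z \<in> P \<Longrightarrow> s * fst z \<le> m + snd z"
  shows "k * s \<le> 1"
proof -
  have m': "1 - m / (1 + m) = 1 / (1 + m)" using m by (simp add: field_simps)
  obtain z where z: "z \<in> P" "1 / (1 + m) * fst z = k * (m / (1 + m) + 1 / (1 + m) * snd z)" and k0: "0 \<le> k"
    using k unfolding best_ratio_def m' by blast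
  have "1 / (1 + m) * fst z = 1 / (1 + m) * (k * (m + snd z))"
    using z(2) by (simp add: algebra_simps add_divide_distrib)
  then have eq: "fst z = k * (m + snd z)" using m by (subst (asm) mult_cancel_left) auto
  note D = move_setD[OF subsetD[OF P z(1)]]
  show ?thesis
  proof (cases "fst z = 0")
    case True
    then have "k = 0" using eq m D(5) by auto
    then show ?thesis by simp
  next
    case False
    have "k * (s * fst z) \<le> k * (m + snd z)" using s[OF z(1)] k0 by (intro mult_left_mono)
    then have "(k * s) * fst z \<le> 1 * fst z" using eq by (simp add: mult.assoc)
    then show ?thesis using False D(1) by (subst (asm) mult_le_cancel_right_pos) auto
  qed
qed

text \<open>Along \<open>\<lambda>/(1-\<lambda>) = t\<^sup>2\<close> with \<open>t = 4 ^ -n\<close> both ratios are \<open>1/(2t)\<close>; along \<open>\<lambda>/(1-\<lambda>) = (2t)\<^sup>2\<close> the first player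
  suffers from the missing arcs of the parabola.\<close>

lemma value_oscillates:
  assumes k1: "\<And>l. l \<in> {0<..1} \<Longrightarrow> best_ratio chord_set l (k1 l)"
    and k2: "\<And>l. l \<in> {0<..1} \<Longrightarrow> best_ratio move_set l (k2 l)"
  shows "\<not> ((\<lambda>l. k1 l / (1 + k1 l + k2 l)) \<longlongrightarrow> L) (at_right 0)"
proof
  let ?D = "\<lambda>l. k1 l / (1 + k1 l + k2 l)"
  assume lim: "(?D \<longlongrightarrow> L) (at_right 0)"
  \<comment> \<open>Starting at 1/16 leaves room for the move with \<open>\<alpha> = 2 * t n\<close>
    in \<open>move_set\<close>.\<close>
  define t :: "nat \<Rightarrow> real" where "t n = (1/4)^Suc (Suc n)" for n
  have t: "0 < t n" "t n \<le> 1/16" for n by (auto simp: t_def power_le_one)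
  have t0: "t \<longlonglongrightarrow> 0"
    unfolding t_def by (intro LIMSEQ_Suc LIMSEQ_realpow_zero) auto
  have conv: "(\<lambda>n. ?D (m n / (1 + m n))) \<longlonglongrightarrow> L" if m: "\<And>n. 0 < m n" "m \<longlonglongrightarrow> 0" for m :: "nat \<Rightarrow> real"
  proof -
    have "(\<lambda>n. m n / (1 + m n)) \<longlonglongrightarrow> 0 / (1 + 0)" by (intro tendsto_intros m(2)) simp
    moreover have "0 < m n / (1 + m n)" for n using m(1)[of n] by simp
    ultimately have "filterlim (\<lambda>n. m n / (1 + m n)) (at_right 0) sequentially"
      by (intro tendsto_imp_filterlim_at_right) auto
    from filterlim_compose[OF lim this] show ?thesis .
  qed
  have I: "m / (1 + m) \<in> {0<..1}" if "0 < m" for m :: real using that by simp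
  have pos1: "0 < (t n)\<^sup>2" and pos2: "0 < 4 * (t n)\<^sup>2" for n using t[of n] by auto
  have half: "?D ((t n)\<^sup>2 / (1 + (t n)\<^sup>2)) = 1 / (2 + 2 * t n)" for n
  proof -
    let ?l = "(t n)\<^sup>2 / (1 + (t n)\<^sup>2)"
    \<comment> \<open>Common to both players: the upper bound uses only that the set lies above the
      parabola (via \<open>2 * t * \<alpha> \<le> t\<^sup>2 + \<alpha>\<^sup>2\<close>), the lower
      bound only the point \<open>(t, t\<^sup>2)\<close>.\<close>
    have val: "k = 1 / (2 * t n)" if k: "best_ratio P ?l k" and P: "P \<subseteq> move_set" "chord_set \<subseteq> P" for k P
    proof -
      have "k * (2 * t n) \<le> 1"
      proof (rule best_ratio_upper[OF k pos1 P(1)])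
        fix z assume "z \<in> P"
        then have "(fst z)\<^sup>2 \<le> snd z" using P(1) move_setD(3) by blast
        moreover have "0 \<le> (t n - fst z)\<^sup>2" by simp
        ultimately show "2 * t n * fst z \<le> (t n)\<^sup>2 + snd z" by (simp add: power2_diff)
      qed
      moreover have "(t n, (t n)\<^sup>2) \<in> P" using parabola_in_chord_set[of "Suc n"] P(2) by (auto simp: t_def)
      from best_ratio_lower[OF k pos1 this] have "t n * 1 \<le> t n * (k * (2 * t n))"
        by (simp add: power2_eq_square algebra_simps)
      then have "1 \<le> k * (2 * t n)" using t[of n] by (subst (asm) mult_le_cancel_left_pos) auto
      ultimately have "k * (2 * t n) = 1" by simp
      then show ?thesis using t[of n] by (simp add: field_simps)
    qed
    have kk: "k1 ?l = 1 / (2 * t n)" "k2 ?l = 1 / (2 * t n)"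
      using val[OF k1[OF I[OF pos1]]] val[OF k2[OF I[OF pos1]]] chord_set_subset by auto
    show ?thesis unfolding kk using t[of n] by (simp add: field_simps)
  qed
  have "(\<lambda>n. (t n)\<^sup>2) \<longlonglongrightarrow> 0\<^sup>2" by (intro tendsto_intros t0)
  then have sq0: "(\<lambda>n. (t n)\<^sup>2) \<longlonglongrightarrow> 0" by simp
  have "(\<lambda>n. 1 / (2 + 2 * t n)) \<longlonglongrightarrow> 1 / (2 + 2 * 0)" by (intro tendsto_intros t0) simp
  then have "L = 1/2" using LIMSEQ_unique[OF conv[OF pos1 sq0]] half by simp
  moreover have "?D (4 * (t n)\<^sup>2 / (1 + 4 * (t n)\<^sup>2)) \<le> 4/9" for n
  proof -
    let ?l = "4 * (t n)\<^sup>2 / (1 + 4 * (t n)\<^sup>2)"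
    note b1 = k1[OF I[OF pos2[of n]]] and b2 = k2[OF I[OF pos2[of n]]]
    \<comment> \<open>For \<open>m = 4 * t\<^sup>2\<close> the line of slope \<open>5 * t\<close>
      through \<open>(0, -m)\<close> is exactly the chord between \<open>t\<close> and
      \<open>4 * t\<close>.\<close>
    have "k1 ?l * (5 * t n) \<le> 1"
    proof (rule best_ratio_upper[OF b1 pos2 chord_set_subset])
      fix z assume z: "z \<in> chord_set"
      then have "5 * (1/4)^Suc (Suc n) * fst z - 4 * ((1/4)^Suc (Suc n))\<^sup>2 \<le> snd z"
        unfolding chord_set_eq by blast
      then show "5 * t n * fst z \<le> 4 * (t n)\<^sup>2 + snd z" unfolding t_def by linarith
    qed
    \<comment> \<open>Player 2 can use the optimum of the full parabola at
      \<open>sqrt m = 2 * t\<close>, with ratio \<open>1 / (4 * t)\<close>. The quotient 4/5 of the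
      two ratios is the source of the bound 4/9.\<close>
    moreover have "(2 * t n, (2 * t n)\<^sup>2) \<in> move_set"
      using t[of n] by (simp add: move_set_def power2_eq_square)
    from best_ratio_lower[OF b2 pos2 this] have "2 * t n * 1 \<le> 2 * t n * (k2 ?l * (4 * t n))"
      by (simp add: power2_eq_square algebra_simps)
    then have "1 \<le> k2 ?l * (4 * t n)" using t[of n] by (subst (asm) mult_le_cancel_left_pos) auto
    ultimately have "t n * (5 * k1 ?l) \<le> t n * (4 * k2 ?l)" by (simp add: algebra_simps)
    then have "5 * k1 ?l \<le> 4 * k2 ?l" using t[of n] by (subst (asm) mult_le_cancel_left_pos) auto
    moreover have "0 \<le> k1 ?l" "0 \<le> k2 ?l" using b1 b2 by (auto simp: best_ratio_def)
    ultimately show ?thesis by (simp add: pos_divide_le_eq)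
  qed
  moreover have "(\<lambda>n. 4 * (t n)\<^sup>2) \<longlonglongrightarrow> 4 * 0" by (intro tendsto_intros sq0)
  then have "(\<lambda>n. ?D (4 * (t n)\<^sup>2 / (1 + 4 * (t n)\<^sup>2))) \<longlonglongrightarrow> L" using conv[OF pos2] by simp
  ultimately show False using LIMSEQ_le_const2[of _ L "4/9"] by fastforce
qed

section \<open>Explicit solution of the three-point game\<close>

context triangle
begin

definition pay :: "'a \<times> 'a \<Rightarrow> real" where
  "pay = (\<lambda>(x, y). if x = c then 0 else if y = c \<or> x = y then 1 else 0)"

text \<open>An ansatz: apart from absorption, only equality of the states matters. \<open>d\<close>
  and \<open>e\<close> are what players 1 and 2 obtain beyond the worst outcome when the current
  position is against them.\<close>

definition val :: "real \<Rightarrow> real \<Rightarrow> 'a \<times> 'a \<Rightarrow> real" where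
  "val d e = (\<lambda>(x, y). if x = c then 0 else if y = c then 1 else if x = y then 1 - e else d)"

lemma other_simps [simp]: "other a = b" "other b = a"
  by (auto simp: other_def)

lemma standard_game:
  assumes "P \<subseteq> move_set" "compact P" "convex P" "(0, 0) \<in> P" "Q \<subseteq> move_set" "compact Q" "convex Q" "(0, 0) \<in> Q"
  shows "standard_gambling_game T T (house P) (house Q) pay"
  unfolding standard_gambling_game_def
  using assms T_mem(1) by (intro conjI compact_T continuous_TT gambling_house_house) blast+

lemma bilin_wt:
  assumes "z \<in> move_set" "z' \<in> move_set" "x \<in> {a, b}" "y \<in> {a, b}"
  shows "bilin v (pt (wt x z)) (pt (wt y z')) =
    (1 - fst z' - snd z') * ((1 - fst z - snd z) * v (x, y) + fst z * v (other x, y) + snd z * v (c, y)) +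
    fst z' * ((1 - fst z - snd z) * v (x, other y) + fst z * v (other x, other y) + snd z * v (c, other y)) +
    snd z' * ((1 - fst z - snd z) * v (x, c) + fst z * v (other x, c) + snd z * v (c, c))"
  unfolding bilin_def E_wt[OF assms(1,3)] E_wt[OF assms(2,4)] ..

text \<open>Only the player disadvantaged by the position moves, with a pair of best ratio; the
  other one stays put. At unequal states this reads
  \<open>d = (1 - l) * (d + \<alpha> * \<Delta> - \<gamma> * d)\<close>, that is
  \<open>d = k1 * \<Delta>\<close>; at equal states likewise \<open>e = k2 * \<Delta>\<close>.
  Together with \<open>d + e + \<Delta> = 1\<close> this fixes \<open>\<Delta>\<close>.\<close>

lemma discounted_value_val:
  assumes P: "P \<subseteq> move_set" "compact P" "convex P" "(0, 0) \<in> P"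
    and Q: "Q \<subseteq> move_set" "compact Q" "convex Q" "(0, 0) \<in> Q"
    and l: "l \<in> {0<..1}" and k1: "best_ratio P l k1" and k2: "best_ratio Q l k2"
  shows "discounted_value T T (house P) (house Q) pay l (val (k1 / (1 + k1 + k2)) (k2 / (1 + k1 + k2)))"
proof -
  define \<Delta> where "\<Delta> = 1 / (1 + k1 + k2)"
  define d where "d = k1 * \<Delta>"
  define e where "e = k2 * \<Delta>"
  have k: "0 \<le> k1" "0 \<le> k2" using k1 k2 by (auto simp: best_ratio_def)
  have \<Delta>: "0 < \<Delta>" "\<Delta> * (1 + k1 + k2) = 1" using k by (auto simp: \<Delta>_def)
  have de: "0 \<le> d" "0 \<le> e" "1 - e = d + \<Delta>"
    using k \<Delta> by (auto simp: d_def e_def algebra_simps)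
  let ?w = "val d e"
  have w_eq: "val (k1 / (1 + k1 + k2)) (k2 / (1 + k1 + k2)) = ?w" by (simp add: d_def e_def \<Delta>_def)
  have same: "?w (x, x) = 1 - e" "?w (x, other x) = d" "?w (other x, x) = d" "?w (other x, other x) = 1 - e"
    "?w (x, c) = 1" "?w (other x, c) = 1" "?w (c, y) = 0" if "x \<in> {a, b}" for x y
    using that by (auto simp: val_def)
  have oo: "other (other x) = x" "other x \<in> {a, b}" if "x \<in> {a, b}" for x using that by auto
  have HD: "gambling_house T (house P)" "gambling_house T (house Q)"
    by (rule gambling_house_house[OF P], rule gambling_house_house[OF Q])
  have mins: "\<exists>m. is_min ((\<lambda>q. l * pay (x, y) + (1 - l) * bilin ?w p q) ` house Q y) m"
    if y: "y \<in> T" for x y p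
  proof -
    obtain q where q: "q \<in> house Q y" "\<And>q'. q' \<in> house Q y \<Longrightarrow>
       E q' (\<lambda>y. - E p (\<lambda>x. ?w (x, y))) \<le> E q (\<lambda>y. - E p (\<lambda>x. ?w (x, y)))"
      using compactin_attains_max[OF house_compactin[OF HD(2) y] house_nonempty[OF HD(2) y] continuous_T] by blast
    have "bilin ?w p q \<le> bilin ?w p q'" if "q' \<in> house Q y" for q'
      using q(2)[OF that] by (simp add: bilin_def)
    then show ?thesis
      using q(1) l unfolding is_min_def
      by (intro exI[of _ "l * pay (x, y) + (1 - l) * bilin ?w p q"]) (auto intro!: mult_left_mono)
  qed
  have maxs: "\<exists>m. is_max ((\<lambda>p. l * pay (x, y) + (1 - l) * bilin ?w p q) ` house P x) m"
    if xy: "x \<in> T" "y \<in> T" "q \<in> house Q y" for x y q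
  proof -
    have bil: "bilin ?w p q = E p (\<lambda>x. E q (\<lambda>y. ?w (x, y)))" if "p \<in> house P x" for p
    proof -
      have "p \<in> Delta T" "q \<in> Delta T"
        using house_subset_Delta[OF HD(1) xy(1)] house_subset_Delta[OF HD(2) xy(2)] xy(3) that by blast+
      then show ?thesis
        unfolding bilin_def by (rule integral_swap_Delta[OF compact_T compact_T continuous_TT, symmetric])
    qed
    obtain p where p: "p \<in> house P x" "\<And>p'. p' \<in> house P x \<Longrightarrow>
       E p' (\<lambda>x. E q (\<lambda>y. ?w (x, y))) \<le> E p (\<lambda>x. E q (\<lambda>y. ?w (x, y)))"
      using compactin_attains_max[OF house_compactin[OF HD(1) xy(1)] house_nonempty[OF HD(1) xy(1)] continuous_T] by blast
    show ?thesis
      using p l bil unfolding is_max_def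
      by (intro exI[of _ "l * pay (x, y) + (1 - l) * bilin ?w p q"]) (auto intro!: mult_left_mono)
  qed
  have PQ: "z \<in> move_set" if "z \<in> P \<or> z \<in> Q" for z using that P(1) Q(1) by blast
  have in_house: "pt (wt x z) \<in> house P x" if "z \<in> P" for x z using that by (simp add: house_def)
  have in_house': "pt (wt x z) \<in> house Q x" if "z \<in> Q" for x z using that by (simp add: house_def)
  have saddle: "\<exists>p\<in>house P x. \<exists>q\<in>house Q y.
      (\<forall>p'\<in>house P x. l * pay (x, y) + (1 - l) * bilin ?w p' q \<le> ?w (x, y)) \<and>
      (\<forall>q'\<in>house Q y. ?w (x, y) \<le> l * pay (x, y) + (1 - l) * bilin ?w p q')" if xy: "x \<in> T" "y \<in> T" for x y
  proof -
    consider "x = c" | "x \<in> {a, b}" "y = c" | "x \<in> {a, b}" "y = x" | "x \<in> {a, b}" "y = other x"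
      using xy by (auto simp: T_def)
    then show ?thesis
    proof cases
      case 1
      have "bilin ?w p q = 0" if "p \<in> house P x" for p q
        using that PQ E_wt_c unfolding 1 house_def bilin_def by (auto simp: val_def)
      then show ?thesis
        using in_house[OF P(4), of x] in_house'[OF Q(4), of y]
        by (intro bexI[of _ "pt (wt x (0, 0))"] bexI[of _ "pt (wt y (0, 0))"]) (auto simp: 1 pay_def val_def)
    next
      case 2
      have bil: "bilin ?w (pt (wt x z)) q = 1 - snd z" if zq: "z \<in> P" "q \<in> house Q y" for z q
      proof -
        obtain z' where z': "z' \<in> Q" "q = pt (wt c z')" using zq(2) by (auto simp: house_def 2)
        show ?thesis
          unfolding bilin_def z'(2) E_wt_c[OF PQ[OF disjI2[OF z'(1)]]] E_wt[OF PQ[OF disjI1[OF zq(1)]] 2(1)]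
          by (simp add: same[OF 2(1)])
      qed
      have W: "?w (x, y) = 1" "pay (x, y) = 1" using 2 by (auto simp: val_def pay_def)
      show ?thesis
      proof (intro bexI[OF _ in_house[OF P(4)]] bexI[OF _ in_house'[OF Q(4)]] conjI ballI)
        fix p' assume "p' \<in> house P x"
        then obtain z where z: "z \<in> P" "p' = pt (wt x z)" by (auto simp: house_def)
        have "(1 - l) * (1 - snd z) \<le> (1 - l) * 1"
          using move_setD(5)[OF PQ[OF disjI1[OF z(1)]]] l by (intro mult_left_mono) auto
        then show "l * pay (x, y) + (1 - l) * bilin ?w p' (pt (wt y (0, 0))) \<le> ?w (x, y)"
          unfolding W z(2) bil[OF z(1) in_house'[OF Q(4)]] by simp
      next
        fix q' assume "q' \<in> house Q y"
        then show "?w (x, y) \<le> l * pay (x, y) + (1 - l) * bilin ?w (pt (wt x (0, 0))) q'"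
          unfolding W bil[OF P(4) \<open>q' \<in> house Q y\<close>] by simp
      qed
    next
      case 3
      note s = same[OF 3(1)]
      have W: "?w (x, y) = 1 - e" "pay (x, y) = 1" using 3 by (auto simp: val_def pay_def)
      obtain z2 where z2: "z2 \<in> Q" "(1 - l) * fst z2 = k2 * (l + (1 - l) * snd z2)"
        using k2 unfolding best_ratio_def by blast
      note m2 = move_setD[OF PQ[OF disjI2[OF z2(1)]]]
      \<comment> \<open>The continuation values when player 2 uses \<open>z2\<close> and player 1
        stays, respectively switches.\<close>
      define Vx where "Vx = (1 - fst z2 - snd z2) * (1 - e) + fst z2 * d + snd z2"
      define Vo where "Vo = (1 - fst z2 - snd z2) * d + fst z2 * (1 - e) + snd z2"
      have dev: "bilin ?w (pt (wt x (0, 0))) (pt (wt y z')) = 1 - e - fst z' * \<Delta> + snd z' * e" if "z' \<in> Q" for z'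
        unfolding 3(2) bilin_wt[OF zero_in_move_set PQ[OF disjI2[OF that]] 3(1) 3(1)] s fst_conv snd_conv
        using de(3) by algebra
      show ?thesis
      proof (intro bexI[OF _ in_house[OF P(4)]] bexI[OF _ in_house'[OF z2(1)]] conjI ballI)
        fix p' assume "p' \<in> house P x"
        then obtain z where z: "z \<in> P" "p' = pt (wt x z)" by (auto simp: house_def)
        note m = move_setD[OF PQ[OF disjI1[OF z(1)]]]
        have "bilin ?w p' (pt (wt y z2)) = (1 - fst z - snd z) * Vx + fst z * Vo"
          unfolding 3(2) z(2) bilin_wt[OF PQ[OF disjI1[OF z(1)]] PQ[OF disjI2[OF z2(1)]] 3(1) 3(1)] Vx_def Vo_def s
          by algebra
        also have "\<dots> \<le> Vx"
        proof -
          \<comment> \<open>Moves with \<open>\<alpha> \<le> 1/4\<close> do not reverse the order of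
            the two positions, so staying is the best reply to \<open>z2\<close>.\<close>
          have "Vx - Vo = (1 - 2 * fst z2 - snd z2) * \<Delta>"
            unfolding Vx_def Vo_def de(3) by (simp add: algebra_simps)
          moreover have "0 \<le> (1 - 2 * fst z2 - snd z2) * \<Delta>" using m2 \<Delta> by (intro mult_nonneg_nonneg) auto
          ultimately have "fst z * Vo \<le> fst z * Vx" using m by (intro mult_left_mono) auto
          moreover have "0 \<le> Vx" unfolding Vx_def de(3) using m2 de \<Delta> by (intro add_nonneg_nonneg mult_nonneg_nonneg) auto
          then have "0 \<le> snd z * Vx" using m by simp
          ultimately show ?thesis by (simp add: algebra_simps)
        qed
        finally have "(1 - l) * bilin ?w p' (pt (wt y z2)) \<le> (1 - l) * Vx" using l by (intro mult_left_mono) auto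
        also have "\<dots> = (1 - l) * (1 - e) - ((1 - l) * fst z2) * \<Delta> + (1 - l) * snd z2 * e"
          unfolding Vx_def using de(3) by algebra
        also have "\<dots> = (1 - l) * (1 - e) - l * e" unfolding z2(2) e_def by (simp add: algebra_simps)
        finally show "l * pay (x, y) + (1 - l) * bilin ?w p' (pt (wt y z2)) \<le> ?w (x, y)"
          unfolding W by (simp add: algebra_simps)
      next
        fix q' assume "q' \<in> house Q y"
        then obtain z' where z': "z' \<in> Q" "q' = pt (wt y z')" by (auto simp: house_def)
        have "((1 - l) * fst z') * \<Delta> \<le> (k2 * (l + (1 - l) * snd z')) * \<Delta>"
          using k2 z'(1) \<Delta> unfolding best_ratio_def by (intro mult_right_mono) auto
        also have "\<dots> = l * e + (1 - l) * snd z' * e" unfolding e_def by (simp add: algebra_simps)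
        finally show "?w (x, y) \<le> l * pay (x, y) + (1 - l) * bilin ?w (pt (wt x (0, 0))) q'"
          unfolding W z'(2) dev[OF z'(1)] by (simp add: algebra_simps)
      qed
    next
      case 4
      note s = same[OF 4(1)]
      have W: "?w (x, y) = d" "pay (x, y) = 0" using 4 by (auto simp: val_def pay_def)
      obtain z1 where z1: "z1 \<in> P" "(1 - l) * fst z1 = k1 * (l + (1 - l) * snd z1)"
        using k1 unfolding best_ratio_def by blast
      note m1 = move_setD[OF PQ[OF disjI1[OF z1(1)]]]
      define Vy where "Vy = (1 - fst z1 - snd z1) * d + fst z1 * (1 - e)"
      define Vo where "Vo = (1 - fst z1 - snd z1) * (1 - e) + fst z1 * d"
      have dev: "bilin ?w (pt (wt x z)) (pt (wt y (0, 0))) = d + fst z * \<Delta> - snd z * d" if "z \<in> P" for z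
        unfolding 4(2) bilin_wt[OF PQ[OF disjI1[OF that]] zero_in_move_set 4(1) oo(2)[OF 4(1)]]
          oo(1)[OF 4(1)] s fst_conv snd_conv
        using de(3) by algebra
      show ?thesis
      proof (intro bexI[OF _ in_house[OF z1(1)]] bexI[OF _ in_house'[OF Q(4)]] conjI ballI)
        fix p' assume "p' \<in> house P x"
        then obtain z where z: "z \<in> P" "p' = pt (wt x z)" by (auto simp: house_def)
        have "((1 - l) * fst z) * \<Delta> \<le> (k1 * (l + (1 - l) * snd z)) * \<Delta>"
          using k1 z(1) \<Delta> unfolding best_ratio_def by (intro mult_right_mono) auto
        also have "\<dots> = l * d + (1 - l) * snd z * d" unfolding d_def by (simp add: algebra_simps)
        finally show "l * pay (x, y) + (1 - l) * bilin ?w p' (pt (wt y (0, 0))) \<le> ?w (x, y)"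
          unfolding W z(2) dev[OF z(1)] by (simp add: algebra_simps)
      next
        fix q' assume "q' \<in> house Q y"
        then obtain z where z: "z \<in> Q" "q' = pt (wt y z)" by (auto simp: house_def)
        note m = move_setD[OF PQ[OF disjI2[OF z(1)]]]
        have "d = (1 - l) * d + l * d" by (simp add: algebra_simps)
        also have "\<dots> = (1 - l) * d + ((1 - l) * fst z1) * \<Delta> - (1 - l) * snd z1 * d"
          unfolding z1(2) d_def by (simp add: algebra_simps)
        also have "\<dots> = (1 - l) * Vy" unfolding Vy_def using de(3) by algebra
        also have "\<dots> \<le> (1 - l) * bilin ?w (pt (wt x z1)) q'"
        proof (rule mult_left_mono)
          have "bilin ?w (pt (wt x z1)) q' = (1 - fst z - snd z) * Vy + fst z * Vo + snd z * (1 - snd z1)"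
            unfolding 4(2) z(2) bilin_wt[OF PQ[OF disjI1[OF z1(1)]] PQ[OF disjI2[OF z(1)]] 4(1) oo(2)[OF 4(1)]] Vy_def Vo_def
              oo(1)[OF 4(1)] s by algebra
          moreover have "Vo - Vy = (1 - 2 * fst z1 - snd z1) * \<Delta>"
            unfolding Vy_def Vo_def de(3) by (simp add: algebra_simps)
          then have "Vy \<le> Vo" using m1 \<Delta> mult_nonneg_nonneg[of "1 - 2 * fst z1 - snd z1" \<Delta>] by linarith
          then have "fst z * Vy \<le> fst z * Vo" using m by (intro mult_left_mono) auto
          \<comment> \<open>Absorption of player 2 leaves player 1 with the value
            \<open>1 - snd z1\<close>, the chance of not being absorbed at the same time; this is at
            least \<open>Vy\<close>, so risking it does not help player 2.\<close>
          moreover have "Vy \<le> (1 - fst z1 - snd z1) * 1 + fst z1 * 1"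
            unfolding Vy_def using m1 de \<Delta> by (intro add_mono mult_left_mono) auto
          then have "snd z * Vy \<le> snd z * (1 - snd z1)" using m by (intro mult_left_mono) auto
          ultimately show "Vy \<le> bilin ?w (pt (wt x z1)) q'" by (simp add: algebra_simps)
        qed (use l in simp)
        finally show "?w (x, y) \<le> l * pay (x, y) + (1 - l) * bilin ?w (pt (wt x z1)) q'" unfolding W by simp
      qed
    qed
  qed
  show ?thesis
    unfolding discounted_value_def w_eq
  proof (intro conjI ballI)
    fix x y assume xy: "x \<in> T" "y \<in> T"
    obtain p q where pq: "p \<in> house P x" "q \<in> house Q y"
      "\<And>p'. p' \<in> house P x \<Longrightarrow> l * pay (x, y) + (1 - l) * bilin ?w p' q \<le> ?w (x, y)"
      "\<And>q'. q' \<in> house Q y \<Longrightarrow> ?w (x, y) \<le> l * pay (x, y) + (1 - l) * bilin ?w p q'"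
      using saddle[OF xy] by blast
    show "is_max_min (house P x) (house Q y) (\<lambda>p q. l * pay (x, y) + (1 - l) * bilin ?w p q) (?w (x, y))"
      "is_min_max (house P x) (house Q y) (\<lambda>p q. l * pay (x, y) + (1 - l) * bilin ?w p q) (?w (x, y))"
      by (rule saddle_point_values[OF pq mins[OF xy(2)] maxs[OF xy]]; assumption)+
  qed (rule continuous_TT)
qed

lemma counterexample:
  "\<exists>X Y \<Gamma> \<Lambda> u vl. standard_gambling_game X (Y :: 'a set) (\<Gamma> :: 'a \<Rightarrow> 'a measure set) \<Lambda> u \<and>
      (\<forall>l\<in>{0<..1}. discounted_value X Y \<Gamma> \<Lambda> u l (vl l)) \<and>
      weakly_acyclic1 X \<Gamma> \<and> weakly_acyclic2 Y \<Lambda> \<and>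
      \<not> (\<exists>v. \<forall>z\<in>X \<times> Y. ((\<lambda>l. vl l z) \<longlongrightarrow> v z) (at_right 0))"
proof -
  note P = chord_set_subset compact_chord_set convex_chord_set zero_in_chord_set
  note Q = order.refl[of move_set] compact_move_set convex_move_set zero_in_move_set
  have "\<exists>k. best_ratio chord_set l k" "\<exists>k. best_ratio move_set l k" if "l \<in> {0<..1}" for l
    using P Q that by (blast intro!: best_ratio_exists)+
  then obtain k1 k2 where k: "\<And>l. l \<in> {0<..1} \<Longrightarrow> best_ratio chord_set l (k1 l)"
    "\<And>l. l \<in> {0<..1} \<Longrightarrow> best_ratio move_set l (k2 l)" by metis
  define vl where "vl l = val (k1 l / (1 + k1 l + k2 l)) (k2 l / (1 + k1 l + k2 l))" for l
  have "\<not> (\<exists>v. \<forall>z\<in>T \<times> T. ((\<lambda>l. vl l z) \<longlongrightarrow> v z) (at_right 0))"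
  proof
    assume "\<exists>v. \<forall>z\<in>T \<times> T. ((\<lambda>l. vl l z) \<longlongrightarrow> v z) (at_right 0)"
    then obtain v where v: "\<forall>z\<in>T \<times> T. ((\<lambda>l. vl l z) \<longlongrightarrow> v z) (at_right 0)" by blast
    \<comment> \<open>At unequal states the value is \<open>d = k1 / (1 + k1 + k2)\<close>, the
      quantity shown to oscillate.\<close>
    have "((\<lambda>l. vl l (a, b)) \<longlongrightarrow> v (a, b)) (at_right 0)" using v by (rule bspec) simp
    then show False using value_oscillates[of k1 k2, OF k] by (simp add: vl_def val_def)
  qed
  moreover have "discounted_value T T (house chord_set) (house move_set) pay l (vl l)" if "l \<in> {0<..1}" for l
    unfolding vl_def by (rule discounted_value_val[OF P Q that k[OF that]])
  ultimately show ?thesis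
    using standard_game[OF P Q] acyclic_house(1)[OF P(1,4)] acyclic_house(2)[OF Q(1,4)] by blast
qed

end

text \<open>The zero sequence, the constant sequence 1 and the first unit vector are pairwise at
  sup-distance 1; the last two differ from index 1 on.\<close>

lemma linf_triangle:
  obtains a b c :: linf where "triangle a b c"
proof -
  have bc: "f \<in> bcontfun" if "range f \<subseteq> {0, 1}" for f :: "nat \<Rightarrow> real"
    unfolding bcontfun_def using finite_imp_bounded[OF finite_subset[OF that]] by simp
  define a b c :: linf where "a = Bcontfun (\<lambda>_. 0)" and "b = Bcontfun (\<lambda>_. 1)"
    and "c = Bcontfun (\<lambda>n. if n = 0 then 1 else 0)"
  have app: "apply_bcontfun a = (\<lambda>_. 0)" "apply_bcontfun b = (\<lambda>_. 1)" "apply_bcontfun c = (\<lambda>n. if n = 0 then 1 else 0)"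
    unfolding a_def b_def c_def by (rule Bcontfun_inverse, rule bc, auto)+
  have D: "dist f g = 1" if "\<And>n. dist (apply_bcontfun f n) (apply_bcontfun g n) \<le> 1"
    "dist (apply_bcontfun f m) (apply_bcontfun g m) = 1" for f g :: linf and m
    using that dist_bounded[of f m g] by (intro antisym dist_bound) auto
  have "triangle a b c"
    by unfold_locales (rule D[where m = 0] D[where m = 1]; simp add: app)+
  then show thesis by (rule that)
qed

theorem theorem3p3:
  shows "(\<forall>(X :: 'a::metric_space set) (Y :: 'b::metric_space set) \<Gamma> \<Lambda> u v\<^sub>l.
      standard_gambling_game X Y \<Gamma> \<Lambda> u \<and>
      (\<forall>l\<in>{0<..1}. discounted_value X Y \<Gamma> \<Lambda> u l (v\<^sub>l l)) \<and>
      (strongly_acyclic1 X \<Gamma> \<or> strongly_acyclic2 Y \<Lambda>) \<longrightarrow>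
      (\<exists>v. uniform_limit (X \<times> Y) v\<^sub>l v (at_right 0) \<and>
         (continuous_on (X \<times> Y) v \<and> excessive X Y \<Gamma> v \<and> depressive X Y \<Lambda> v \<and>
          P1 X Y \<Gamma> u v \<and> P2 X Y \<Lambda> u v) \<and>
         (\<forall>w. continuous_on (X \<times> Y) w \<and> excessive X Y \<Gamma> w \<and> depressive X Y \<Lambda> w \<and>
              P1 X Y \<Gamma> u w \<and> P2 X Y \<Lambda> u w \<longrightarrow> (\<forall>z\<in>X \<times> Y. w z = v z)) \<and>
         (\<forall>w. continuous_on (X \<times> Y) w \<and> excessive X Y \<Gamma> w \<and> depressive X Y \<Lambda> w \<and>
              P1 X Y \<Gamma> u w \<longrightarrow> (\<forall>z\<in>X \<times> Y. w z \<le> v z)) \<and>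
         (\<forall>w. continuous_on (X \<times> Y) w \<and> excessive X Y \<Gamma> w \<and> depressive X Y \<Lambda> w \<and>
              P2 X Y \<Lambda> u w \<longrightarrow> (\<forall>z\<in>X \<times> Y. v z \<le> w z))))
    \<and>
    (\<exists>(X :: linf set) (Y :: linf set) \<Gamma> \<Lambda> u v\<^sub>l.
      standard_gambling_game X Y \<Gamma> \<Lambda> u \<and>
      (\<forall>l\<in>{0<..1}. discounted_value X Y \<Gamma> \<Lambda> u l (v\<^sub>l l)) \<and>
      weakly_acyclic1 X \<Gamma> \<and> weakly_acyclic2 Y \<Lambda> \<and>
      \<not> (\<exists>v. \<forall>z\<in>X \<times> Y. ((\<lambda>l. v\<^sub>l l z) \<longlongrightarrow> v z) (at_right 0)))"
proof (intro conjI allI impI)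
  fix X :: "'a set" and Y :: "'b set" and \<Gamma> \<Lambda> u and v\<^sub>l :: "real \<Rightarrow> 'a \<times> 'b \<Rightarrow> real"
  assume A: "standard_gambling_game X Y \<Gamma> \<Lambda> u \<and>
      (\<forall>l\<in>{0<..1}. discounted_value X Y \<Gamma> \<Lambda> u l (v\<^sub>l l)) \<and>
      (strongly_acyclic1 X \<Gamma> \<or> strongly_acyclic2 Y \<Lambda>)"
  interpret game X Y \<Gamma> \<Lambda> u by unfold_locales (use A in blast)
  have vl: "saddle_value X Y \<Gamma> \<Lambda> u l (v\<^sub>l l)" if "l \<in> {0<..1}" for l
    using A that by (intro discounted_imp_saddle_value) blast
  have ac: "strongly_acyclic1 X \<Gamma> \<or> strongly_acyclic2 Y \<Lambda>" using A by blast
  obtain v where v: "uniform_limit (X \<times> Y) v\<^sub>l v (at_right 0)"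
    "continuous_on (X \<times> Y) v" "excessive X Y \<Gamma> v" "depressive X Y \<Lambda> v" "P1 X Y \<Gamma> u v" "P2 X Y \<Lambda> u v"
    using strongly_acyclic_convergence[OF vl ac] by blast
  have below: "w z \<le> v z" if "continuous_on (X \<times> Y) w" "excessive X Y \<Gamma> w" "depressive X Y \<Lambda> w"
    "P1 X Y \<Gamma> u w" "z \<in> X \<times> Y" for w z
    by (rule comparison_strongly_acyclic[OF ac that(1-4) v(2-4,6) that(5)])
  have above: "v z \<le> w z" if "continuous_on (X \<times> Y) w" "excessive X Y \<Gamma> w" "depressive X Y \<Lambda> w"
    "P2 X Y \<Lambda> u w" "z \<in> X \<times> Y" for w z
    by (rule comparison_strongly_acyclic[OF ac v(2-5) that(1-5)])
  show "\<exists>v. uniform_limit (X \<times> Y) v\<^sub>l v (at_right 0) \<and>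
         (continuous_on (X \<times> Y) v \<and> excessive X Y \<Gamma> v \<and> depressive X Y \<Lambda> v \<and>
          P1 X Y \<Gamma> u v \<and> P2 X Y \<Lambda> u v) \<and>
         (\<forall>w. continuous_on (X \<times> Y) w \<and> excessive X Y \<Gamma> w \<and> depressive X Y \<Lambda> w \<and>
              P1 X Y \<Gamma> u w \<and> P2 X Y \<Lambda> u w \<longrightarrow> (\<forall>z\<in>X \<times> Y. w z = v z)) \<and>
         (\<forall>w. continuous_on (X \<times> Y) w \<and> excessive X Y \<Gamma> w \<and> depressive X Y \<Lambda> w \<and>
              P1 X Y \<Gamma> u w \<longrightarrow> (\<forall>z\<in>X \<times> Y. w z \<le> v z)) \<and>
         (\<forall>w. continuous_on (X \<times> Y) w \<and> excessive X Y \<Gamma> w \<and> depressive X Y \<Lambda> w \<and>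
              P2 X Y \<Lambda> u w \<longrightarrow> (\<forall>z\<in>X \<times> Y. v z \<le> w z))"
    \<comment> \<open>Uniqueness follows from the two extremality statements by
      antisymmetry.\<close>
    using v below above by (intro exI[of _ v] conjI allI impI ballI antisym) auto
next
  obtain a b c :: linf where "triangle a b c" by (rule linf_triangle)
  from triangle.counterexample[OF this]
  show "\<exists>(X :: linf set) (Y :: linf set) \<Gamma> \<Lambda> u v\<^sub>l.
      standard_gambling_game X Y \<Gamma> \<Lambda> u \<and>
      (\<forall>l\<in>{0<..1}. discounted_value X Y \<Gamma> \<Lambda> u l (v\<^sub>l l)) \<and>
      weakly_acyclic1 X \<Gamma> \<and> weakly_acyclic2 Y \<Lambda> \<and>
      \<not> (\<exists>v. \<forall>z\<in>X \<times> Y. ((\<lambda>l. v\<^sub>l l z) \<longlongrightarrow> v z) (at_right 0))" .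
qed

end
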